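(* Let $(\Lambda,\pi)$ be an action operad and $P$ a $\Lambda$-operad in $\mathbf{Cat}$. The 2-monad $\underline P$ on $\mathbf{Cat}$ associated to $P$ is (2-)cartesian if and only if, for all $n$, whenever $p\cdot g=p$ for an object $p\in P(n)$ and $g\in\Lambda(n)$, then $g\in\ker(\pi_n:\Lambda(n)\to\Sigma_n)$.
   Context: $\mathbb N\ni 0$; $e_n$ is the identity of $\Lambda(n)$; permutations compose as functions. A (non-symmetric) operad $O$ in sets: sets $O(n)$ ($n\in\mathbb N$), $\mathrm{id}\in O(1)$, functions $\mu:O(n)\times O(k_1)\times\cdots\times O(k_n)\to O(k_1+\cdots+k_n)$, unital and associative in the usual sense; maps preserve $\mathrm{id}$ and $\mu$. The operad $\Sigma$ of symmetric groups has $\mu(\sigma;\tau_1,\dots,\tau_n)=\delta(\sigma)\cdot\beta(\tau_1,\dots,\tau_n)$, with $\beta$ the block sum of the permutations $\tau_i\in\Sigma_{k_i}$ and $\delta(\sigma)=\delta_{n;k_1,\dots,k_n}(\sigma)$ sending $k_1+\cdots+k_{i-1}+a$ ($1\le a\le k_i$) to $(\sum_{\sigma(i')<\sigma(i)}k_{i'})+a$. An action operad $(\Lambda,\pi)$: an operad $\Lambda$ in sets with a group structure on each $\Lambda(n)$ and a map of operads $\pi:\Lambda\to\Sigma$ whose components are group homomorphisms, such that, writing $g(i)=\pi_n(g)(i)$ and $g^{-1}(i)=\pi_n(g)^{-1}(i)$, $\mu(g';f_1',\dots,f_n')\mu(g;f_1,\dots,f_n)=\mu(g'g;f'_{g(1)}f_1,\dots,f'_{g(n)}f_n)$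 for $g,g'\in\Lambda(n)$, $f_i\in\Lambda(k_i)$, $f_i'\in\Lambda(k_{g^{-1}(i)})$. Put $\beta^\Lambda(g_1,\dots,g_n)=\mu(e_n;g_1,\dots,g_n)$ and $\delta^\Lambda_{n;k_1,\dots,k_n}(g)=\mu(g;e_{k_1},\dots,e_{k_n})$. A $\Lambda$-operad $P$ in $\mathbf{Cat}$: small categories $P(n)$, an object $\mathrm{id}\in P(1)$, functors $\mu:P(n)\times P(k_1)\times\cdots\times P(k_n)\to P(k_1+\cdots+k_n)$, strictly unital and associative, with strict right actions of $\Lambda(n)$ on $P(n)$ by functors such that (for objects and morphisms) $\mu(p;q_1\cdot g_1,\dots,q_n\cdot g_n)=\mu(p;q_1,\dots,q_n)\cdot\beta^\Lambda(g_1,\dots,g_n)$ and $\mu(p\cdot g;q_1,\dots,q_n)=\mu(p;q_{g^{-1}(1)},\dots,q_{g^{-1}(n)})\cdot\delta^\Lambda_{n;k_1,\dots,k_n}(g)$. $\underline P(X)=\coprod_nP(n)\otimes_{\Lambda(n)}X^n$, where $\Lambda(n)$ acts on $X^n$ by $g\cdot(x_1,\dots,x_n)=(x_{g^{-1}(1)},\dots,x_{g^{-1}(n)})$ and $P(n)\otimes_{\Lambda(n)}X^n$ is the coequalizer in $\mathbf{Cat}$ of $(p,g,\underline x)\mapsto(p\cdot g,\underline x)$ and $(p,g,\underline x)\mapsto(p,g\cdot\underline x)$; unit $x\mapsto[\mathrm{id};x]$; multiplication $[p;[q_1;\underline{x_1}],\dots,[q_n;\underline{x_n}]]\mapsto[\mu(p;q_1,\dots,q_n);\underline{x_1},\dots,\underline{x_n}]$.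 A 2-monad $T$ on a 2-category with 2-pullbacks is 2-cartesian if $T$ preserves 2-pullbacks up to isomorphism and all naturality squares of the unit and multiplication are 2-pullbacks; in $\mathbf{Cat}$, 2-pullbacks coincide with ordinary (strict) pullbacks. *)

theory Defs
  imports "HOL-Algebra.Sym_Groups"
begin

section \<open>Small categories, functors and natural transformations\<close>

text \<open>
  A small category has a set of objects and a set of arrows, drawn from arbitrary types.
  \<open>Cmp C g f\<close> is the composite of \<open>g\<close> after \<open>f\<close>; it matters only if \<open>Dom C g = Cod C f\<close>.
\<close>

record ('o, 'a) cat =
  Obj :: "'o set"
  Arr :: "'a set"
  Dom :: "'a \<Rightarrow> 'o"
  Cod :: "'a \<Rightarrow> 'o"
  Idt :: "'o \<Rightarrow> 'a"
  Cmp :: "'a \<Rightarrow> 'a \<Rightarrow> 'a"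

definition is_cat :: "('o, 'a) cat \<Rightarrow> bool" where
  "is_cat C \<longleftrightarrow>
     (\<forall>f\<in>Arr C. Dom C f \<in> Obj C \<and> Cod C f \<in> Obj C) \<and>
     (\<forall>x\<in>Obj C. Idt C x \<in> Arr C \<and> Dom C (Idt C x) = x \<and> Cod C (Idt C x) = x) \<and>
     (\<forall>f\<in>Arr C. \<forall>g\<in>Arr C. Dom C g = Cod C f \<longrightarrow>
        Cmp C g f \<in> Arr C \<and> Dom C (Cmp C g f) = Dom C f \<and> Cod C (Cmp C g f) = Cod C g) \<and>
     (\<forall>f\<in>Arr C. Cmp C f (Idt C (Dom C f)) = f \<and> Cmp C (Idt C (Cod C f)) f = f) \<and>
     (\<forall>f\<in>Arr C. \<forall>g\<in>Arr C. \<forall>h\<in>Arr C. Dom C g = Cod C f \<and> Dom C h = Cod C g \<longrightarrow>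
        Cmp C h (Cmp C g f) = Cmp C (Cmp C h g) f)"

record ('o1, 'a1, 'o2, 'a2) ftr =
  FObj :: "'o1 \<Rightarrow> 'o2"
  FArr :: "'a1 \<Rightarrow> 'a2"

definition is_functor ::
    "('o1, 'a1) cat \<Rightarrow> ('o2, 'a2) cat \<Rightarrow> ('o1, 'a1, 'o2, 'a2) ftr \<Rightarrow> bool" where
  "is_functor C D F \<longleftrightarrow>
     (\<forall>x\<in>Obj C. FObj F x \<in> Obj D) \<and>
     (\<forall>f\<in>Arr C. FArr F f \<in> Arr D \<and>
        Dom D (FArr F f) = FObj F (Dom C f) \<and> Cod D (FArr F f) = FObj F (Cod C f)) \<and>
     (\<forall>x\<in>Obj C. FArr F (Idt C x) = Idt D (FObj F x)) \<and>
     (\<forall>f\<in>Arr C. \<forall>g\<in>Arr C. Dom C g = Cod C f \<longrightarrow>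
        FArr F (Cmp C g f) = Cmp D (FArr F g) (FArr F f))"

text \<open>
  Functors are represented by total HOL functions, so two of them with source \<open>C\<close> are the
  same functor if they agree on the objects and arrows of \<open>C\<close>.
\<close>

definition func_eq ::
    "('o1, 'a1) cat \<Rightarrow> ('o1, 'a1, 'o2, 'a2) ftr \<Rightarrow> ('o1, 'a1, 'o2, 'a2) ftr \<Rightarrow> bool" where
  "func_eq C F G \<longleftrightarrow>
     (\<forall>x\<in>Obj C. FObj F x = FObj G x) \<and> (\<forall>f\<in>Arr C. FArr F f = FArr G f)"

definition func_comp ::
    "('o2, 'a2, 'o3, 'a3) ftr \<Rightarrow> ('o1, 'a1, 'o2, 'a2) ftr \<Rightarrow> ('o1, 'a1, 'o3, 'a3) ftr" where
  "func_comp G F = \<lparr>FObj = FObj G \<circ> FObj F, FArr = FArr G \<circ> FArr F\<rparr>"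

definition nat_trans ::
    "('o1, 'a1) cat \<Rightarrow> ('o2, 'a2) cat \<Rightarrow> ('o1, 'a1, 'o2, 'a2) ftr \<Rightarrow> ('o1, 'a1, 'o2, 'a2) ftr
      \<Rightarrow> ('o1 \<Rightarrow> 'a2) \<Rightarrow> bool" where
  "nat_trans C D F G \<alpha> \<longleftrightarrow>
     (\<forall>x\<in>Obj C. \<alpha> x \<in> Arr D \<and> Dom D (\<alpha> x) = FObj F x \<and> Cod D (\<alpha> x) = FObj G x) \<and>
     (\<forall>f\<in>Arr C. Cmp D (\<alpha> (Cod C f)) (FArr F f) = Cmp D (FArr G f) (\<alpha> (Dom C f)))"

definition discrete :: "'x set \<Rightarrow> ('x, 'x) cat" where
  "discrete S = \<lparr>Obj = S, Arr = S, Dom = id, Cod = id, Idt = id, Cmp = (\<lambda>g f. f)\<rparr>"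

definition prod_cat :: "('o1, 'a1) cat \<Rightarrow> ('o2, 'a2) cat \<Rightarrow> ('o1 \<times> 'o2, 'a1 \<times> 'a2) cat" where
  "prod_cat C D =
     \<lparr>Obj = Obj C \<times> Obj D, Arr = Arr C \<times> Arr D,
      Dom = map_prod (Dom C) (Dom D), Cod = map_prod (Cod C) (Cod D),
      Idt = map_prod (Idt C) (Idt D),
      Cmp = (\<lambda>(g, g') (f, f'). (Cmp C g f, Cmp D g' f'))\<rparr>"

text \<open>The product \<open>C\<^sub>1 \<times> \<dots> \<times> C\<^sub>n\<close> of a list of categories, with tuples as lists of length \<open>n\<close>.\<close>

definition tuple_cat :: "('o, 'a) cat list \<Rightarrow> ('o list, 'a list) cat" where
  "tuple_cat Cs =
     \<lparr>Obj = {xs. list_all2 (\<lambda>C x. x \<in> Obj C) Cs xs},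
      Arr = {fs. list_all2 (\<lambda>C f. f \<in> Arr C) Cs fs},
      Dom = map2 Dom Cs, Cod = map2 Cod Cs, Idt = map2 Idt Cs,
      Cmp = (\<lambda>gs fs. map2 (\<lambda>C (g, f). Cmp C g f) Cs (zip gs fs))\<rparr>"

definition coprod_cat :: "('i \<Rightarrow> ('o, 'a) cat) \<Rightarrow> ('i \<times> 'o, 'i \<times> 'a) cat" where
  "coprod_cat C =
     \<lparr>Obj = {(i, x). x \<in> Obj (C i)}, Arr = {(i, f). f \<in> Arr (C i)},
      Dom = (\<lambda>(i, f). (i, Dom (C i) f)), Cod = (\<lambda>(i, f). (i, Cod (C i) f)),
      Idt = (\<lambda>(i, x). (i, Idt (C i) x)),
      Cmp = (\<lambda>(i, g) (j, f). (i, Cmp (C i) g f))\<rparr>"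


section \<open>Coequalizers in Cat\<close>

text \<open>
  The coequalizer of \<open>F, G : C \<rightarrow> D\<close>.  Objects are the classes for the equivalence relation
  generated by \<open>F c \<sim> G c\<close>.  Arrows of \<open>D\<close> that are not composable may become composable
  after this identification, so arrows are classes of nonempty paths of arrows of \<open>D\<close> (first
  arrow first) that match up to \<open>\<sim>\<close>, modulo the congruence generated by composition in \<open>D\<close> and
  \<open>F c \<sim> G c\<close>.  No separate rule for identities is needed, because they can be absorbed into a
  neighbouring arrow by the composition rule.  Note that for a group action this is in general
  coarser than the set of orbits of arrows.
\<close>

inductive coeq_obj ::
    "('o1, 'a1) cat \<Rightarrow> ('o2, 'a2) cat \<Rightarrow> ('o1, 'a1, 'o2, 'a2) ftr \<Rightarrow> ('o1, 'a1, 'o2, 'a2) ftr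
      \<Rightarrow> 'o2 \<Rightarrow> 'o2 \<Rightarrow> bool"
  for C D F G where
  base: "c \<in> Obj C \<Longrightarrow> coeq_obj C D F G (FObj F c) (FObj G c)"
| refl: "x \<in> Obj D \<Longrightarrow> coeq_obj C D F G x x"
| sym: "coeq_obj C D F G x y \<Longrightarrow> coeq_obj C D F G y x"
| trans: "coeq_obj C D F G x y \<Longrightarrow> coeq_obj C D F G y z \<Longrightarrow> coeq_obj C D F G x z"

definition coeq_path ::
    "('o1, 'a1) cat \<Rightarrow> ('o2, 'a2) cat \<Rightarrow> ('o1, 'a1, 'o2, 'a2) ftr \<Rightarrow> ('o1, 'a1, 'o2, 'a2) ftr
      \<Rightarrow> 'a2 list \<Rightarrow> bool" where
  "coeq_path C D F G fs \<longleftrightarrow> fs \<noteq> [] \<and> set fs \<subseteq> Arr D \<and>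
     (\<forall>i. Suc i < length fs \<longrightarrow> coeq_obj C D F G (Cod D (fs ! i)) (Dom D (fs ! Suc i)))"

inductive coeq_arr ::
    "('o1, 'a1) cat \<Rightarrow> ('o2, 'a2) cat \<Rightarrow> ('o1, 'a1, 'o2, 'a2) ftr \<Rightarrow> ('o1, 'a1, 'o2, 'a2) ftr
      \<Rightarrow> 'a2 list \<Rightarrow> 'a2 list \<Rightarrow> bool"
  for C D F G where
  base: "c \<in> Arr C \<Longrightarrow> coeq_arr C D F G [FArr F c] [FArr G c]"
| comp: "f \<in> Arr D \<Longrightarrow> g \<in> Arr D \<Longrightarrow> Dom D g = Cod D f \<Longrightarrow>
    coeq_arr C D F G [f, g] [Cmp D g f]"
| refl: "coeq_path C D F G fs \<Longrightarrow> coeq_arr C D F G fs fs"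
| sym: "coeq_arr C D F G fs gs \<Longrightarrow> coeq_arr C D F G gs fs"
| trans: "coeq_arr C D F G fs gs \<Longrightarrow> coeq_arr C D F G gs hs \<Longrightarrow> coeq_arr C D F G fs hs"
| append: "coeq_arr C D F G fs fs' \<Longrightarrow> coeq_arr C D F G gs gs' \<Longrightarrow>
    coeq_path C D F G (fs @ gs) \<Longrightarrow> coeq_arr C D F G (fs @ gs) (fs' @ gs')"

definition coeq_ocls where
  "coeq_ocls C D F G x = Collect (coeq_obj C D F G x)"

definition coeq_acls where
  "coeq_acls C D F G fs = Collect (coeq_arr C D F G fs)"

definition coequalizer ::
    "('o1, 'a1) cat \<Rightarrow> ('o2, 'a2) cat \<Rightarrow> ('o1, 'a1, 'o2, 'a2) ftr \<Rightarrow> ('o1, 'a1, 'o2, 'a2) ftr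
      \<Rightarrow> ('o2 set, 'a2 list set) cat" where
  "coequalizer C D F G =
     \<lparr>Obj = coeq_ocls C D F G ` Obj D,
      Arr = coeq_acls C D F G ` {fs. coeq_path C D F G fs},
      Dom = (\<lambda>S. coeq_ocls C D F G (Dom D (hd (SOME fs. fs \<in> S)))),
      Cod = (\<lambda>S. coeq_ocls C D F G (Cod D (last (SOME fs. fs \<in> S)))),
      Idt = (\<lambda>X. coeq_acls C D F G [Idt D (SOME x. x \<in> X)]),
      Cmp = (\<lambda>T S. coeq_acls C D F G ((SOME fs. fs \<in> S) @ (SOME gs. gs \<in> T)))\<rparr>"


section \<open>2-pullbacks\<close>

text \<open>
  The square with \<open>p : W \<rightarrow> A\<close>, \<open>q : W \<rightarrow> B\<close>, \<open>f : A \<rightarrow> C\<close>, \<open>g : B \<rightarrow> C\<close> is a 2-pullback: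
  for every category \<open>Q\<close>, composition with \<open>p\<close> and \<open>q\<close> is an isomorphism from the category
  of functors \<open>Q \<rightarrow> W\<close> to the pullback of the categories of functors \<open>Q \<rightarrow> A\<close> and \<open>Q \<rightarrow> B\<close>
  over that of functors \<open>Q \<rightarrow> C\<close>.  The test categories \<open>Q\<close> are those with objects and arrows
  in \<open>'u\<close>.  The terminal category and the arrow category already suffice for testing, so the
  notion does not depend on the choice of an infinite \<open>'u\<close>.
\<close>

definition two_pullback ::
    "'u itself \<Rightarrow> ('ow, 'aw) cat \<Rightarrow> ('oa, 'aa) cat \<Rightarrow> ('ob, 'ab) cat \<Rightarrow> ('oc, 'ac) cat
      \<Rightarrow> ('ow, 'aw, 'oa, 'aa) ftr \<Rightarrow> ('ow, 'aw, 'ob, 'ab) ftr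
      \<Rightarrow> ('oa, 'aa, 'oc, 'ac) ftr \<Rightarrow> ('ob, 'ab, 'oc, 'ac) ftr \<Rightarrow> bool" where
  "two_pullback U W A B C p q f g \<longleftrightarrow>
     is_cat W \<and> is_cat A \<and> is_cat B \<and> is_cat C \<and>
     is_functor W A p \<and> is_functor W B q \<and> is_functor A C f \<and> is_functor B C g \<and>
     func_eq W (func_comp f p) (func_comp g q) \<and>
     (\<forall>Q :: ('u, 'u) cat. is_cat Q \<longrightarrow>
        (\<forall>a b. is_functor Q A a \<and> is_functor Q B b \<and>
               func_eq Q (func_comp f a) (func_comp g b) \<longrightarrow>
           (\<exists>h. is_functor Q W h \<and> func_eq Q (func_comp p h) a \<and> func_eq Q (func_comp q h) b \<and>
              (\<forall>h'. is_functor Q W h' \<and> func_eq Q (func_comp p h') a \<and>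
                    func_eq Q (func_comp q h') b \<longrightarrow> func_eq Q h' h))) \<and>
        (\<forall>h k \<alpha> \<beta>. is_functor Q W h \<and> is_functor Q W k \<and>
               nat_trans Q A (func_comp p h) (func_comp p k) \<alpha> \<and>
               nat_trans Q B (func_comp q h) (func_comp q k) \<beta> \<and>
               (\<forall>x\<in>Obj Q. FArr f (\<alpha> x) = FArr g (\<beta> x)) \<longrightarrow>
           (\<exists>\<gamma>. nat_trans Q W h k \<gamma> \<and>
              (\<forall>x\<in>Obj Q. FArr p (\<gamma> x) = \<alpha> x \<and> FArr q (\<gamma> x) = \<beta> x) \<and>
              (\<forall>\<gamma>'. nat_trans Q W h k \<gamma>' \<and>
                    (\<forall>x\<in>Obj Q. FArr p (\<gamma>' x) = \<alpha> x \<and> FArr q (\<gamma>' x) = \<beta> x) \<longrightarrow>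
                 (\<forall>x\<in>Obj Q. \<gamma>' x = \<gamma> x)))))"


section \<open>Operads in sets\<close>

text \<open>
  The sets \<open>Ops O n\<close> need not be disjoint, so the multiplication carries the arities:
  \<open>Mu O [k\<^sub>1, \<dots>, k\<^sub>n] p [q\<^sub>1, \<dots>, q\<^sub>n]\<close> is the composite \<open>\<mu>(p; q\<^sub>1, \<dots>, q\<^sub>n)\<close> for
  \<open>p \<in> O(n)\<close> and \<open>q\<^sub>i \<in> O(k\<^sub>i)\<close>.
\<close>

record 'x operad =
  Ops :: "nat \<Rightarrow> 'x set"
  Unit :: 'x
  Mu :: "nat list \<Rightarrow> 'x \<Rightarrow> 'x list \<Rightarrow> 'x"

definition ops_tuple :: "'x operad \<Rightarrow> nat list \<Rightarrow> 'x list \<Rightarrow> bool" where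
  "ops_tuple O' ks qs \<longleftrightarrow> list_all2 (\<lambda>k q. q \<in> Ops O' k) ks qs"

definition is_operad :: "'x operad \<Rightarrow> bool" where
  "is_operad O' \<longleftrightarrow>
     Unit O' \<in> Ops O' 1 \<and>
     (\<forall>ks p qs. p \<in> Ops O' (length ks) \<and> ops_tuple O' ks qs \<longrightarrow>
        Mu O' ks p qs \<in> Ops O' (sum_list ks)) \<and>
     (\<forall>n. \<forall>p\<in>Ops O' n. Mu O' [n] (Unit O') [p] = p) \<and>
     (\<forall>n. \<forall>p\<in>Ops O' n. Mu O' (replicate n 1) p (replicate n (Unit O')) = p) \<and>
     (\<forall>lss p qs rss. p \<in> Ops O' (length lss) \<and> ops_tuple O' (map length lss) qs \<and>
        list_all2 (ops_tuple O') lss rss \<longrightarrow>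
        Mu O' (concat lss) (Mu O' (map length lss) p qs) (concat rss) =
        Mu O' (map sum_list lss) p (map2 (\<lambda>ls (q, rs). Mu O' ls q rs) lss (zip qs rss)))"

definition is_operad_map :: "'x operad \<Rightarrow> 'y operad \<Rightarrow> (nat \<Rightarrow> 'x \<Rightarrow> 'y) \<Rightarrow> bool" where
  "is_operad_map O1 O2 \<phi> \<longleftrightarrow>
     (\<forall>n. \<phi> n \<in> Ops O1 n \<rightarrow> Ops O2 n) \<and>
     \<phi> 1 (Unit O1) = Unit O2 \<and>
     (\<forall>ks p qs. p \<in> Ops O1 (length ks) \<and> ops_tuple O1 ks qs \<longrightarrow>
        \<phi> (sum_list ks) (Mu O1 ks p qs) = Mu O2 ks (\<phi> (length ks) p) (map2 \<phi> ks qs))"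


section \<open>The operad of symmetric groups\<close>

text \<open>Permutations act on \<open>{1..n}\<close>, so the \<open>i\<close>-th entry of a list \<open>xs\<close> is \<open>xs ! (i - 1)\<close>.\<close>

definition block_start :: "nat list \<Rightarrow> nat \<Rightarrow> nat" where
  "block_start ks i = sum_list (take (i - 1) ks)"

definition sym_delta :: "nat list \<Rightarrow> (nat \<Rightarrow> nat) \<Rightarrow> nat \<Rightarrow> nat" where
  "sym_delta ks \<sigma> j =
     (if j \<in> {1..sum_list ks}
      then THE m. \<exists>i\<in>{1..length ks}. \<exists>a\<in>{1..ks ! (i - 1)}.
             j = block_start ks i + a \<and>
             m = (\<Sum>i' | i' \<in> {1..length ks} \<and> \<sigma> i' < \<sigma> i. ks ! (i' - 1)) + a
      else j)"

definition sym_beta :: "nat list \<Rightarrow> (nat \<Rightarrow> nat) list \<Rightarrow> nat \<Rightarrow> nat" where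
  "sym_beta ks \<tau>s j =
     (if j \<in> {1..sum_list ks}
      then THE m. \<exists>i\<in>{1..length ks}. \<exists>a\<in>{1..ks ! (i - 1)}.
             j = block_start ks i + a \<and> m = block_start ks i + (\<tau>s ! (i - 1)) a
      else j)"

definition sym_operad :: "(nat \<Rightarrow> nat) operad" where
  "sym_operad =
     \<lparr>Ops = (\<lambda>n. carrier (sym_group n)), Unit = id,
      Mu = (\<lambda>ks \<sigma> \<tau>s. sym_delta ks \<sigma> \<circ> sym_beta ks \<tau>s)\<rparr>"

text \<open>\<open>(x\<^sub>1, \<dots>, x\<^sub>n) \<mapsto> (x\<^bsub>\<sigma>\<^sup>-\<^sup>1(1)\<^esub>, \<dots>, x\<^bsub>\<sigma>\<^sup>-\<^sup>1(n)\<^esub>)\<close>\<close>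

definition perm_tuple :: "(nat \<Rightarrow> nat) \<Rightarrow> 'x list \<Rightarrow> 'x list" where
  "perm_tuple \<sigma> xs = map (\<lambda>i. xs ! (inv' \<sigma> i - 1)) [1..<Suc (length xs)]"


section \<open>Action operads\<close>

record 'g action_operad =
  Grp :: "nat \<Rightarrow> 'g monoid"
  GUnit :: 'g
  GMu :: "nat list \<Rightarrow> 'g \<Rightarrow> 'g list \<Rightarrow> 'g"
  Prm :: "nat \<Rightarrow> 'g \<Rightarrow> nat \<Rightarrow> nat"

definition underlying_operad :: "'g action_operad \<Rightarrow> 'g operad" where
  "underlying_operad L = \<lparr>Ops = (\<lambda>n. carrier (Grp L n)), Unit = GUnit L, Mu = GMu L\<rparr>"

definition is_action_operad :: "'g action_operad \<Rightarrow> bool" where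
  "is_action_operad L \<longleftrightarrow>
     is_operad (underlying_operad L) \<and>
     (\<forall>n. group (Grp L n)) \<and>
     is_operad_map (underlying_operad L) sym_operad (Prm L) \<and>
     (\<forall>n. Prm L n \<in> hom (Grp L n) (sym_group n)) \<and>
     (\<forall>ks g g' fs fs'. g \<in> carrier (Grp L (length ks)) \<and> g' \<in> carrier (Grp L (length ks)) \<and>
        ops_tuple (underlying_operad L) ks fs \<and>
        ops_tuple (underlying_operad L) (perm_tuple (Prm L (length ks) g) ks) fs' \<longrightarrow>
        GMu L (perm_tuple (Prm L (length ks) g) ks) g' fs' \<otimes>\<^bsub>Grp L (sum_list ks)\<^esub> GMu L ks g fs =
        GMu L ks (g' \<otimes>\<^bsub>Grp L (length ks)\<^esub> g)
          (map (\<lambda>i. fs' ! (Prm L (length ks) g i - 1) \<otimes>\<^bsub>Grp L (ks ! (i - 1))\<^esub> fs ! (i - 1))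
            [1..<Suc (length ks)]))"

definition L_beta :: "'g action_operad \<Rightarrow> nat list \<Rightarrow> 'g list \<Rightarrow> 'g" where
  "L_beta L ks gs = GMu L ks \<one>\<^bsub>Grp L (length ks)\<^esub> gs"

definition L_delta :: "'g action_operad \<Rightarrow> nat list \<Rightarrow> 'g \<Rightarrow> 'g" where
  "L_delta L ks g = GMu L ks g (map (\<lambda>k. \<one>\<^bsub>Grp L k\<^esub>) ks)"


section \<open>Operads with equivariance, in sets and in Cat\<close>

definition is_set_lam_operad ::
    "'g action_operad \<Rightarrow> 'x operad \<Rightarrow> (nat \<Rightarrow> 'g \<Rightarrow> 'x \<Rightarrow> 'x) \<Rightarrow> bool" where
  "is_set_lam_operad L O' act \<longleftrightarrow>
     is_operad O' \<and>
     (\<forall>n. \<forall>g\<in>carrier (Grp L n). act n g \<in> Ops O' n \<rightarrow> Ops O' n) \<and>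
     (\<forall>n. \<forall>p\<in>Ops O' n. act n \<one>\<^bsub>Grp L n\<^esub> p = p) \<and>
     (\<forall>n. \<forall>g\<in>carrier (Grp L n). \<forall>h\<in>carrier (Grp L n). \<forall>p\<in>Ops O' n.
        act n (g \<otimes>\<^bsub>Grp L n\<^esub> h) p = act n h (act n g p)) \<and>
     (\<forall>ks p qs gs. p \<in> Ops O' (length ks) \<and> ops_tuple O' ks qs \<and>
        ops_tuple (underlying_operad L) ks gs \<longrightarrow>
        Mu O' ks p (map2 (\<lambda>k (q, g). act k g q) ks (zip qs gs)) =
        act (sum_list ks) (L_beta L ks gs) (Mu O' ks p qs)) \<and>
     (\<forall>ks p g qs. p \<in> Ops O' (length ks) \<and> g \<in> carrier (Grp L (length ks)) \<and>
        ops_tuple O' ks qs \<longrightarrow>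
        Mu O' ks (act (length ks) g p) qs =
        act (sum_list ks) (L_delta L ks g)
          (Mu O' (perm_tuple (Prm L (length ks) g) ks) p (perm_tuple (Prm L (length ks) g) qs)))"

record ('g, 'o, 'a) lam_operad =
  PCat :: "nat \<Rightarrow> ('o, 'a) cat"
  PUnit :: 'o
  PMu :: "nat list \<Rightarrow> ('o \<times> 'o list, 'a \<times> 'a list, 'o, 'a) ftr"
  PAct :: "nat \<Rightarrow> 'g \<Rightarrow> ('o, 'a, 'o, 'a) ftr"

definition obj_operad :: "('g, 'o, 'a) lam_operad \<Rightarrow> 'o operad" where
  "obj_operad P =
     \<lparr>Ops = (\<lambda>n. Obj (PCat P n)), Unit = PUnit P, Mu = (\<lambda>ks p qs. FObj (PMu P ks) (p, qs))\<rparr>"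

definition arr_operad :: "('g, 'o, 'a) lam_operad \<Rightarrow> 'a operad" where
  "arr_operad P =
     \<lparr>Ops = (\<lambda>n. Arr (PCat P n)), Unit = Idt (PCat P 1) (PUnit P),
      Mu = (\<lambda>ks p qs. FArr (PMu P ks) (p, qs))\<rparr>"

definition is_lam_operad :: "'g action_operad \<Rightarrow> ('g, 'o, 'a) lam_operad \<Rightarrow> bool" where
  "is_lam_operad L P \<longleftrightarrow>
     (\<forall>n. is_cat (PCat P n)) \<and>
     (\<forall>ks. is_functor (prod_cat (PCat P (length ks)) (tuple_cat (map (PCat P) ks)))
             (PCat P (sum_list ks)) (PMu P ks)) \<and>
     (\<forall>n. \<forall>g\<in>carrier (Grp L n). is_functor (PCat P n) (PCat P n) (PAct P n g)) \<and>
     is_set_lam_operad L (obj_operad P) (\<lambda>n g. FObj (PAct P n g)) \<and>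
     is_set_lam_operad L (arr_operad P) (\<lambda>n g. FArr (PAct P n g))"


section \<open>The associated 2-monad\<close>

definition power_cat :: "('o, 'a) cat \<Rightarrow> nat \<Rightarrow> ('o list, 'a list) cat" where
  "power_cat X n = tuple_cat (replicate n X)"

text \<open>
  \<open>P(n) \<otimes>\<^bsub>\<Lambda>(n)\<^esub> X\<^sup>n\<close> is the coequalizer of two functors
  \<open>P(n) \<times> \<Lambda>(n) \<times> X\<^sup>n \<rightarrow> P(n) \<times> X\<^sup>n\<close>, with \<open>\<Lambda>(n)\<close> as a discrete category.
\<close>

definition tensor_src ::
    "'g action_operad \<Rightarrow> ('g, 'o, 'a) lam_operad \<Rightarrow> ('xo, 'xa) cat \<Rightarrow> nat
      \<Rightarrow> ('o \<times> 'g \<times> 'xo list, 'a \<times> 'g \<times> 'xa list) cat" where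
  "tensor_src L P X n =
     prod_cat (PCat P n) (prod_cat (discrete (carrier (Grp L n))) (power_cat X n))"

definition tensor_tgt ::
    "('g, 'o, 'a) lam_operad \<Rightarrow> ('xo, 'xa) cat \<Rightarrow> nat
      \<Rightarrow> ('o \<times> 'xo list, 'a \<times> 'xa list) cat" where
  "tensor_tgt P X n = prod_cat (PCat P n) (power_cat X n)"

definition act_left ::
    "('g, 'o, 'a) lam_operad \<Rightarrow> nat
      \<Rightarrow> ('o \<times> 'g \<times> 'xo list, 'a \<times> 'g \<times> 'xa list, 'o \<times> 'xo list, 'a \<times> 'xa list) ftr" where
  "act_left P n =
     \<lparr>FObj = (\<lambda>(p, g, xs). (FObj (PAct P n g) p, xs)),
      FArr = (\<lambda>(p, g, xs). (FArr (PAct P n g) p, xs))\<rparr>"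

definition act_right ::
    "'g action_operad \<Rightarrow> nat
      \<Rightarrow> ('o \<times> 'g \<times> 'xo list, 'a \<times> 'g \<times> 'xa list, 'o \<times> 'xo list, 'a \<times> 'xa list) ftr" where
  "act_right L n =
     \<lparr>FObj = (\<lambda>(p, g, xs). (p, perm_tuple (Prm L n g) xs)),
      FArr = (\<lambda>(p, g, xs). (p, perm_tuple (Prm L n g) xs))\<rparr>"

definition tensor ::
    "'g action_operad \<Rightarrow> ('g, 'o, 'a) lam_operad \<Rightarrow> ('xo, 'xa) cat \<Rightarrow> nat
      \<Rightarrow> (('o \<times> 'xo list) set, ('a \<times> 'xa list) list set) cat" where
  "tensor L P X n =
     coequalizer (tensor_src L P X n) (tensor_tgt P X n) (act_left P n) (act_right L n)"

definition T_cat ::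
    "'g action_operad \<Rightarrow> ('g, 'o, 'a) lam_operad \<Rightarrow> ('xo, 'xa) cat
      \<Rightarrow> (nat \<times> ('o \<times> 'xo list) set, nat \<times> ('a \<times> 'xa list) list set) cat" where
  "T_cat L P X = coprod_cat (tensor L P X)"

text \<open>
  The object and the arrow \<open>[p; x\<^sub>1, \<dots>, x\<^sub>n]\<close> of \<open>T_cat L P X\<close>.  Since the groups act by
  automorphisms, every path in \<open>P(n) \<times> X\<^sup>n\<close> is equivalent to one of length 1, so every arrow
  of \<open>T_cat L P X\<close> is of this form and functors on \<open>T_cat L P X\<close> can be defined by their values
  on such arrows, just as on objects.
\<close>

definition T_obj ::
    "'g action_operad \<Rightarrow> ('g, 'o, 'a) lam_operad \<Rightarrow> ('xo, 'xa) cat \<Rightarrow> nat \<Rightarrow> 'o \<Rightarrow> 'xo list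
      \<Rightarrow> nat \<times> ('o \<times> 'xo list) set" where
  "T_obj L P X n p xs =
     (n, coeq_ocls (tensor_src L P X n) (tensor_tgt P X n) (act_left P n) (act_right L n) (p, xs))"

definition T_arr ::
    "'g action_operad \<Rightarrow> ('g, 'o, 'a) lam_operad \<Rightarrow> ('xo, 'xa) cat \<Rightarrow> nat \<Rightarrow> 'a \<Rightarrow> 'xa list
      \<Rightarrow> nat \<times> ('a \<times> 'xa list) list set" where
  "T_arr L P X n p xs =
     (n, coeq_acls (tensor_src L P X n) (tensor_tgt P X n) (act_left P n) (act_right L n) [(p, xs)])"

definition T_map ::
    "'g action_operad \<Rightarrow> ('g, 'o, 'a) lam_operad \<Rightarrow> ('xo, 'xa) cat \<Rightarrow> ('yo, 'ya) cat
      \<Rightarrow> ('xo, 'xa, 'yo, 'ya) ftr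
      \<Rightarrow> (nat \<times> ('o \<times> 'xo list) set, nat \<times> ('a \<times> 'xa list) list set,
          nat \<times> ('o \<times> 'yo list) set, nat \<times> ('a \<times> 'ya list) list set) ftr" where
  "T_map L P X Y F =
     \<lparr>FObj = (\<lambda>Z. THE W. \<exists>n p xs. p \<in> Obj (PCat P n) \<and> xs \<in> Obj (power_cat X n) \<and>
        Z = T_obj L P X n p xs \<and> W = T_obj L P Y n p (map (FObj F) xs)),
      FArr = (\<lambda>Z. THE W. \<exists>n p xs. p \<in> Arr (PCat P n) \<and> xs \<in> Arr (power_cat X n) \<and>
        Z = T_arr L P X n p xs \<and> W = T_arr L P Y n p (map (FArr F) xs))\<rparr>"

definition T_unit ::
    "'g action_operad \<Rightarrow> ('g, 'o, 'a) lam_operad \<Rightarrow> ('xo, 'xa) cat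
      \<Rightarrow> ('xo, 'xa, nat \<times> ('o \<times> 'xo list) set, nat \<times> ('a \<times> 'xa list) list set) ftr" where
  "T_unit L P X =
     \<lparr>FObj = (\<lambda>x. T_obj L P X 1 (PUnit P) [x]),
      FArr = (\<lambda>u. T_arr L P X 1 (Idt (PCat P 1) (PUnit P)) [u])\<rparr>"

definition T_mult ::
    "'g action_operad \<Rightarrow> ('g, 'o, 'a) lam_operad \<Rightarrow> ('xo, 'xa) cat
      \<Rightarrow> (nat \<times> ('o \<times> (nat \<times> ('o \<times> 'xo list) set) list) set,
          nat \<times> ('a \<times> (nat \<times> ('a \<times> 'xa list) list set) list) list set,
          nat \<times> ('o \<times> 'xo list) set, nat \<times> ('a \<times> 'xa list) list set) ftr" where
  "T_mult L P X =
     \<lparr>FObj = (\<lambda>Z. THE W. \<exists>ks p qs xss.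
        p \<in> Obj (PCat P (length ks)) \<and> ops_tuple (obj_operad P) ks qs \<and>
        list_all2 (\<lambda>k xs. xs \<in> Obj (power_cat X k)) ks xss \<and>
        Z = T_obj L P (T_cat L P X) (length ks) p
              (map2 (\<lambda>k (q, xs). T_obj L P X k q xs) ks (zip qs xss)) \<and>
        W = T_obj L P X (sum_list ks) (Mu (obj_operad P) ks p qs) (concat xss)),
      FArr = (\<lambda>Z. THE W. \<exists>ks p qs xss.
        p \<in> Arr (PCat P (length ks)) \<and> ops_tuple (arr_operad P) ks qs \<and>
        list_all2 (\<lambda>k xs. xs \<in> Arr (power_cat X k)) ks xss \<and>
        Z = T_arr L P (T_cat L P X) (length ks) p
              (map2 (\<lambda>k (q, xs). T_arr L P X k q xs) ks (zip qs xss)) \<and>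
        W = T_arr L P X (sum_list ks) (Mu (arr_operad P) ks p qs) (concat xss))\<rparr>"

text \<open>
  The associated 2-monad is 2-cartesian.  Here \<open>'u\<close> is the universe: the categories to which
  the 2-monad is applied, and the test categories for 2-pullbacks, are those with objects and
  arrows in \<open>'u\<close>.  If \<open>'u\<close> is infinite, every cospan of such categories has a pullback of the
  same kind.  2-pullbacks in Cat are a condition on the objects and functors of the square, so
  the action of the 2-monad on natural transformations does not enter.
\<close>

definition two_cartesian ::
    "'u itself \<Rightarrow> 'g action_operad \<Rightarrow> ('g, 'o, 'a) lam_operad \<Rightarrow> bool" where
  "two_cartesian U L P \<longleftrightarrow>
     (\<forall>(W :: ('u, 'u) cat) (A :: ('u, 'u) cat) (B :: ('u, 'u) cat) (C :: ('u, 'u) cat) p q f g.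
        two_pullback U W A B C p q f g \<longrightarrow>
        two_pullback U (T_cat L P W) (T_cat L P A) (T_cat L P B) (T_cat L P C)
          (T_map L P W A p) (T_map L P W B q) (T_map L P A C f) (T_map L P B C g)) \<and>
     (\<forall>(X :: ('u, 'u) cat) (Y :: ('u, 'u) cat) F. is_cat X \<and> is_cat Y \<and> is_functor X Y F \<longrightarrow>
        two_pullback U X (T_cat L P X) Y (T_cat L P Y)
          (T_unit L P X) F (T_map L P X Y F) (T_unit L P Y)) \<and>
     (\<forall>(X :: ('u, 'u) cat) (Y :: ('u, 'u) cat) F. is_cat X \<and> is_cat Y \<and> is_functor X Y F \<longrightarrow>
        two_pullback U (T_cat L P (T_cat L P X)) (T_cat L P X) (T_cat L P (T_cat L P Y)) (T_cat L P Y)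
          (T_mult L P X) (T_map L P (T_cat L P X) (T_cat L P Y) (T_map L P X Y F))
          (T_map L P X Y F) (T_mult L P Y))"

end

theory Submission
  imports Defs
begin

text \<open>
  If \<open>p \<cdot> g = p\<close>, then \<open>[p; (x, x)]\<close> and \<open>[p; (x, g \<cdot> x)]\<close> in the value of the 2-monad on a discrete
  product have the same components, so preservation of this product makes \<open>g\<close> act trivially
  on \<open>x\<close>.

  Conversely, let \<open>N\<^sub>n = ker \<pi>\<^sub>n\<close>.  If stabilizers of objects lie in \<open>N\<^sub>n\<close>, then \<open>\<Lambda>(n)/N\<^sub>n\<close> acts
  freely on the objects, hence also on the arrows, of the quotient category \<open>P(n)/N\<^sub>n\<close>.  Therefore
  an arrow of \<open>P(n) \<otimes> X\<^sup>n\<close> is an orbit of pairs of an arrow of \<open>P(n)/N\<^sub>n\<close> and a tuple of arrows of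
  \<open>X\<close>, and the group element relating two such pairs is unique modulo \<open>N\<^sub>n\<close>.  Given this
  description, a 2-pullback in \<open>Cat\<close> is checked separately on objects and on arrows, where each of
  the three conditions is a statement about sets.
\<close>

section \<open>Pullbacks of categories\<close>

text \<open>The obstacle to sufficiency is that arrows of the coequalizer are classes of paths:
  arrows that become composable only after identification acquire new composites. Freeness controls
  them, because the group element that makes two arrows composable is unique up to the kernel. Even
  so, kernel orbits of arrows are too fine for composition. The quotient category is therefore never
  built; on arrows it is represented by \<open>arr_cong\<close>, the congruence generated by kernel
  orbits under composition, and on objects by \<open>kernel_orbit\<close>. Both relations are
  instances of \<open>operad_congruence\<close>, so each of the three pullback statements is proved
  once, for sets. In these set-level arguments freeness enters through uniqueness: it removes the
  permutation that could separate two elements with the same projections. The unit square rests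
  instead on the triviality of the symmetric group on one letter. For necessity, two-valued tuples
  already detect a nontrivial permutation, so a discrete category with two objects is enough. Its
  square needs four elements of \<open>'u\<close>, which the infinity assumption provides.\<close>

lemma is_catI:
  assumes "\<And>f. f \<in> Arr C \<Longrightarrow> Dom C f \<in> Obj C \<and> Cod C f \<in> Obj C"
    and "\<And>x. x \<in> Obj C \<Longrightarrow> Idt C x \<in> Arr C \<and> Dom C (Idt C x) = x \<and> Cod C (Idt C x) = x"
    and "\<And>f g. \<lbrakk>f \<in> Arr C; g \<in> Arr C; Dom C g = Cod C f\<rbrakk> \<Longrightarrow>
        Cmp C g f \<in> Arr C \<and> Dom C (Cmp C g f) = Dom C f \<and> Cod C (Cmp C g f) = Cod C g"
    and "\<And>f. f \<in> Arr C \<Longrightarrow> Cmp C f (Idt C (Dom C f)) = f \<and> Cmp C (Idt C (Cod C f)) f = f"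
    and "\<And>f g h. \<lbrakk>f \<in> Arr C; g \<in> Arr C; h \<in> Arr C; Dom C g = Cod C f; Dom C h = Cod C g\<rbrakk> \<Longrightarrow>
        Cmp C h (Cmp C g f) = Cmp C (Cmp C h g) f"
  shows "is_cat C"
  using assms unfolding is_cat_def by simp

lemma
  assumes "is_cat C"
  shows Dom_Obj: "\<And>f. f \<in> Arr C \<Longrightarrow> Dom C f \<in> Obj C"
    and Cod_Obj: "\<And>f. f \<in> Arr C \<Longrightarrow> Cod C f \<in> Obj C"
    and Idt_Arr: "\<And>x. x \<in> Obj C \<Longrightarrow> Idt C x \<in> Arr C"
    and Dom_Idt: "\<And>x. x \<in> Obj C \<Longrightarrow> Dom C (Idt C x) = x"
    and Cod_Idt: "\<And>x. x \<in> Obj C \<Longrightarrow> Cod C (Idt C x) = x"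
    and Cmp_Arr: "\<And>f g. \<lbrakk>f \<in> Arr C; g \<in> Arr C; Dom C g = Cod C f\<rbrakk> \<Longrightarrow> Cmp C g f \<in> Arr C"
    and Dom_Cmp: "\<And>f g. \<lbrakk>f \<in> Arr C; g \<in> Arr C; Dom C g = Cod C f\<rbrakk> \<Longrightarrow> Dom C (Cmp C g f) = Dom C f"
    and Cod_Cmp: "\<And>f g. \<lbrakk>f \<in> Arr C; g \<in> Arr C; Dom C g = Cod C f\<rbrakk> \<Longrightarrow> Cod C (Cmp C g f) = Cod C g"
    and Cmp_Idt_right: "\<And>f. f \<in> Arr C \<Longrightarrow> Cmp C f (Idt C (Dom C f)) = f"
    and Cmp_Idt_left: "\<And>f. f \<in> Arr C \<Longrightarrow> Cmp C (Idt C (Cod C f)) f = f"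
    and Cmp_assoc: "\<And>f g h. \<lbrakk>f \<in> Arr C; g \<in> Arr C; h \<in> Arr C; Dom C g = Cod C f; Dom C h =
        Cod C g\<rbrakk> \<Longrightarrow>
        Cmp C h (Cmp C g f) = Cmp C (Cmp C h g) f"
  using assms unfolding is_cat_def by auto

lemmas cat_simps = Dom_Obj Cod_Obj Idt_Arr Dom_Idt Cod_Idt Cmp_Arr Dom_Cmp Cod_Cmp
  Cmp_Idt_right Cmp_Idt_left Cmp_assoc

lemma is_functorI:
  assumes "\<And>x. x \<in> Obj C \<Longrightarrow> FObj F x \<in> Obj D"
    and "\<And>f. f \<in> Arr C \<Longrightarrow> FArr F f \<in> Arr D \<and>
        Dom D (FArr F f) = FObj F (Dom C f) \<and> Cod D (FArr F f) = FObj F (Cod C f)"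
    and "\<And>x. x \<in> Obj C \<Longrightarrow> FArr F (Idt C x) = Idt D (FObj F x)"
    and "\<And>f g. \<lbrakk>f \<in> Arr C; g \<in> Arr C; Dom C g = Cod C f\<rbrakk> \<Longrightarrow>
        FArr F (Cmp C g f) = Cmp D (FArr F g) (FArr F f)"
  shows "is_functor C D F"
  using assms unfolding is_functor_def by simp

lemma
  assumes "is_functor C D F"
  shows FObj_Obj: "\<And>x. x \<in> Obj C \<Longrightarrow> FObj F x \<in> Obj D"
    and FArr_Arr: "\<And>f. f \<in> Arr C \<Longrightarrow> FArr F f \<in> Arr D"
    and FArr_Dom: "\<And>f. f \<in> Arr C \<Longrightarrow> Dom D (FArr F f) = FObj F (Dom C f)"
    and FArr_Cod: "\<And>f. f \<in> Arr C \<Longrightarrow> Cod D (FArr F f) = FObj F (Cod C f)"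
    and FArr_Idt: "\<And>x. x \<in> Obj C \<Longrightarrow> FArr F (Idt C x) = Idt D (FObj F x)"
    and FArr_Cmp: "\<And>f g. \<lbrakk>f \<in> Arr C; g \<in> Arr C; Dom C g = Cod C f\<rbrakk> \<Longrightarrow>
        FArr F (Cmp C g f) = Cmp D (FArr F g) (FArr F f)"
  using assms unfolding is_functor_def by auto

lemmas functor_simps = FObj_Obj FArr_Arr FArr_Dom FArr_Cod FArr_Idt FArr_Cmp

text \<open>The comparison map from \<open>W\<close> to the fibre product of \<open>A\<close> and
  \<open>B\<close> is a bijection. The common target of \<open>f\<close> and \<open>g\<close> has no
  carrier here, because only equality of values matters.\<close>

definition set_pullback ::
    "'w set \<Rightarrow> 'a set \<Rightarrow> 'b set \<Rightarrow> ('w \<Rightarrow> 'a) \<Rightarrow> ('w \<Rightarrow> 'b) \<Rightarrow> ('a \<Rightarrow> 'c) \<Rightarrow> ('b \<Rightarrow> 'c) \<Rightarrow> bool" where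
  "set_pullback W A B p q f g \<longleftrightarrow>
     (\<forall>w\<in>W. p w \<in> A \<and> q w \<in> B \<and> f (p w) = g (q w)) \<and>
     (\<forall>a\<in>A. \<forall>b\<in>B. f a = g b \<longrightarrow> (\<exists>w\<in>W. p w = a \<and> q w = b)) \<and>
     (\<forall>w\<in>W. \<forall>w'\<in>W. p w = p w' \<longrightarrow> q w = q w' \<longrightarrow> w = w')"

lemma set_pullback_ex:
  assumes "set_pullback W A B p q f g" "a \<in> A" "b \<in> B" "f a = g b"
  shows "\<exists>w\<in>W. p w = a \<and> q w = b"
  using assms unfolding set_pullback_def by blast

lemma set_pullback_unique:
  "set_pullback W A B p q f g \<Longrightarrow> w \<in> W \<Longrightarrow> w' \<in> W \<Longrightarrow> p w = p w' \<Longrightarrow> q w = q w' \<Longrightarrow> w = w'"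
  unfolding set_pullback_def by blast

text \<open>Lifts are chosen independently for each object and each arrow of the test category. The
  functor and naturality equations for the chosen lifts hold after both projections, so the joint
  injectivity in \<open>set_pullback\<close> gives them in \<open>W\<close>.\<close>

lemma two_pullbackI:
  assumes cW: "is_cat W" and cA: "is_cat A" and cB: "is_cat B" and cC: "is_cat C"
    and p: "is_functor W A p" and q: "is_functor W B q"
    and f: "is_functor A C f" and g: "is_functor B C g"
    and O: "set_pullback (Obj W) (Obj A) (Obj B) (FObj p) (FObj q) (FObj f) (FObj g)"
    and R: "set_pullback (Arr W) (Arr A) (Arr B) (FArr p) (FArr q) (FArr f) (FArr g)"
  shows "two_pullback U W A B C p q f g"
proof -
  have comm: "func_eq W (func_comp f p) (func_comp g q)"
    using O R unfolding set_pullback_def func_eq_def func_comp_def by simp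
  have one: "\<exists>h. is_functor Q W h \<and> func_eq Q (func_comp p h) a \<and> func_eq Q (func_comp q h) b \<and>
              (\<forall>h'. is_functor Q W h' \<and> func_eq Q (func_comp p h') a \<and>
                    func_eq Q (func_comp q h') b \<longrightarrow> func_eq Q h' h)"
    if Q: "is_cat Q" and a: "is_functor Q A a" and b: "is_functor Q B b"
      and e: "func_eq Q (func_comp f a) (func_comp g b)" for Q :: "('x,'x) cat" and a b
  proof -
    note as = functor_simps[OF a] functor_simps[OF b] cat_simps[OF Q]
    have "\<exists>w\<in>Obj W. FObj p w = FObj a x \<and> FObj q w = FObj b x" if "x \<in> Obj Q" for x
      using set_pullback_ex[OF O, of "FObj a x" "FObj b x"] that e as
      by (simp add: func_eq_def func_comp_def)
    then obtain ho where ho: "\<And>x. x \<in> Obj Q \<Longrightarrow> ho x \<in> Obj W \<and> FObj p (ho x) = FObj a x \<and>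
        FObj q (ho x) = FObj b x"
      by metis
    have "\<exists>w\<in>Arr W. FArr p w = FArr a x \<and> FArr q w = FArr b x" if "x \<in> Arr Q" for x
      using set_pullback_ex[OF R, of "FArr a x" "FArr b x"] that e as
      by (auto simp: func_eq_def func_comp_def)
    then obtain ha where ha: "\<And>x. x \<in> Arr Q \<Longrightarrow> ha x \<in> Arr W \<and> FArr p (ha x) = FArr a x \<and>
        FArr q (ha x) = FArr b x"
      by metis
    have D: "Dom W (ha u) = ho (Dom Q u)" if "u \<in> Arr Q" for u
      by (rule set_pullback_unique[OF O]) (simp_all add: that ha ho Dom_Obj[OF cW] Dom_Obj[OF Q]
          FArr_Dom[OF p, symmetric] FArr_Dom[OF q, symmetric] FArr_Dom[OF a] FArr_Dom[OF b])
    have C: "Cod W (ha u) = ho (Cod Q u)" if "u \<in> Arr Q" for u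
      by (rule set_pullback_unique[OF O]) (simp_all add: that ha ho Cod_Obj[OF cW] Cod_Obj[OF Q]
          FArr_Cod[OF p, symmetric] FArr_Cod[OF q, symmetric] FArr_Cod[OF a] FArr_Cod[OF b])
    have I: "ha (Idt Q x) = Idt W (ho x)" if "x \<in> Obj Q" for x
      by (rule set_pullback_unique[OF R]) (simp_all add: that ha ho Idt_Arr[OF cW] Idt_Arr[OF Q]
          FArr_Idt[OF p] FArr_Idt[OF q] FArr_Idt[OF a] FArr_Idt[OF b])
    have M: "ha (Cmp Q v u) = Cmp W (ha v) (ha u)" if "u \<in> Arr Q" "v \<in> Arr Q" "Dom Q v = Cod Q u"
        for u v
      by (rule set_pullback_unique[OF R]) (simp_all add: that ha ho D C Cmp_Arr[OF cW] Cmp_Arr[OF Q]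
          FArr_Cmp[OF p] FArr_Cmp[OF q] FArr_Cmp[OF a] FArr_Cmp[OF b])
    let ?h = "\<lparr>FObj = ho, FArr = ha\<rparr>"
    have "is_functor Q W ?h"
      by (rule is_functorI) (use ho ha D C I M in auto)
    moreover have "func_eq Q (func_comp p ?h) a" "func_eq Q (func_comp q ?h) b"
      using ho ha by (auto simp: func_eq_def func_comp_def)
    moreover have "func_eq Q h' ?h" if h': "is_functor Q W h'" and "func_eq Q (func_comp p h') a"
      "func_eq Q (func_comp q h') b" for h'
      using that(2,3) functor_simps(1,2)[OF h'] ho ha set_pullback_unique[OF O]
          set_pullback_unique[OF R]
      by (auto simp: func_eq_def func_comp_def)
    ultimately show ?thesis by blast
  qed
  have two: "\<exists>\<gamma>. nat_trans Q W h k \<gamma> \<and>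
              (\<forall>x\<in>Obj Q. FArr p (\<gamma> x) = \<alpha> x \<and> FArr q (\<gamma> x) = \<beta> x) \<and>
              (\<forall>\<gamma>'. nat_trans Q W h k \<gamma>' \<and>
                    (\<forall>x\<in>Obj Q. FArr p (\<gamma>' x) = \<alpha> x \<and> FArr q (\<gamma>' x) = \<beta> x) \<longrightarrow>
                 (\<forall>x\<in>Obj Q. \<gamma>' x = \<gamma> x))"
    if Q: "is_cat Q" and h: "is_functor Q W h" and k: "is_functor Q W k"
      and a: "nat_trans Q A (func_comp p h) (func_comp p k) \<alpha>"
      and b: "nat_trans Q B (func_comp q h) (func_comp q k) \<beta>"
      and e: "\<forall>x\<in>Obj Q. FArr f (\<alpha> x) = FArr g (\<beta> x)"
    for Q :: "('x,'x) cat" and h k \<alpha> \<beta>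
  proof -
    note as = functor_simps[OF h] functor_simps[OF k] cat_simps[OF Q]
    have "\<exists>w\<in>Arr W. FArr p w = \<alpha> x \<and> FArr q w = \<beta> x" if "x \<in> Obj Q" for x
      using set_pullback_ex[OF R, of "\<alpha> x" "\<beta> x"] that e a b
      by (auto simp: nat_trans_def)
    then obtain c where c: "\<And>x. x \<in> Obj Q \<Longrightarrow> c x \<in> Arr W \<and> FArr p (c x) = \<alpha> x \<and> FArr q (c x) = \<beta> x"
      by metis
    have ab: "\<And>x. x \<in> Obj Q \<Longrightarrow> \<alpha> x \<in> Arr A \<and> Dom A (\<alpha> x) = FObj p (FObj h x) \<and> Cod A (\<alpha> x) =
        FObj p (FObj k x)"
      "\<And>x. x \<in> Obj Q \<Longrightarrow> \<beta> x \<in> Arr B \<and> Dom B (\<beta> x) = FObj q (FObj h x) \<and> Cod B (\<beta> x) =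
          FObj q (FObj k x)"
      "\<And>u. u \<in> Arr Q \<Longrightarrow> Cmp A (\<alpha> (Cod Q u)) (FArr p (FArr h u)) =
          Cmp A (FArr p (FArr k u)) (\<alpha> (Dom Q u))"
      "\<And>u. u \<in> Arr Q \<Longrightarrow> Cmp B (\<beta> (Cod Q u)) (FArr q (FArr h u)) =
          Cmp B (FArr q (FArr k u)) (\<beta> (Dom Q u))"
      using a b by (simp_all add: nat_trans_def func_comp_def)
    have D: "Dom W (c x) = FObj h x" if "x \<in> Obj Q" for x
      by (rule set_pullback_unique[OF O]) (simp_all add: that c ab Dom_Obj[OF cW] FObj_Obj[OF h]
          FArr_Dom[OF p, symmetric] FArr_Dom[OF q, symmetric])
    have C: "Cod W (c x) = FObj k x" if "x \<in> Obj Q" for x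
      by (rule set_pullback_unique[OF O]) (simp_all add: that c ab Cod_Obj[OF cW] FObj_Obj[OF k]
          FArr_Cod[OF p, symmetric] FArr_Cod[OF q, symmetric])
    have N: "Cmp W (c (Cod Q u)) (FArr h u) = Cmp W (FArr k u) (c (Dom Q u))" if "u \<in> Arr Q" for u
      by (rule set_pullback_unique[OF R])
          (simp_all add: that c ab D C Cmp_Arr[OF cW] FArr_Arr[OF h] FArr_Arr[OF k]
          Dom_Obj[OF Q] Cod_Obj[OF Q] FArr_Dom[OF h] FArr_Cod[OF h] FArr_Dom[OF k] FArr_Cod[OF k]
          FArr_Cmp[OF p] FArr_Cmp[OF q])
    have "nat_trans Q W h k c" using D C N c by (auto simp: nat_trans_def)
    moreover have "\<forall>x\<in>Obj Q. \<gamma>' x = c x" if "nat_trans Q W h k \<gamma>'"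
      "\<forall>x\<in>Obj Q. FArr p (\<gamma>' x) = \<alpha> x \<and> FArr q (\<gamma>' x) = \<beta> x" for \<gamma>'
      using that c set_pullback_unique[OF R] by (auto simp: nat_trans_def)
    ultimately show ?thesis using c by blast
  qed
  show ?thesis unfolding two_pullback_def
    using assms comm one two by auto
qed

section \<open>Discrete categories and functors that pick an object\<close>

lemma is_cat_discrete: "is_cat (discrete S)"
  by (rule is_catI) (auto simp: discrete_def)

lemma is_functor_discrete:
  "is_functor (discrete S) D F \<longleftrightarrow>
    (\<forall>x\<in>S. FObj F x \<in> Obj D \<and> FArr F x \<in> Arr D \<and> Dom D (FArr F x) = FObj F x \<and> Cod D (FArr F x) =
        FObj F x \<and>
      FArr F x = Idt D (FObj F x) \<and> FArr F x = Cmp D (FArr F x) (FArr F x))"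
  by (auto simp: discrete_def is_functor_def)

definition point :: "('o, 'a) cat \<Rightarrow> 'o \<Rightarrow> ('u, 'u, 'o, 'a) ftr" where
  "point D x = \<lparr>FObj = (\<lambda>_. x), FArr = (\<lambda>_. Idt D x)\<rparr>"

lemma point_sel [simp]: "FObj (point D x) u = x" "FArr (point D x) u = Idt D x"
  by (simp_all add: point_def)

lemma is_functor_point:
  assumes "is_cat D" "x \<in> Obj D"
  shows "is_functor (discrete {u}) D (point D x)"
  using cat_simps[OF assms(1)] cat_simps(9)[OF assms(1), of "Idt D x"] assms(2)
  by (auto simp: is_functor_discrete point_def)

lemma func_comp_point:
  assumes "is_functor D E F" "x \<in> Obj D"
  shows "func_comp F (point D x) = point E (FObj F x)"
  using functor_simps(5)[OF assms(1)] assms(2) by (auto simp: func_comp_def point_def)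

text \<open>
  The test category is the terminal one: functors from it pick objects, and natural
  transformations between them pick arrows.
\<close>

lemma two_pullbackD:
  fixes W :: "('ow, 'aw) cat" and A :: "('oa, 'aa) cat" and B :: "('ob, 'ab) cat"
      and C :: "('oc, 'ac) cat"
  assumes P: "two_pullback TYPE('u) W A B C p q f g"
  shows "is_cat W" "is_cat A" "is_cat B" "is_cat C"
    "is_functor W A p" "is_functor W B q" "is_functor A C f" "is_functor B C g"
    "set_pullback (Obj W) (Obj A) (Obj B) (FObj p) (FObj q) (FObj f) (FObj g)"
    "set_pullback (Arr W) (Arr A) (Arr B) (FArr p) (FArr q) (FArr f) (FArr g)"
proof -
  show cW: "is_cat W" and cA: "is_cat A" and cB: "is_cat B" and cC: "is_cat C" and
    p: "is_functor W A p" and q: "is_functor W B q" and f: "is_functor A C f"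
        and g: "is_functor B C g"
    using P unfolding two_pullback_def by auto
  note cs = cat_simps[OF cW] cat_simps[OF cA] cat_simps[OF cB] cat_simps[OF cC]
  note fs = functor_simps[OF p] functor_simps[OF q] functor_simps[OF f] functor_simps[OF g]
  \<comment> \<open>\<open>undefined\<close> serves only as some element of
    \<open>'u\<close>.\<close>
  define Q where "Q = discrete {undefined :: 'u}"
  have Q: "is_cat Q" by (simp add: Q_def is_cat_discrete)
  have QO: "Obj Q = {undefined}" "Arr Q = {undefined}" by (auto simp: Q_def discrete_def)
  have comm: "func_eq W (func_comp f p) (func_comp g q)"
    and one: "\<And>a b. is_functor Q A a \<and> is_functor Q B b \<and>
        func_eq Q (func_comp f a) (func_comp g b) \<Longrightarrow>
       (\<exists>h. is_functor Q W h \<and> func_eq Q (func_comp p h) a \<and> func_eq Q (func_comp q h) b \<and>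
              (\<forall>h'. is_functor Q W h' \<and> func_eq Q (func_comp p h') a \<and>
                    func_eq Q (func_comp q h') b \<longrightarrow> func_eq Q h' h))"
    and two: "\<And>h k \<alpha> \<beta>. is_functor Q W h \<and> is_functor Q W k \<and>
               nat_trans Q A (func_comp p h) (func_comp p k) \<alpha> \<and>
               nat_trans Q B (func_comp q h) (func_comp q k) \<beta> \<and>
               (\<forall>x\<in>Obj Q. FArr f (\<alpha> x) = FArr g (\<beta> x)) \<Longrightarrow>
           (\<exists>\<gamma>. nat_trans Q W h k \<gamma> \<and>
              (\<forall>x\<in>Obj Q. FArr p (\<gamma> x) = \<alpha> x \<and> FArr q (\<gamma> x) = \<beta> x) \<and>
              (\<forall>\<gamma>'. nat_trans Q W h k \<gamma>' \<and>
                    (\<forall>x\<in>Obj Q. FArr p (\<gamma>' x) = \<alpha> x \<and> FArr q (\<gamma>' x) = \<beta> x) \<longrightarrow>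
                 (\<forall>x\<in>Obj Q. \<gamma>' x = \<gamma> x)))"
    using P Q unfolding two_pullback_def by auto
  have con: "\<And>x. x \<in> Obj W \<Longrightarrow> is_functor Q W (point W x)" "\<And>x. x \<in> Obj A \<Longrightarrow>
      is_functor Q A (point A x)"
    "\<And>x. x \<in> Obj B \<Longrightarrow> is_functor Q B (point B x)"
    unfolding Q_def by (auto intro: is_functor_point cW cA cB)
  note pc = func_comp_point[OF p] func_comp_point[OF q] func_comp_point[OF f] func_comp_point[OF g]
  have commo: "FObj f (FObj p w) = FObj g (FObj q w)" if "w \<in> Obj W" for w
    using that comm by (auto simp: func_eq_def func_comp_def)
  show O: "set_pullback (Obj W) (Obj A) (Obj B) (FObj p) (FObj q) (FObj f) (FObj g)"
    unfolding set_pullback_def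
  proof (intro conjI ballI impI)
    fix w assume w: "w \<in> Obj W"
    show "FObj p w \<in> Obj A" "FObj q w \<in> Obj B" using w fs by auto
    show "FObj f (FObj p w) = FObj g (FObj q w)" using w comm
        by (auto simp: func_eq_def func_comp_def)
  next
    fix a b assume a: "a \<in> Obj A" and b: "b \<in> Obj B" and e: "FObj f a = FObj g b"
    have "func_eq Q (func_comp f (point A a)) (func_comp g (point B b))"
      using a b e by (simp add: pc func_eq_def)
    then obtain h where h: "is_functor Q W h" "func_eq Q (func_comp p h) (point A a)"
        "func_eq Q (func_comp q h) (point B b)"
      using one con(2)[OF a] con(3)[OF b] by blast
    thus "\<exists>w\<in>Obj W. FObj p w = a \<and> FObj q w = b"
      using functor_simps(1)[OF h(1)]
      by (intro bexI[of _ "FObj h undefined"]) (auto simp: func_eq_def func_comp_def QO point_def)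
  next
    fix w w' assume w: "w \<in> Obj W" "w' \<in> Obj W" and e: "FObj p w = FObj p w'" "FObj q w = FObj q w'"
    let ?a = "point A (FObj p w) :: ('u, 'u, _, _) ftr" and ?b =
        "point B (FObj q w) :: ('u, 'u, _, _) ftr"
    have "is_functor Q A ?a" "is_functor Q B ?b" using con w fs by auto
    moreover have "func_eq Q (func_comp f ?a) (func_comp g ?b)"
      using w fs(1,7) commo by (simp add: pc func_eq_def)
    ultimately obtain h where
      h: "\<And>h'. is_functor Q W h' \<and> func_eq Q (func_comp p h') ?a \<and> func_eq Q (func_comp q h') ?b \<Longrightarrow>
          func_eq Q h' h"
      using one by blast
    have "func_eq Q (point W w) h" "func_eq Q (point W w') h"
      by (rule h; use con(1) w e in \<open>simp add: pc func_eq_def\<close>)+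
    thus "w = w'" by (auto simp: func_eq_def QO point_def)
  qed
  show "set_pullback (Arr W) (Arr A) (Arr B) (FArr p) (FArr q) (FArr f) (FArr g)"
    unfolding set_pullback_def
  proof (intro conjI ballI impI)
    fix w assume w: "w \<in> Arr W"
    show "FArr p w \<in> Arr A" "FArr q w \<in> Arr B" using w fs by auto
    show "FArr f (FArr p w) = FArr g (FArr q w)" using w comm
        by (auto simp: func_eq_def func_comp_def)
  next
    fix a b assume a: "a \<in> Arr A" and b: "b \<in> Arr B" and e: "FArr f a = FArr g b"
    \<comment> \<open>The object square supplies a source and a target for the arrow sought. Between
      the corresponding point functors, \<open>a\<close> and \<open>b\<close> are natural
      transformations, so the second clause of the universal property applies.\<close>
    have "FObj f (Dom A a) = FObj g (Dom B b)" "FObj f (Cod A a) = FObj g (Cod B b)"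
      using e FArr_Dom[OF f a] FArr_Dom[OF g b] FArr_Cod[OF f a] FArr_Cod[OF g b] by simp_all
    then obtain x y where x: "x \<in> Obj W" "FObj p x = Dom A a" "FObj q x = Dom B b"
      and y: "y \<in> Obj W" "FObj p y = Cod A a" "FObj q y = Cod B b"
      using set_pullback_ex[OF O] Dom_Obj[OF cA a] Cod_Obj[OF cA a] Dom_Obj[OF cB b]
          Cod_Obj[OF cB b] by metis
    have "nat_trans Q A (func_comp p (point W x)) (func_comp p (point W y)) (\<lambda>_. a)"
      "nat_trans Q B (func_comp q (point W x)) (func_comp q (point W y)) (\<lambda>_. b)"
      using x y a b Cmp_Idt_left[OF cA a] Cmp_Idt_right[OF cA a] Cmp_Idt_left[OF cB b]
          Cmp_Idt_right[OF cB b]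
      by (simp_all add: pc nat_trans_def)
    then have "\<exists>\<gamma>. nat_trans Q W (point W x) (point W y) \<gamma> \<and>
              (\<forall>z\<in>Obj Q. FArr p (\<gamma> z) = a \<and> FArr q (\<gamma> z) = b)"
      using two[of "point W x" "point W y" "\<lambda>_. a" "\<lambda>_. b"] con(1) x(1) y(1) e by blast
    thus "\<exists>w\<in>Arr W. FArr p w = a \<and> FArr q w = b"
      by (auto simp: nat_trans_def QO)
  next
    fix w w' assume w: "w \<in> Arr W" "w' \<in> Arr W" and e: "FArr p w = FArr p w'" "FArr q w = FArr q w'"
    \<comment> \<open>Uniqueness of natural transformations compares only arrows with common
      endpoints, so the endpoints of \<open>w\<close> and \<open>w'\<close> are matched
      first.\<close>
    have d: "Dom W w' = Dom W w"
      by (rule set_pullback_unique[OF O])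
          (use w e Dom_Obj[OF cW] FArr_Dom[OF p] FArr_Dom[OF q] in metis)+
    have c: "Cod W w' = Cod W w"
      by (rule set_pullback_unique[OF O])
          (use w e Cod_Obj[OF cW] FArr_Cod[OF p] FArr_Cod[OF q] in metis)+
    let ?h = "point W (Dom W w)" and ?k = "point W (Cod W w)"
    have t: "nat_trans Q W ?h ?k (\<lambda>_. w)" "nat_trans Q W ?h ?k (\<lambda>_. w')"
      using w d c cs(9,10)[of w] cs(9,10)[of w'] by (auto simp: nat_trans_def point_def)
    have "nat_trans Q A (func_comp p ?h) (func_comp p ?k) (\<lambda>_. FArr p w)"
      "nat_trans Q B (func_comp q ?h) (func_comp q ?k) (\<lambda>_. FArr q w)"
      using w(1) Dom_Obj[OF cW w(1)] Cod_Obj[OF cW w(1)] FArr_Dom[OF p w(1)] FArr_Cod[OF p w(1)]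
        FArr_Dom[OF q w(1)] FArr_Cod[OF q w(1)] Cmp_Idt_left[OF cA FArr_Arr[OF p w(1)]]
        Cmp_Idt_right[OF cA FArr_Arr[OF p w(1)]] Cmp_Idt_left[OF cB FArr_Arr[OF q w(1)]]
        Cmp_Idt_right[OF cB FArr_Arr[OF q w(1)]] FArr_Arr[OF p w(1)] FArr_Arr[OF q w(1)]
      by (simp_all add: pc nat_trans_def)
    moreover have "FArr f (FArr p w) = FArr g (FArr q w)" using w comm
        by (auto simp: func_eq_def func_comp_def)
    ultimately obtain c where c: "\<And>\<gamma>'. nat_trans Q W ?h ?k \<gamma>' \<and>
                    (\<forall>x\<in>Obj Q. FArr p (\<gamma>' x) = FArr p w \<and> FArr q (\<gamma>' x) = FArr q w) \<Longrightarrow>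
                 (\<forall>x\<in>Obj Q. \<gamma>' x = c x)"
      using two[of ?h ?k "\<lambda>_. FArr p w" "\<lambda>_. FArr q w"] con(1) Dom_Obj[OF cW w(1)]
          Cod_Obj[OF cW w(1)] by blast
    have "\<forall>x\<in>Obj Q. w = c x" by (rule c) (use t in auto)
    moreover have "\<forall>x\<in>Obj Q. w' = c x" by (rule c) (use t e in auto)
    ultimately show "w = w'" by (auto simp: QO)
  qed
qed

section \<open>Coequalizers of functors\<close>

locale functor_pair =
  fixes C :: "('o1, 'a1) cat" and D :: "('o2, 'a2) cat" and F G
  assumes cat_C: "is_cat C" and cat_D: "is_cat D"
    and functor_F: "is_functor C D F" and functor_G: "is_functor C D G"
begin

abbreviation obj_rel (infix \<open>\<sim>\<close> 50) where "x \<sim> y \<equiv> coeq_obj C D F G x y"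
abbreviation arr_rel (infix \<open>\<approx>\<close> 50) where "fs \<approx> gs \<equiv> coeq_arr C D F G fs gs"
abbreviation path where "path \<equiv> coeq_path C D F G"
abbreviation ocls where "ocls \<equiv> coeq_ocls C D F G"
abbreviation acls where "acls \<equiv> coeq_acls C D F G"

lemma obj_rel_Obj: "x \<sim> y \<Longrightarrow> x \<in> Obj D \<and> y \<in> Obj D"
  by (induction rule: coeq_obj.induct) (auto simp: FObj_Obj[OF functor_F] FObj_Obj[OF functor_G])

lemma path_iff: "path fs \<longleftrightarrow> fs \<noteq> [] \<and> set fs \<subseteq> Arr D \<and> successively (\<lambda>f g. Cod D f \<sim> Dom D g) fs"
  by (simp add: coeq_path_def successively_conv_nth)

lemma path_single [simp]: "path [f] \<longleftrightarrow> f \<in> Arr D"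
  by (simp add: path_iff)

lemma path_append:
  "fs \<noteq> [] \<Longrightarrow> gs \<noteq> [] \<Longrightarrow> path (fs @ gs) \<longleftrightarrow> path fs \<and> path gs \<and> Cod D (last fs) \<sim> Dom D (hd gs)"
  by (auto simp: path_iff successively_append_iff)

lemma path_Cons:
  "gs \<noteq> [] \<Longrightarrow> path (f # gs) \<longleftrightarrow> f \<in> Arr D \<and> path gs \<and> Cod D f \<sim> Dom D (hd gs)"
  using path_append[of "[f]" gs] by simp

lemma path_nonempty: "path fs \<Longrightarrow> fs \<noteq> []"
  by (simp add: path_iff)

lemma path_hd: "path fs \<Longrightarrow> hd fs \<in> Arr D" and path_last: "path fs \<Longrightarrow> last fs \<in> Arr D"
  by (auto simp: path_iff)

text \<open>The rule \<open>append\<close> requires only its left side to be a path. Since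
  equivalent paths have equivalent endpoints, the join on the right side matches too; this is why
  both claims go through one induction.\<close>

lemma arr_rel_path:
  "fs \<approx> gs \<Longrightarrow> path fs \<and> path gs \<and> Dom D (hd fs) \<sim> Dom D (hd gs) \<and> Cod D (last fs) \<sim> Cod D (last gs)"
proof (induction rule: coeq_arr.induct)
  case (base c)
  thus ?case
    using coeq_obj.base[of "Dom C c" C D F G] coeq_obj.base[of "Cod C c" C D F G]
        cat_simps[OF cat_C]
    by (simp add: functor_simps[OF functor_F] functor_simps[OF functor_G])
next
  case (comp f g)
  thus ?case
    using path_Cons[of "[g]" f] coeq_obj.refl[of "Cod D f" D C F G]
        coeq_obj.refl[of "Cod D g" D C F G]
      coeq_obj.refl[of "Dom D f" D C F G] cat_simps[OF cat_D] by simp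
next
  case (refl fs)
  thus ?case
    using path_hd path_last cat_simps[OF cat_D] by (auto intro: coeq_obj.refl)
next
  case (append fs fs' gs gs')
  note ne = path_nonempty[of fs] path_nonempty[of gs] path_nonempty[of fs'] path_nonempty[of gs']
  from append ne have "Cod D (last fs) \<sim> Dom D (hd gs)" by (simp add: path_append)
  with append have "Cod D (last fs') \<sim> Dom D (hd gs')" by (blast intro: coeq_obj.sym coeq_obj.trans)
  with append ne show ?case by (simp add: path_append)
qed (blast intro: coeq_obj.sym coeq_obj.trans)+

lemma arr_rel_append: "fs \<approx> fs' \<Longrightarrow> gs \<approx> gs' \<Longrightarrow> Cod D (last fs) \<sim> Dom D (hd gs) \<Longrightarrow> fs @ gs \<approx> fs' @ gs'"
  using coeq_arr.append[of C D F G fs fs' gs gs'] arr_rel_path[of fs fs'] arr_rel_path[of gs gs']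
    path_append[of fs gs] path_nonempty[of fs] path_nonempty[of gs] by blast

lemma ocls_eq: "x \<in> Obj D \<Longrightarrow> ocls x = ocls y \<longleftrightarrow> x \<sim> y"
  unfolding coeq_ocls_def by (auto simp: set_eq_iff intro: coeq_obj.refl coeq_obj.sym
      coeq_obj.trans)

lemma acls_eq: "path fs \<Longrightarrow> acls fs = acls gs \<longleftrightarrow> fs \<approx> gs"
  unfolding coeq_acls_def by (auto simp: set_eq_iff intro: coeq_arr.refl coeq_arr.sym
      coeq_arr.trans)

lemma some_ocls: "x \<in> Obj D \<Longrightarrow> x \<sim> (SOME y. y \<in> ocls x)"
  using someI[of "\<lambda>y. y \<in> ocls x" x] coeq_obj.refl[of x D C F G] by (simp add: coeq_ocls_def)

lemma some_acls: "path fs \<Longrightarrow> fs \<approx> (SOME gs. gs \<in> acls fs)"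
  using someI[of "\<lambda>y. y \<in> acls fs" fs] coeq_arr.refl[of C D F G fs] by (simp add: coeq_acls_def)

text \<open>\<open>Idt\<close> of the coequalizer picks a representative object, and this makes the
  choice irrelevant. Functors preserve identities, so a generator of \<open>coeq_obj\<close> yields
  a generator of \<open>coeq_arr\<close>.\<close>

lemma Idt_rel: "x \<sim> y \<Longrightarrow> [Idt D x] \<approx> [Idt D y]"
proof (induction rule: coeq_obj.induct)
  case (base c)
  thus ?case using coeq_arr.base[of "Idt C c" C D F G] cat_simps[OF cat_C]
    by (simp add: functor_simps[OF functor_F] functor_simps[OF functor_G])
next
  case (refl x)
  thus ?case using cat_simps[OF cat_D] by (auto intro: coeq_arr.refl)
qed (blast intro: coeq_arr.sym coeq_arr.trans)+

abbreviation Q where "Q \<equiv> coequalizer C D F G"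

lemma Obj_Q: "Obj Q = ocls ` Obj D" and Arr_Q: "Arr Q = acls ` {fs. path fs}"
  by (simp_all add: coequalizer_def)

lemma Dom_acls: "path fs \<Longrightarrow> Dom Q (acls fs) = ocls (Dom D (hd fs))"
  using arr_rel_path[OF some_acls[of fs]] ocls_eq[OF Dom_Obj[OF cat_D path_hd[of fs]], symmetric]
  by (simp add: coequalizer_def)

lemma Cod_acls: "path fs \<Longrightarrow> Cod Q (acls fs) = ocls (Cod D (last fs))"
  using arr_rel_path[OF some_acls[of fs]] ocls_eq[OF Cod_Obj[OF cat_D path_last[of fs]], symmetric]
  by (simp add: coequalizer_def)

lemma Idt_ocls: "x \<in> Obj D \<Longrightarrow> Idt Q (ocls x) = acls [Idt D x]"
  using Idt_rel[OF some_ocls] acls_eq[of "[Idt D x]" "[Idt D (SOME y. y \<in> ocls x)]"]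
      Idt_Arr[OF cat_D] by (simp add: coequalizer_def)

lemma Cmp_acls:
  assumes "path fs" "path gs" "Cod D (last fs) \<sim> Dom D (hd gs)"
  shows "Cmp Q (acls gs) (acls fs) = acls (fs @ gs)"
proof -
  have "path (fs @ gs)" using assms path_append path_nonempty by blast
  moreover have "fs @ gs \<approx> (SOME hs. hs \<in> acls fs) @ (SOME hs. hs \<in> acls gs)"
    by (intro arr_rel_append some_acls assms)
  ultimately show ?thesis using acls_eq[of "fs @ gs", symmetric] by (simp add: coequalizer_def)
qed

text \<open>The rule \<open>comp\<close> absorbs the identity into the first arrow. What remains of
  the path is appended only if it is nonempty, because the empty list is not a path.\<close>

lemma Idt_path_left:
  assumes "path fs" shows "Idt D (Dom D (hd fs)) # fs \<approx> fs"
proof -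
  obtain f gs where fs: "fs = f # gs" using path_nonempty[OF assms] by (cases fs) auto
  have f: "f \<in> Arr D" using path_hd[OF assms] fs by simp
  have s: "[Idt D (Dom D f), f] \<approx> [f]"
    using coeq_arr.comp[of "Idt D (Dom D f)" D f C F G] f cat_simps[OF cat_D] by simp
  show ?thesis
  proof (cases "gs = []")
    case False
    with assms fs have "path gs" "Cod D f \<sim> Dom D (hd gs)" by (simp_all add: path_Cons)
    thus ?thesis using arr_rel_append[OF s, of gs gs] coeq_arr.refl[of C D F G gs] fs by simp
  qed (use s fs in simp)
qed

lemma Idt_path_right:
  assumes "path fs" shows "fs @ [Idt D (Cod D (last fs))] \<approx> fs"
proof -
  obtain f gs where fs: "fs = gs @ [f]" using path_nonempty[OF assms]
      by (cases fs rule: rev_cases) auto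
  have f: "f \<in> Arr D" using path_last[OF assms] fs by simp
  have s: "[f, Idt D (Cod D f)] \<approx> [f]"
    using coeq_arr.comp[of f D "Idt D (Cod D f)" C F G] f cat_simps[OF cat_D] by simp
  show ?thesis
  proof (cases "gs = []")
    case False
    with assms fs have "path gs" "Cod D (last gs) \<sim> Dom D f" by (simp_all add: path_append)
    thus ?thesis using arr_rel_append[OF _ s, of gs gs] coeq_arr.refl[of C D F G gs] fs by simp
  qed (use s fs in simp)
qed

theorem is_cat_coequalizer: "is_cat Q"
proof (rule is_catI)
  note cd = cat_simps[OF cat_D]
  fix T assume "T \<in> Arr Q"
  then obtain fs where T: "T = acls fs" and p: "path fs" by (auto simp: Arr_Q)
  show "Dom Q T \<in> Obj Q \<and> Cod Q T \<in> Obj Q"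
    using p path_hd[OF p] path_last[OF p] cd by (auto simp: T Dom_acls Cod_acls Obj_Q)
  have d: "Dom D (hd fs) \<in> Obj D" "Cod D (last fs) \<in> Obj D" using path_hd[OF p] path_last[OF p] cd
      by auto
  hence i: "path [Idt D (Dom D (hd fs))]" "path [Idt D (Cod D (last fs))]" using cd by auto
  have "Cmp Q T (Idt Q (Dom Q T)) = acls ([Idt D (Dom D (hd fs))] @ fs)"
    using p d i cd by (simp add: T Dom_acls Idt_ocls Cmp_acls coeq_obj.refl)
  moreover have "Cmp Q (Idt Q (Cod Q T)) T = acls (fs @ [Idt D (Cod D (last fs))])"
    using p d i cd by (simp add: T Cod_acls Idt_ocls Cmp_acls coeq_obj.refl)
  ultimately show "Cmp Q T (Idt Q (Dom Q T)) = T \<and> Cmp Q (Idt Q (Cod Q T)) T = T"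
    using acls_eq[OF p, THEN iffD2, OF coeq_arr.sym, OF Idt_path_left[OF p]]
      acls_eq[OF p, THEN iffD2, OF coeq_arr.sym, OF Idt_path_right[OF p]] T by simp
next
  note cd = cat_simps[OF cat_D]
  fix X assume "X \<in> Obj Q"
  then obtain x where "X = ocls x" "x \<in> Obj D" by (auto simp: Obj_Q)
  thus "Idt Q X \<in> Arr Q \<and> Dom Q (Idt Q X) = X \<and> Cod Q (Idt Q X) = X"
    using cd by (auto simp: Idt_ocls Arr_Q Dom_acls Cod_acls)
next
  fix S T assume "S \<in> Arr Q" "T \<in> Arr Q" and e: "Dom Q T = Cod Q S"
  then obtain fs gs where S: "S = acls fs" and p: "path fs" and T: "T = acls gs" and q: "path gs"
    by (auto simp: Arr_Q)
  have j: "Cod D (last fs) \<sim> Dom D (hd gs)"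
    using e[symmetric] p q ocls_eq[OF Cod_Obj[OF cat_D path_last[OF p]]]
        by (simp add: S T Dom_acls Cod_acls)
  have r: "path (fs @ gs)" using p q j path_append path_nonempty by blast
  show "Cmp Q T S \<in> Arr Q \<and> Dom Q (Cmp Q T S) = Dom Q S \<and> Cod Q (Cmp Q T S) = Cod Q T"
    using p q j r path_nonempty by (simp add: S T Cmp_acls Dom_acls Cod_acls) (simp add: Arr_Q)
  fix U assume "U \<in> Arr Q" and e': "Dom Q U = Cod Q T"
  then obtain hs where U: "U = acls hs" and s: "path hs" by (auto simp: Arr_Q)
  have k: "Cod D (last gs) \<sim> Dom D (hd hs)"
    using e'[symmetric] q s ocls_eq[OF Cod_Obj[OF cat_D path_last[OF q]]]
        by (simp add: U T Dom_acls Cod_acls)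
  have t: "path (gs @ hs)" using s q k path_append path_nonempty by blast
  show "Cmp Q U (Cmp Q T S) = Cmp Q (Cmp Q U T) S"
    using p q j k r t s path_nonempty by (simp add: S T U Cmp_acls)
qed

end

text \<open>
  A congruence \<open>R\<close> on the arrows of \<open>D\<close> along which arrows can be transported to any equivalent
  domain.  Every path then has a value, an \<open>R\<close>-class of single arrows, that is invariant under
  \<open>coeq_arr\<close>.
\<close>

locale transport_congruence = functor_pair +
  fixes R
  assumes R_Arr: "R f g \<Longrightarrow> f \<in> Arr D \<and> g \<in> Arr D \<and> Cod D f \<sim> Cod D g"
    and R_refl: "f \<in> Arr D \<Longrightarrow> R f f"
    and R_sym: "R f g \<Longrightarrow> R g f"
    and R_trans: "R f g \<Longrightarrow> R g h \<Longrightarrow> R f h"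
    and R_base: "c \<in> Arr C \<Longrightarrow> R (FArr F c) (FArr G c)"
    and R_Cmp: "R f f' \<Longrightarrow> R g g' \<Longrightarrow> Dom D g = Cod D f \<Longrightarrow> Dom D g' = Cod D f' \<Longrightarrow>
        R (Cmp D g f) (Cmp D g' f')"
    and R_transport: "f \<in> Arr D \<Longrightarrow> x \<sim> Dom D f \<Longrightarrow> \<exists>f'. R f f' \<and> Dom D f' = x"
    and R_arr_rel: "R f g \<Longrightarrow> [f] \<approx> [g]"
begin

text \<open>Only pairs that compose on the nose are used. \<open>R_transport\<close> provides such a
  pair whenever the classes have equivalent endpoints.\<close>

definition class_comp where
  "class_comp S T = {h. \<exists>f\<in>S. \<exists>g\<in>T. Dom D g = Cod D f \<and> R (Cmp D g f) h}"

text \<open>The unions of \<open>R\<close>-classes; inside such a set an arrow may be replaced by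
  any transported copy.\<close>

definition saturated where
  "saturated S \<longleftrightarrow> S \<subseteq> Arr D \<and> (\<forall>f g. f \<in> S \<longrightarrow> R f g \<longrightarrow> g \<in> S)"

text \<open>Keeping the value as a set avoids choosing representatives and makes it defined for
  lists that are not paths. The value of the empty list is a dummy.\<close>

fun val where
  "val [] = {}"
| "val [f] = {g. R f g}"
| "val (f # g # fs) = class_comp {h. R f h} (val (g # fs))"

lemma saturated_class: "saturated {g. R f g}"
  unfolding saturated_def using R_Arr R_trans[of f] by auto

lemma saturated_comp: "saturated (class_comp S T)"
  unfolding saturated_def class_comp_def using R_Arr by (fast intro: R_trans)

lemma saturated_val: "saturated (val fs)"
  by (induction fs rule: val.induct) (auto simp: saturated_class saturated_comp, simp
      add: saturated_def)

text \<open>From either bracketing, transport the later arrows until all three compose on the nose;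
  then associativity in \<open>D\<close> applies. Saturation keeps the transported arrows in their
  sets.\<close>

lemma class_comp_assoc:
  assumes S: "saturated S" and T: "saturated T" and U: "saturated U"
  shows "class_comp (class_comp S T) U = class_comp S (class_comp T U)"
proof -
  note cd = cat_simps[OF cat_D]
  have tr: "\<exists>h'. h' \<in> U \<and> R h h' \<and> Dom D h' = Cod D f"
    if "R f l" "h \<in> U" "Dom D h = Cod D l" "saturated U" for f l h U
  proof -
    have "Cod D f \<sim> Dom D h" using R_Arr[OF that(1)] that by simp
    moreover have "h \<in> Arr D" using that by (auto simp: saturated_def)
    ultimately obtain h' where "R h h'" "Dom D h' = Cod D f" using R_transport[of h "Cod D f"]
        by auto
    thus ?thesis using that by (auto simp: saturated_def)
  qed
  have "k \<in> class_comp S (class_comp T U)" if k: "k \<in> class_comp (class_comp S T) U" for k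
  proof -
    from k obtain f g l h where f: "f \<in> S" and g: "g \<in> T" and d: "Dom D g = Cod D f"
        and l: "R (Cmp D g f) l"
      and h: "h \<in> U" and e: "Dom D h = Cod D l" and k: "R (Cmp D h l) k"
      unfolding class_comp_def by blast
    have fa: "f \<in> Arr D" "g \<in> Arr D" using f g S T by (auto simp: saturated_def)
    have l': "R l (Cmp D g f)" and Cl: "Cod D (Cmp D g f) = Cod D g"
      using R_sym[OF l] Cod_Cmp[OF cat_D fa d] by auto
    obtain h' where h': "h' \<in> U" "R h h'" "Dom D h' = Cod D g" using tr[OF l h e U] Cl by auto
    have ha: "h' \<in> Arr D" using R_Arr[OF h'(2)] by simp
    have "R (Cmp D h' (Cmp D g f)) (Cmp D h l)"
      by (rule R_sym[OF R_Cmp[OF l' h'(2) e]]) (simp add: Cl h'(3))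
    hence "R (Cmp D (Cmp D h' g) f) k" using k R_trans fa ha d h'(3)
        by (simp add: Cmp_assoc[OF cat_D])
    moreover have "Cmp D h' g \<in> class_comp T U"
      unfolding class_comp_def using g h' R_refl[OF Cmp_Arr[OF cat_D fa(2) ha h'(3)]] by auto
    ultimately show ?thesis unfolding class_comp_def[of S]
        using f d Dom_Cmp[OF cat_D fa(2) ha h'(3)]
      by (intro CollectI bexI[of _ "Cmp D h' g"] bexI[of _ f] conjI) simp_all
  qed
  moreover have "k \<in> class_comp (class_comp S T) U" if k: "k \<in> class_comp S (class_comp T U)" for k
  proof -
    from k obtain f g l h where f: "f \<in> S" and g: "g \<in> T" and h: "h \<in> U" and d: "Dom D h = Cod D g"
      and l: "R (Cmp D h g) l" and e: "Dom D l = Cod D f" and k: "R (Cmp D l f) k"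
      unfolding class_comp_def by blast
    have fa: "f \<in> Arr D" "g \<in> Arr D" "h \<in> Arr D" using f g h S T U by (auto simp: saturated_def)
    \<comment> \<open>\<open>R_Arr\<close> relates codomains only; the domains of \<open>l\<close>
      and of the composite are compared through \<open>R_arr_rel\<close>.\<close>
    have "Cod D f \<sim> Dom D g"
    proof -
      have "[l] \<approx> [Cmp D h g]" using R_arr_rel[OF R_sym[OF l]] .
      from arr_rel_path[OF this] have "Dom D l \<sim> Dom D g" using fa d cd by simp
      thus ?thesis using e by simp
    qed
    then obtain g' where g': "R g g'" "Dom D g' = Cod D f" using R_transport fa by blast
    have gT: "g' \<in> T" "g' \<in> Arr D" using g g' T by (auto simp: saturated_def)
    obtain h' where h': "h' \<in> U" "R h h'" "Dom D h' = Cod D g'" using tr[OF R_sym[OF g'(1)] h d U]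
        by auto
    have ha: "h' \<in> Arr D" using R_Arr[OF h'(2)] by simp
    have "R (Cmp D h' g') l" using R_trans[OF R_sym[OF R_Cmp[OF g'(1) h'(2) d h'(3)]] l] .
    hence "R (Cmp D (Cmp D h' g') f) (Cmp D l f)"
      using R_Cmp[OF R_refl[OF fa(1)]] e g' gT ha h'(3) cd by simp
    hence "R (Cmp D h' (Cmp D g' f)) k" using k R_trans fa ha gT g' h'(3)
        by (simp add: Cmp_assoc[OF cat_D])
    moreover have "Cmp D g' f \<in> class_comp S T"
      unfolding class_comp_def using f gT g' R_refl[OF Cmp_Arr[OF cat_D fa(1) gT(2) g'(2)]] by auto
    ultimately show ?thesis
      unfolding class_comp_def[of _ U] using h' Cod_Cmp[OF cat_D fa(1) gT(2) g'(2)]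
      by (intro CollectI bexI[of _ "Cmp D g' f"] bexI[of _ h'] conjI) simp_all
  qed
  ultimately show ?thesis by blast
qed

lemma val_append: "fs \<noteq> [] \<Longrightarrow> gs \<noteq> [] \<Longrightarrow> val (fs @ gs) = class_comp (val fs) (val gs)"
proof (induction fs rule: val.induct)
  case (2 f)
  then obtain g gs' where "gs = g # gs'" by (cases gs) auto
  thus ?case by simp
next
  case (3 f g fs)
  thus ?case by (simp add: class_comp_assoc[OF saturated_class saturated_val saturated_val])
qed simp

text \<open>The rules \<open>base\<close>, \<open>comp\<close> and \<open>append\<close> of
  \<open>coeq_arr\<close> are matched by \<open>R_base\<close>, \<open>R_Cmp\<close> and
  \<open>val_append\<close>.\<close>

lemma val_eq: "fs \<approx> gs \<Longrightarrow> val fs = val gs"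
proof (induction rule: coeq_arr.induct)
  case (base c)
  hence "R (FArr F c) g \<longleftrightarrow> R (FArr G c) g" for g
    using R_base R_sym R_trans by meson
  thus ?case by auto
next
  case (comp f g)
  have "R (Cmp D g f) h" if "R f f'" "R g g'" "Dom D g' = Cod D f'" "R (Cmp D g' f') h" for f' g' h
    using R_trans[OF R_Cmp[OF that(1,2) comp(3) that(3)] that(4)] .
  hence "class_comp {h. R f h} {h. R g h} = {h. R (Cmp D g f) h}"
    unfolding class_comp_def using comp R_refl[of f] R_refl[of g] by auto
  thus ?case by simp
next
  case (append fs fs' gs gs')
  hence "fs \<noteq> []" "gs \<noteq> []" "fs' \<noteq> []" "gs' \<noteq> []"
    using arr_rel_path[OF append(1)] arr_rel_path[OF append(2)] path_nonempty by simp_all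
  thus ?case using append by (simp add: val_append)
qed auto

text \<open>The value of a one-arrow path is its \<open>R\<close>-class, so invariance of
  \<open>val\<close> shows that passing through longer paths identifies no more single arrows than
  \<open>R\<close> does.\<close>

theorem single_rel_iff: "f \<in> Arr D \<Longrightarrow> [f] \<approx> [g] \<longleftrightarrow> R f g"
proof
  assume "[f] \<approx> [g]"
  from val_eq[OF this] arr_rel_path[OF this] show "R f g" using R_refl[of g] by auto
qed (rule R_arr_rel)

text \<open>Collapse the tail to one arrow, transport that arrow so that it starts exactly where the
  first arrow ends, and compose.\<close>

lemma path_single_rep: "path fs \<Longrightarrow> \<exists>f\<in>Arr D. fs \<approx> [f]"
proof (induction fs rule: val.induct)
  case (2 f)
  thus ?case using coeq_arr.refl[of C D F G "[f]"] by auto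
next
  case (3 f g fs)
  from "3.prems" have p: "f \<in> Arr D" "path (g # fs)" "Cod D f \<sim> Dom D g"
      by (simp_all add: path_Cons)
  with "3.IH" obtain h where h: "h \<in> Arr D" "g # fs \<approx> [h]" by blast
  from arr_rel_path[OF h(2)] p(3) have "Cod D f \<sim> Dom D h" by (auto intro: coeq_obj.trans)
  then obtain h' where h': "R h h'" "Dom D h' = Cod D f" using R_transport h(1) by blast
  have "[f] @ (g # fs) \<approx> [f] @ [h']"
    using p coeq_arr.refl[of C D F G "[f]"] coeq_arr.trans[OF h(2) R_arr_rel[OF h'(1)]]
    by (intro arr_rel_append) simp_all
  moreover have "[f, h'] \<approx> [Cmp D h' f]" using coeq_arr.comp[of f D h'] p h' R_Arr by blast
  ultimately have "f # g # fs \<approx> [Cmp D h' f]" by (auto intro: coeq_arr.trans)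
  thus ?case using p(1) h'(2) R_Arr[OF h'(1)] Cmp_Arr[OF cat_D, of f h'] by blast
qed (auto dest: path_nonempty)

end

section \<open>Permutations of tuples\<close>

lemma length_perm_tuple [simp]: "length (perm_tuple \<sigma> xs) = length xs"
  by (simp add: perm_tuple_def del: upt_Suc)

lemma nth_perm_tuple: "i < length xs \<Longrightarrow> perm_tuple \<sigma> xs ! i = xs ! (inv' \<sigma> (Suc i) - 1)"
  by (simp add: perm_tuple_def nth_append del: upt_Suc)

lemma perm_tuple_index:
  assumes "\<sigma> permutes {1..n}" "i < n"
  shows "inv' \<sigma> (Suc i) - 1 < n" "Suc (inv' \<sigma> (Suc i) - 1) = inv' \<sigma> (Suc i)"
  using permutes_in_image[OF permutes_inv[OF assms(1)], of "Suc i"] assms(2) by auto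

lemma perm_tuple_id [simp]: "perm_tuple id xs = xs"
  by (rule nth_equalityI) (simp_all add: nth_perm_tuple)

lemma perm_tuple_comp:
  assumes "\<sigma> permutes {1..length xs}" "\<tau> permutes {1..length xs}"
  shows "perm_tuple (\<sigma> \<circ> \<tau>) xs = perm_tuple \<sigma> (perm_tuple \<tau> xs)"
proof (rule nth_equalityI)
  fix i assume "i < length (perm_tuple (\<sigma> \<circ> \<tau>) xs)"
  hence i: "i < length xs" by simp
  have "inv' (\<sigma> \<circ> \<tau>) = inv' \<tau> \<circ> inv' \<sigma>"
    using assms by (intro o_inv_distrib) (auto intro: permutes_bij)
  thus "perm_tuple (\<sigma> \<circ> \<tau>) xs ! i = perm_tuple \<sigma> (perm_tuple \<tau> xs) ! i"
    using i perm_tuple_index[OF assms(1) i] by (simp add: nth_perm_tuple)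
qed simp

lemma map_perm_tuple:
  assumes "\<sigma> permutes {1..length xs}"
  shows "map f (perm_tuple \<sigma> xs) = perm_tuple \<sigma> (map f xs)"
  by (rule nth_equalityI) (use perm_tuple_index[OF assms] in \<open>simp_all add: nth_perm_tuple\<close>)

lemma zip_perm_tuple:
  assumes "\<sigma> permutes {1..length xs}" "length xs = length ys"
  shows "zip (perm_tuple \<sigma> xs) (perm_tuple \<sigma> ys) = perm_tuple \<sigma> (zip xs ys)"
  by (rule nth_equalityI) (use perm_tuple_index[OF assms(1)] assms(2) in \<open>simp_all
      add: nth_perm_tuple\<close>)

lemma set_perm_tuple_subset:
  assumes "\<sigma> permutes {1..length xs}"
  shows "set (perm_tuple \<sigma> xs) \<subseteq> set xs"
proof
  fix x assume "x \<in> set (perm_tuple \<sigma> xs)"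
  then obtain i where "i < length xs" "x = xs ! (inv' \<sigma> (Suc i) - 1)"
    by (auto simp: in_set_conv_nth nth_perm_tuple)
  thus "x \<in> set xs" using perm_tuple_index(1)[OF assms] by simp
qed

lemma list_all2_perm_tuple:
  assumes "\<sigma> permutes {1..length xs}" "list_all2 P xs ys"
  shows "list_all2 P (perm_tuple \<sigma> xs) (perm_tuple \<sigma> ys)"
  using assms perm_tuple_index[OF assms(1)] by (simp add: list_all2_conv_all_nth nth_perm_tuple)

lemma perm_tuple_inv:
  assumes "\<sigma> permutes {1..length xs}"
  shows "perm_tuple \<sigma> (perm_tuple (inv' \<sigma>) xs) = xs" "perm_tuple (inv' \<sigma>) (perm_tuple \<sigma> xs) = xs"
  using perm_tuple_comp[OF assms permutes_inv[OF assms]]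
      perm_tuple_comp[OF permutes_inv[OF assms] assms]
    permutes_inv_o[OF assms] by simp_all

lemma nth_perm_tuple_image:
  assumes "\<sigma> permutes {1..length xs}" "i < length xs"
  shows "\<sigma> (Suc i) - 1 < length xs" "Suc (\<sigma> (Suc i) - 1) = \<sigma> (Suc i)"
    "perm_tuple \<sigma> xs ! (\<sigma> (Suc i) - 1) = xs ! i"
proof -
  show *: "\<sigma> (Suc i) - 1 < length xs" "Suc (\<sigma> (Suc i) - 1) = \<sigma> (Suc i)"
    using permutes_in_image[OF assms(1), of "Suc i"] assms(2) by auto
  show "perm_tuple \<sigma> xs ! (\<sigma> (Suc i) - 1) = xs ! i"
    using * permutes_inverses(2)[OF assms(1)] by (simp add: nth_perm_tuple)
qed

text \<open>The criterion follows each entry to its new place instead of asking where a given entry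
  came from, so that block permutations can be handled without computing their inverses.\<close>

lemma perm_tuple_eqI:
  assumes "\<sigma> permutes {1..length xs}" "length ys = length xs"
    and "\<And>i. i < length xs \<Longrightarrow> ys ! (\<sigma> (Suc i) - 1) = xs ! i"
  shows "perm_tuple \<sigma> xs = ys"
proof (rule nth_equalityI)
  fix i assume "i < length (perm_tuple \<sigma> xs)"
  hence i: "i < length xs" by simp
  show "perm_tuple \<sigma> xs ! i = ys ! i"
    using assms(3)[OF perm_tuple_index(1)[OF assms(1) i]] perm_tuple_index[OF assms(1) i] i
      permutes_inverses(1)[OF assms(1)] by (simp add: nth_perm_tuple)
qed (simp add: assms)

lemma sum_list_perm_tuple:
  fixes ks :: "nat list"
  assumes "\<sigma> permutes {1..length ks}"
  shows "sum_list (perm_tuple \<sigma> ks) = sum_list ks"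
proof -
  have "sum_list ks = (\<Sum>i<length ks. perm_tuple \<sigma> ks ! (\<sigma> (Suc i) - 1))"
    using nth_perm_tuple_image[OF assms] by (simp add: sum_list_sum_nth atLeast0LessThan)
  also have "\<dots> = (\<Sum>i<length ks. perm_tuple \<sigma> ks ! i)"
    by (rule sum.reindex_bij_witness[where i = "\<lambda>i. inv' \<sigma> (Suc i) - 1" and j =
        "\<lambda>i. \<sigma> (Suc i) - 1"])
      (use nth_perm_tuple_image[OF assms] perm_tuple_index[OF assms] permutes_inverses[OF assms] in
          auto)
  finally show ?thesis by (simp add: sum_list_sum_nth atLeast0LessThan)
qed

section \<open>Positions in a concatenation and block permutations\<close>

lemma block_decomp:
  fixes ks :: "nat list"
  assumes "j < sum_list ks"
  obtains i a where "i < length ks" "a < ks ! i" "j = sum_list (take i ks) + a"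
  using assms
proof (induction ks arbitrary: j thesis)
  case (Cons k ks)
  show ?case
  proof (cases "j < k")
    case True
    thus ?thesis using Cons.prems(1)[of 0 j] by simp
  next
    case False
    with Cons.prems(2) have "j - k < sum_list ks" by simp
    then obtain i a where "i < length ks" "a < ks ! i" "j - k = sum_list (take i ks) + a"
      using Cons.IH by blast
    thus ?thesis using False Cons.prems(1)[of "Suc i" a] by simp
  qed
qed simp

lemma block_unique:
  fixes ks :: "nat list"
  assumes "i < length ks" "a < ks ! i" "i' < length ks" "a' < ks ! i'"
    and "sum_list (take i ks) + a = sum_list (take i' ks) + a'"
  shows "i = i' \<and> a = a'"
  using assms
proof (induction ks arbitrary: i i')
  case (Cons k ks)
  show ?case
  proof (cases i)
    case 0
    thus ?thesis using Cons.prems by (cases i') simp_all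
  next
    case (Suc l)
    thus ?thesis using Cons.prems Cons.IH[of l "i' - 1"] by (cases i') simp_all
  qed
qed simp

lemma block_bound:
  fixes ks :: "nat list"
  assumes "i < length ks" "a < ks ! i"
  shows "sum_list (take i ks) + a < sum_list ks"
proof -
  have "sum_list ks = sum_list (take i ks) + sum_list (drop i ks)"
    by (metis append_take_drop_id sum_list_append)
  moreover have "ks ! i \<le> sum_list (drop i ks)" using assms(1)
      by (simp add: Cons_nth_drop_Suc[symmetric])
  ultimately show ?thesis using assms(2) by simp
qed

lemma nth_concat:
  assumes "i < length xss" "a < length (xss ! i)"
  shows "concat xss ! (sum_list (take i (map length xss)) + a) = xss ! i ! a"
  using assms
proof (induction xss arbitrary: i)
  case (Cons xs xss)
  thus ?case by (cases i) (auto simp: nth_append)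
qed simp

text \<open>\<open>block_unique\<close> makes the definite description meaningful. Block numbers and
  offsets are zero-based here, while permutations act from 1; hence the occurrences of
  \<open>Suc\<close>.\<close>

lemma sym_beta_block:
  assumes "i < length ks" "a < ks ! i"
  shows "sym_beta ks \<tau>s (Suc (sum_list (take i ks) + a)) = sum_list (take i ks) + (\<tau>s ! i) (Suc a)"
proof -
  have "(THE m. \<exists>i'\<in>{1..length ks}. \<exists>a'\<in>{1..ks ! (i' - 1)}.
      Suc (sum_list (take i ks) + a) = block_start ks i' + a' \<and> m = block_start ks i' +
          (\<tau>s ! (i' - 1)) a') =
      sum_list (take i ks) + (\<tau>s ! i) (Suc a)"
  proof (rule the_equality)
    show "\<exists>i'\<in>{1..length ks}. \<exists>a'\<in>{1..ks ! (i' - 1)}. Suc (sum_list (take i ks) + a) =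
        block_start ks i' + a' \<and>
       sum_list (take i ks) + (\<tau>s ! i) (Suc a) = block_start ks i' + (\<tau>s ! (i' - 1)) a'"
      using assms by (intro bexI[of _ "Suc i"] bexI[of _ "Suc a"]) (auto simp: block_start_def)
    fix m
    assume "\<exists>i'\<in>{1..length ks}. \<exists>a'\<in>{1..ks ! (i' - 1)}. Suc (sum_list (take i ks) + a) =
        block_start ks i' + a' \<and>
       m = block_start ks i' + (\<tau>s ! (i' - 1)) a'"
    then obtain i' a' where i': "i' \<in> {1..length ks}" "a' \<in> {1..ks ! (i' - 1)}"
      and e: "Suc (sum_list (take i ks) + a) = block_start ks i' + a'" and m: "m =
          block_start ks i' + (\<tau>s ! (i' - 1)) a'"
      by blast
    have "i = i' - 1 \<and> a = a' - 1"
      by (rule block_unique[OF assms]) (use i' e in \<open>auto simp: block_start_def\<close>)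
    thus "m = sum_list (take i ks) + (\<tau>s ! i) (Suc a)" using i' m by (auto simp: block_start_def)
  qed
  thus ?thesis using block_bound[OF assms] by (simp add: sym_beta_def)
qed

lemma sym_delta_block:
  assumes "i < length ks" "a < ks ! i"
  shows "sym_delta ks \<sigma> (Suc (sum_list (take i ks) + a)) =
    (\<Sum>i' | i' \<in> {1..length ks} \<and> \<sigma> i' < \<sigma> (Suc i). ks ! (i' - 1)) + Suc a"
proof -
  let ?s = "\<lambda>i. \<Sum>i' | i' \<in> {1..length ks} \<and> \<sigma> i' < \<sigma> i. ks ! (i' - 1)"
  have "(THE m. \<exists>i'\<in>{1..length ks}. \<exists>a'\<in>{1..ks ! (i' - 1)}.
      Suc (sum_list (take i ks) + a) = block_start ks i' + a' \<and> m = ?s i' + a') = ?s (Suc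
          i) + Suc a"
  proof (rule the_equality)
    show "\<exists>i'\<in>{1..length ks}. \<exists>a'\<in>{1..ks ! (i' - 1)}. Suc (sum_list (take i ks) + a) =
        block_start ks i' + a' \<and>
       ?s (Suc i) + Suc a = ?s i' + a'"
      using assms by (intro bexI[of _ "Suc i"] bexI[of _ "Suc a"]) (auto simp: block_start_def)
    fix m
    assume "\<exists>i'\<in>{1..length ks}. \<exists>a'\<in>{1..ks ! (i' - 1)}. Suc (sum_list (take i ks) + a) =
        block_start ks i' + a' \<and>
       m = ?s i' + a'"
    then obtain i' a' where i': "i' \<in> {1..length ks}" "a' \<in> {1..ks ! (i' - 1)}"
      and e: "Suc (sum_list (take i ks) + a) = block_start ks i' + a'" and m: "m = ?s i' + a'"
      by blast
    have "i = i' - 1 \<and> a = a' - 1"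
      by (rule block_unique[OF assms]) (use i' e in \<open>auto simp: block_start_def\<close>)
    hence "i' = Suc i" "a' = Suc a" using i' by auto
    thus "m = ?s (Suc i) + Suc a" using m by simp
  qed
  thus ?thesis using block_bound[OF assms] by (simp add: sym_delta_def)
qed

lemma sym_delta_id [simp]: "sym_delta ks id = id"
proof
  fix j
  show "sym_delta ks id j = id j"
  proof (cases "j \<in> {1..sum_list ks}")
    case True
    hence "j - 1 < sum_list ks" by auto
    then obtain i a where ia: "i < length ks" "a < ks ! i" "j - 1 = sum_list (take i ks) + a"
      by (rule block_decomp)
    have "(\<Sum>i' | i' \<in> {1..length ks} \<and> id i' < id (Suc i). ks ! (i' - 1)) = (\<Sum>i'<i. ks ! i')"
      by (rule sum.reindex_bij_witness[where i = Suc and j = "\<lambda>i. i - 1"]) (use ia in auto)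
    also have "\<dots> = sum_list (take i ks)" using ia by (simp add: sum_list_sum_nth atLeast0LessThan)
    finally have "sym_delta ks id (Suc (j - 1)) = Suc (j - 1)"
        using sym_delta_block[of i ks a id] ia by simp
    thus ?thesis using True by simp
  qed (auto simp: sym_delta_def)
qed

lemma sym_beta_id:
  assumes "length \<tau>s = length ks" "set \<tau>s \<subseteq> {id}"
  shows "sym_beta ks \<tau>s = id"
proof
  fix j
  show "sym_beta ks \<tau>s j = id j"
  proof (cases "j \<in> {1..sum_list ks}")
    case True
    hence "j - 1 < sum_list ks" by auto
    then obtain i a where ia: "i < length ks" "a < ks ! i" "j - 1 = sum_list (take i ks) + a"
      by (rule block_decomp)
    have "\<tau>s ! i = id" using assms ia nth_mem[of i \<tau>s] by (metis singletonD subsetD)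
    hence "sym_beta ks \<tau>s (Suc (j - 1)) = Suc (j - 1)" using sym_beta_block[of i ks a \<tau>s] ia by simp
    thus ?thesis using True by simp
  qed (auto simp: sym_beta_def)
qed

text \<open>Position \<open>a\<close> of block \<open>i\<close> moves to position
  \<open>\<tau>s ! i\<close> of \<open>a\<close> in the same block. That the block sum is a
  permutation is assumed as \<open>p\<close>, since in the application it is the image under
  \<open>Prm\<close> of a group element.\<close>

lemma perm_tuple_sym_beta:
  assumes ks: "ks = map length xss" and l: "length \<tau>s = length xss"
    and \<tau>: "\<And>i. i < length xss \<Longrightarrow> \<tau>s ! i permutes {1..length (xss ! i)}"
    and p: "sym_beta ks \<tau>s permutes {1..sum_list ks}"
  shows "perm_tuple (sym_beta ks \<tau>s) (concat xss) = concat (map2 perm_tuple \<tau>s xss)"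
proof (rule perm_tuple_eqI)
  have m: "map length (map2 perm_tuple \<tau>s xss) = ks"
    using l by (auto simp: ks intro: nth_equalityI)
  show "length (concat (map2 perm_tuple \<tau>s xss)) = length (concat xss)"
    unfolding length_concat m by (simp add: ks)
  show "sym_beta ks \<tau>s permutes {1..length (concat xss)}" using p by (simp add: ks length_concat)
  fix j assume "j < length (concat xss)"
  hence "j < sum_list ks" by (simp add: length_concat ks)
  then obtain i a where ia: "i < length ks" "a < ks ! i" "j = sum_list (take i ks) + a"
    by (rule block_decomp)
  note pi = nth_perm_tuple_image[OF \<tau>[of i], of a]
  have *: "sym_beta ks \<tau>s (Suc j) - 1 = sum_list (take i ks) + ((\<tau>s ! i) (Suc a) - 1)"
    unfolding ia(3) using sym_beta_block[of i ks a \<tau>s] pi ia(1,2) by (simp add: ks)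
  show "concat (map2 perm_tuple \<tau>s xss) ! (sym_beta ks \<tau>s (Suc j) - 1) = concat xss ! j"
    using nth_concat[of i "map2 perm_tuple \<tau>s xss" "(\<tau>s ! i) (Suc a) - 1"] nth_concat[of i xss a]
      pi ia l unfolding * m by (simp add: ks)
qed

lemma perm_tuple_sym_delta:
  assumes ks: "ks = map length xss" and \<sigma>: "\<sigma> permutes {1..length xss}"
    and p: "sym_delta ks \<sigma> permutes {1..sum_list ks}"
  shows "perm_tuple (sym_delta ks \<sigma>) (concat xss) = concat (perm_tuple \<sigma> xss)"
proof (rule perm_tuple_eqI)
  have m: "map length (perm_tuple \<sigma> xss) = perm_tuple \<sigma> ks" using map_perm_tuple[OF \<sigma>] ks by simp
  have lk: "length ks = length xss" by (simp add: ks)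
  show "length (concat (perm_tuple \<sigma> xss)) = length (concat xss)"
    unfolding length_concat m using sum_list_perm_tuple[of \<sigma> ks] \<sigma> by (simp add: ks)
  show "sym_delta ks \<sigma> permutes {1..length (concat xss)}" using p by (simp add: ks length_concat)
  fix j assume "j < length (concat xss)"
  hence "j < sum_list ks" by (simp add: length_concat ks)
  then obtain i a where ia: "i < length ks" "a < ks ! i" "j = sum_list (take i ks) + a"
    by (rule block_decomp)
  note pi = nth_perm_tuple_image[OF \<sigma>, of i]
  note sk = \<sigma>[folded lk]
  \<comment> \<open>The blocks that \<open>\<sigma>\<close> places before block \<open>i\<close> are
    the first ones of the permuted list, up to the new place of block \<open>i\<close>; so the sum
    in \<open>sym_delta\<close> is the start of that block after the permutation.\<close>
  have "(\<Sum>i' | i' \<in> {1..length ks} \<and> \<sigma> i' < \<sigma> (Suc i). ks ! (i' - 1)) =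
    (\<Sum>m<\<sigma> (Suc i) - 1. perm_tuple \<sigma> ks ! m)"
  proof (rule sum.reindex_bij_witness[where i = "\<lambda>m. inv' \<sigma> (Suc m)" and j = "\<lambda>i. \<sigma> i - 1"])
    fix i' assume i': "i' \<in> {i' \<in> {1..length ks}. \<sigma> i' < \<sigma> (Suc i)}"
    then obtain i'' where i'': "i' = Suc i''" "i'' < length ks" by (cases i') auto
    note q = nth_perm_tuple_image[OF sk i''(2)]
    show "inv' \<sigma> (Suc (\<sigma> i' - 1)) = i'" "perm_tuple \<sigma> ks ! (\<sigma> i' - 1) = ks ! (i' - 1)"
      using q i'' permutes_inverses(2)[OF \<sigma>] by simp_all
    show "\<sigma> i' - 1 \<in> {..<\<sigma> (Suc i) - 1}" using i' i'' q by auto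
  next
    fix m assume m: "m \<in> {..<\<sigma> (Suc i) - 1}"
    hence ml: "m < length ks" using pi ia lk by simp
    show "\<sigma> (inv' \<sigma> (Suc m)) - 1 = m" using permutes_inverses(1)[OF \<sigma>] by simp
    show "inv' \<sigma> (Suc m) \<in> {i' \<in> {1..length ks}. \<sigma> i' < \<sigma> (Suc i)}"
      using permutes_in_image[OF permutes_inv[OF sk], of "Suc m"] ml m permutes_inverses(1)[OF \<sigma>]
          by auto
  qed
  also have "\<dots> = sum_list (take (\<sigma> (Suc i) - 1) (perm_tuple \<sigma> ks))"
    using pi ia lk by (simp add: sum_list_sum_nth atLeast0LessThan)
  finally have *: "sym_delta ks \<sigma> (Suc j) - 1 =
      sum_list (take (\<sigma> (Suc i) - 1) (perm_tuple \<sigma> ks)) + a"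
    unfolding ia(3) using sym_delta_block[of i ks a \<sigma>] ia(1,2) by simp
  show "concat (perm_tuple \<sigma> xss) ! (sym_delta ks \<sigma> (Suc j) - 1) = concat xss ! j"
    using nth_concat[of "\<sigma> (Suc i) - 1" "perm_tuple \<sigma> xss" a] nth_concat[of i xss a] pi ia
    unfolding * m by (simp add: ks)
qed

section \<open>Quotients of operads by congruences\<close>

locale action_op =
  fixes L :: "'g action_operad"
  assumes action_operad: "is_action_operad L"
begin

abbreviation G where "G n \<equiv> carrier (Grp L n)"

lemma group_Grp: "group (Grp L n)"
  using action_operad by (simp add: is_action_operad_def)

lemma Prm_hom: "Prm L n \<in> hom (Grp L n) (sym_group n)"
  using action_operad by (simp add: is_action_operad_def)

lemma Prm_permutes: "g \<in> G n \<Longrightarrow> Prm L n g permutes {1..n}"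
  using Prm_hom[of n] by (auto simp: hom_def sym_group_carrier)

lemma Prm_mult: "g \<in> G n \<Longrightarrow> h \<in> G n \<Longrightarrow> Prm L n (g \<otimes>\<^bsub>Grp L n\<^esub> h) = Prm L n g \<circ> Prm L n h"
  using Prm_hom[of n] by (auto simp: hom_def sym_group_mult)

lemma Prm_one [simp]: "Prm L n \<one>\<^bsub>Grp L n\<^esub> = id"
  using hom_one[OF Prm_hom[of n] group_Grp sym_group_is_group] by (simp add: sym_group_one)

lemma one_G [simp]: "\<one>\<^bsub>Grp L n\<^esub> \<in> G n"
  using group.is_monoid[OF group_Grp] by (rule monoid.one_closed)

lemma inv_G [simp]: "g \<in> G n \<Longrightarrow> inv\<^bsub>Grp L n\<^esub> g \<in> G n"
  by (rule group.inv_closed[OF group_Grp])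

lemma mult_G [simp]: "g \<in> G n \<Longrightarrow> h \<in> G n \<Longrightarrow> g \<otimes>\<^bsub>Grp L n\<^esub> h \<in> G n"
  using group.is_monoid[OF group_Grp] by (rule monoid.m_closed)

lemma r_inv_G: "g \<in> G n \<Longrightarrow> g \<otimes>\<^bsub>Grp L n\<^esub> inv\<^bsub>Grp L n\<^esub> g = \<one>\<^bsub>Grp L n\<^esub>"
  by (rule group.r_inv[OF group_Grp])

lemma l_inv_G: "g \<in> G n \<Longrightarrow> inv\<^bsub>Grp L n\<^esub> g \<otimes>\<^bsub>Grp L n\<^esub> g = \<one>\<^bsub>Grp L n\<^esub>"
  by (rule group.l_inv[OF group_Grp])

lemma Prm_inv: "g \<in> G n \<Longrightarrow> Prm L n (inv\<^bsub>Grp L n\<^esub> g) = inv' (Prm L n g)"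
proof -
  assume g: "g \<in> G n"
  have "Prm L n g \<circ> Prm L n (inv\<^bsub>Grp L n\<^esub> g) = id"
    using Prm_mult[OF g inv_G[OF g]] r_inv_G[OF g] by simp
  thus ?thesis using inv_unique_comp[of "Prm L n g"] Prm_mult[OF inv_G[OF g] g] l_inv_G[OF g]
      by simp
qed

lemma underlying_tuple: "ops_tuple (underlying_operad L) ks hs \<longleftrightarrow> list_all2 (\<lambda>k h. h \<in> G k) ks hs"
  by (simp add: ops_tuple_def underlying_operad_def)

lemma ones_tuple: "list_all2 (\<lambda>k h. h \<in> G k) ks (map (\<lambda>k. \<one>\<^bsub>Grp L k\<^esub>) ks)"
  by (simp add: list_all2_conv_all_nth)

lemma GMu_G: "g \<in> G (length ks) \<Longrightarrow> list_all2 (\<lambda>k h. h \<in> G k) ks hs \<Longrightarrow> GMu L ks g hs \<in> G (sum_list ks)"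
  using action_operad
  by (auto simp: is_action_operad_def is_operad_def underlying_tuple)
      (simp add: underlying_operad_def)

lemma Prm_GMu:
  "g \<in> G (length ks) \<Longrightarrow> list_all2 (\<lambda>k h. h \<in> G k) ks hs \<Longrightarrow>
    Prm L (sum_list ks) (GMu L ks g hs) = sym_delta ks (Prm L (length ks) g) \<circ> sym_beta ks
        (map2 (Prm L) ks hs)"
  using action_operad
  by (auto simp: is_action_operad_def is_operad_map_def underlying_tuple)
      (simp add: underlying_operad_def sym_operad_def)

lemma L_beta_G: "list_all2 (\<lambda>k h. h \<in> G k) ks hs \<Longrightarrow> L_beta L ks hs \<in> G (sum_list ks)"
  by (simp add: L_beta_def GMu_G)

lemma L_delta_G: "g \<in> G (length ks) \<Longrightarrow> L_delta L ks g \<in> G (sum_list ks)"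
  by (simp add: L_delta_def GMu_G ones_tuple)

lemma Prm_L_beta: "list_all2 (\<lambda>k h. h \<in> G k) ks hs \<Longrightarrow>
    Prm L (sum_list ks) (L_beta L ks hs) = sym_beta ks (map2 (Prm L) ks hs)"
  by (simp add: L_beta_def Prm_GMu)

lemma Prm_L_delta:
  assumes "g \<in> G (length ks)"
  shows "Prm L (sum_list ks) (L_delta L ks g) = sym_delta ks (Prm L (length ks) g)"
proof -
  have "sym_beta ks (map2 (Prm L) ks (map (\<lambda>k. \<one>\<^bsub>Grp L k\<^esub>) ks)) = id"
    by (rule sym_beta_id) (auto simp: set_zip)
  thus ?thesis by (simp add: L_delta_def Prm_GMu[OF assms ones_tuple])
qed

end

section \<open>Tensor classes over a set of entries\<close>

definition tuples :: "'e set \<Rightarrow> nat \<Rightarrow> 'e list set" where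
  "tuples S n = {xs. length xs = n \<and> set xs \<subseteq> S}"

lemma length_tuples: "xs \<in> tuples S n \<Longrightarrow> length xs = n"
  by (simp add: tuples_def)

lemma map_tuples: "xs \<in> tuples S n \<Longrightarrow> f \<in> S \<rightarrow> S' \<Longrightarrow> map f xs \<in> tuples S' n"
  by (auto simp: tuples_def)

lemma concat_tuples: "list_all2 (\<lambda>k xs. xs \<in> tuples S k) ks xss \<Longrightarrow>
    concat xss \<in> tuples S (sum_list ks)"
  by (induction rule: list_all2_induct) (auto simp: tuples_def)

abbreviation tuple_lists :: "'e set \<Rightarrow> nat list \<Rightarrow> 'e list list \<Rightarrow> bool" where
  "tuple_lists S \<equiv> list_all2 (\<lambda>k xs. xs \<in> tuples S k)"

lemma list_all2_lengths: "tuple_lists S ks xss \<Longrightarrow> ks = map length xss"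
  by (auto simp: list_all2_conv_all_nth tuples_def intro: nth_equalityI)

definition blocks :: "(nat \<Rightarrow> 'x \<Rightarrow> 'e list \<Rightarrow> 't) \<Rightarrow> nat list \<Rightarrow> 'x list \<Rightarrow> 'e list list \<Rightarrow> 't list" where
  "blocks T ks qs xss = map2 (\<lambda>k (q, xs). T k q xs) ks (zip qs xss)"

text \<open>
  Objects and arrows of \<open>T_cat\<close> are treated alike: \<open>T n p xs\<close> stands for the class of \<open>(p, xs)\<close>,
  and \<open>T\<close> will be \<open>T_obj\<close> or \<open>T_arr\<close>.
\<close>

definition tens :: "'x operad \<Rightarrow> 'e set \<Rightarrow> (nat \<Rightarrow> 'x \<Rightarrow> 'e list \<Rightarrow> 't) \<Rightarrow> 't set" where
  "tens O' S T = {Z. \<exists>n p xs. p \<in> Ops O' n \<and> xs \<in> tuples S n \<and> Z = T n p xs}"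

lemma tens_I: "p \<in> Ops O' n \<Longrightarrow> xs \<in> tuples S n \<Longrightarrow> T n p xs \<in> tens O' S T"
  unfolding tens_def by blast

text \<open>It has the same shape as both components of \<open>T_map\<close>, which thereby become
  instances by unfolding; \<open>tens_unit\<close> and \<open>tens_mult\<close> follow
  \<open>T_unit\<close> and \<open>T_mult\<close> in the same way.\<close>

definition tens_map :: "'x operad \<Rightarrow> 'e set \<Rightarrow> (nat \<Rightarrow> 'x \<Rightarrow> 'e list \<Rightarrow> 't) \<Rightarrow> (nat \<Rightarrow> 'x \<Rightarrow> 'd list \<Rightarrow> 's) \<Rightarrow>
    ('e \<Rightarrow> 'd) \<Rightarrow> 't \<Rightarrow> 's" where
  "tens_map O' S T T' f Z = (THE W. \<exists>n p xs. p \<in> Ops O' n \<and> xs \<in> tuples S n \<and> Z = T n p xs \<and> W =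
      T' n p (map f xs))"

definition tens_unit :: "'x operad \<Rightarrow> (nat \<Rightarrow> 'x \<Rightarrow> 'e list \<Rightarrow> 't) \<Rightarrow> 'e \<Rightarrow> 't" where
  "tens_unit O' T x = T 1 (Unit O') [x]"

definition tens_mult :: "'x operad \<Rightarrow> 'e set \<Rightarrow> (nat \<Rightarrow> 'x \<Rightarrow> 'e list \<Rightarrow> 't) \<Rightarrow> (nat \<Rightarrow> 'x \<Rightarrow> 't list \<Rightarrow> 's)
    \<Rightarrow>
    's \<Rightarrow> 't" where
  "tens_mult O' S T TT Z = (THE W. \<exists>ks p qs xss. p \<in> Ops O' (length ks) \<and> ops_tuple O' ks qs \<and>
     tuple_lists S ks xss \<and>
     Z = TT (length ks) p (blocks T ks qs xss) \<and> W = T (sum_list ks) (Mu O' ks p qs) (concat xss))"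

locale equivariant_operad = action_op L for L :: "'g action_operad" +
  fixes Op :: "'x operad" and act :: "nat \<Rightarrow> 'g \<Rightarrow> 'x \<Rightarrow> 'x"
  assumes set_operad: "is_set_lam_operad L Op act"
begin

lemma act_Ops: "p \<in> Ops Op n \<Longrightarrow> g \<in> G n \<Longrightarrow> act n g p \<in> Ops Op n"
  using set_operad by (auto simp: is_set_lam_operad_def)

lemma act_one: "p \<in> Ops Op n \<Longrightarrow> act n \<one>\<^bsub>Grp L n\<^esub> p = p"
  using set_operad by (auto simp: is_set_lam_operad_def)

lemma act_mult: "p \<in> Ops Op n \<Longrightarrow> g \<in> G n \<Longrightarrow> h \<in> G n \<Longrightarrow> act n (g \<otimes>\<^bsub>Grp L n\<^esub> h) p = act n h (act n g p)"
  using set_operad by (auto simp: is_set_lam_operad_def)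

lemma act_inv: "p \<in> Ops Op n \<Longrightarrow> g \<in> G n \<Longrightarrow> act n (inv\<^bsub>Grp L n\<^esub> g) (act n g p) = p"
  using act_mult[of p n g "inv\<^bsub>Grp L n\<^esub> g"] act_one r_inv_G[of g n] by simp

lemma Mu_Ops: "p \<in> Ops Op (length ks) \<Longrightarrow> ops_tuple Op ks qs \<Longrightarrow> Mu Op ks p qs \<in> Ops Op (sum_list ks)"
  using set_operad by (auto simp: is_set_lam_operad_def is_operad_def)

lemma Unit_Ops: "Unit Op \<in> Ops Op 1"
  using set_operad by (auto simp: is_set_lam_operad_def is_operad_def)

lemma Mu_beta: "p \<in> Ops Op (length ks) \<Longrightarrow> ops_tuple Op ks qs \<Longrightarrow> list_all2 (\<lambda>k h. h \<in> G k) ks gs \<Longrightarrow>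
    Mu Op ks p (map2 (\<lambda>k (q, g). act k g q) ks (zip qs gs)) = act (sum_list ks) (L_beta L ks gs)
        (Mu Op ks p qs)"
  using set_operad by (auto simp: is_set_lam_operad_def underlying_tuple)

lemma Mu_delta: "p \<in> Ops Op (length ks) \<Longrightarrow> g \<in> G (length ks) \<Longrightarrow> ops_tuple Op ks qs \<Longrightarrow>
    Mu Op ks (act (length ks) g p) qs = act (sum_list ks) (L_delta L ks g)
          (Mu Op (perm_tuple (Prm L (length ks) g) ks) p (perm_tuple (Prm L (length ks) g) qs))"
  using set_operad by (auto simp: is_set_lam_operad_def)

text \<open>A kernel element permutes no inputs, so \<open>Mu_delta\<close> merely moves it outside.
  The resulting \<open>L_delta\<close> lies over \<open>sym_delta ks id\<close>, which is the
  identity.\<close>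

lemma Mu_ker_left:
  assumes p: "p \<in> Ops Op (length ks)" and qs: "ops_tuple Op ks qs"
    and h: "h \<in> G (length ks)" "Prm L (length ks) h = id"
  obtains k where "k \<in> G (sum_list ks)" "Prm L (sum_list ks) k = id"
    "Mu Op ks (act (length ks) h p) qs = act (sum_list ks) k (Mu Op ks p qs)"
  using that[of "L_delta L ks h"] Mu_delta[OF p h(1) qs] L_delta_G[OF h(1)] Prm_L_delta[OF h(1)]
      h(2) by simp

text \<open>\<open>Mu_beta\<close> collects the inner elements into one \<open>L_beta\<close>, which
  lies over a block sum of identities.\<close>

lemma Mu_ker_right:
  assumes p: "p \<in> Ops Op (length ks)" and qs: "ops_tuple Op ks qs" and qs': "length qs' = length ks"
    and h: "\<And>i. i < length ks \<Longrightarrow> h i \<in> G (ks ! i) \<and> Prm L (ks ! i) (h i) = id \<and> qs' ! i =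
        act (ks ! i) (h i) (qs ! i)"
  obtains k where "k \<in> G (sum_list ks)" "Prm L (sum_list ks) k = id"
    "Mu Op ks p qs' = act (sum_list ks) k (Mu Op ks p qs)"
proof -
  define hs where "hs = map h [0..<length ks]"
  have hs: "list_all2 (\<lambda>k h. h \<in> G k) ks hs" using h by (simp add: hs_def list_all2_conv_all_nth)
  have "length qs = length ks" using qs by (simp add: ops_tuple_def list_all2_lengthD)
  hence "map2 (\<lambda>k (q, g). act k g q) ks (zip qs hs) = qs'"
    using qs' h by (intro nth_equalityI) (auto simp: hs_def)
  moreover have "sym_beta ks (map2 (Prm L) ks hs) = id"
    by (rule sym_beta_id) (use h in \<open>auto simp: hs_def set_zip\<close>)
  ultimately show thesis
    using that[of "L_beta L ks hs"] Mu_beta[OF p qs hs] L_beta_G[OF hs] Prm_L_beta[OF hs] by simp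
qed

definition kernel_orbit :: "nat \<Rightarrow> 'x \<Rightarrow> 'x \<Rightarrow> bool" where
  "kernel_orbit n p q \<longleftrightarrow> p \<in> Ops Op n \<and> (\<exists>h\<in>G n. Prm L n h = id \<and> q = act n h p)"

text \<open>The kernel is normal. Together with \<open>act_conj\<close>, which says that
  \<open>p\<close> moved by \<open>h\<close> and then \<open>g\<close> is \<open>p\<close> moved by
  \<open>g\<close> and then the conjugate of \<open>h\<close>, this lets the whole group act on
  kernel orbits.\<close>

lemma Prm_conj: "g \<in> G n \<Longrightarrow> h \<in> G n \<Longrightarrow> Prm L n h = id \<Longrightarrow>
    Prm L n (inv\<^bsub>Grp L n\<^esub> g \<otimes>\<^bsub>Grp L n\<^esub> (h \<otimes>\<^bsub>Grp L n\<^esub> g)) = id"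
  using permutes_inv_o(2)[OF Prm_permutes[of g n]] by (simp add: Prm_mult Prm_inv)

lemma act_conj:
  assumes p: "p \<in> Ops Op n" and g: "g \<in> G n" and h: "h \<in> G n"
  shows "act n (inv\<^bsub>Grp L n\<^esub> g \<otimes>\<^bsub>Grp L n\<^esub> (h \<otimes>\<^bsub>Grp L n\<^esub> g)) (act n g p) = act n g (act n h p)"
proof -
  interpret group "Grp L n" by (rule group_Grp)
  have "g \<otimes>\<^bsub>Grp L n\<^esub> (inv\<^bsub>Grp L n\<^esub> g \<otimes>\<^bsub>Grp L n\<^esub> (h \<otimes>\<^bsub>Grp L n\<^esub> g)) = h \<otimes>\<^bsub>Grp L n\<^esub> g"
    using g h by (simp add: m_assoc[symmetric])
  thus ?thesis
    using act_mult[OF p g, of "inv\<^bsub>Grp L n\<^esub> g \<otimes>\<^bsub>Grp L n\<^esub> (h \<otimes>\<^bsub>Grp L n\<^esub> g)"] act_mult[OF p h g] g h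
        by simp
qed

end

text \<open>The quotient of the operad by \<open>eqv\<close> carries an action in which kernel
  elements are trivial. The instances are \<open>kernel_orbit\<close> for objects and
  \<open>arr_cong\<close> for arrows.\<close>

locale operad_congruence = equivariant_operad L Op act
  for L :: "'g action_operad" and Op :: "'x operad" and act +
  fixes eqv :: "nat \<Rightarrow> 'x \<Rightarrow> 'x \<Rightarrow> bool"
  assumes eqv_Ops: "eqv n p q \<Longrightarrow> p \<in> Ops Op n \<and> q \<in> Ops Op n"
    and eqv_refl: "p \<in> Ops Op n \<Longrightarrow> eqv n p p"
    and eqv_sym: "eqv n p q \<Longrightarrow> eqv n q p"
    and eqv_trans: "eqv n p q \<Longrightarrow> eqv n q r \<Longrightarrow> eqv n p r"
    and eqv_act: "eqv n p q \<Longrightarrow> g \<in> G n \<Longrightarrow> eqv n (act n g p) (act n g q)"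
    and eqv_ker: "p \<in> Ops Op n \<Longrightarrow> g \<in> G n \<Longrightarrow> Prm L n g = id \<Longrightarrow> eqv n (act n g p) p"
    and eqv_Mu: "eqv (length ks) p p' \<Longrightarrow> ops_tuple Op ks qs \<Longrightarrow> ops_tuple Op ks qs' \<Longrightarrow>
      (\<And>i. i < length ks \<Longrightarrow> eqv (ks ! i) (qs ! i) (qs' ! i)) \<Longrightarrow>
      eqv (sum_list ks) (Mu Op ks p qs) (Mu Op ks p' qs')"
begin

text \<open>The tensor relation between \<open>(p, g . xs')\<close> and \<open>(p . g, xs')\<close>,
  with equality of operations weakened to \<open>eqv\<close>.\<close>

definition rel :: "nat \<Rightarrow> 'x \<Rightarrow> 'e list \<Rightarrow> 'x \<Rightarrow> 'e list \<Rightarrow> bool" where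
  "rel n p xs p' xs' \<longleftrightarrow> (\<exists>g\<in>G n. eqv n p' (act n g p) \<and> xs = perm_tuple (Prm L n g) xs')"

text \<open>An interface that hides the coequalizer: \<open>T\<close> has exactly the equalities of
  the class map of \<open>rel\<close>, with different arities kept apart. The set-level arguments
  about classes use only this.\<close>

definition presents :: "'e set \<Rightarrow> (nat \<Rightarrow> 'x \<Rightarrow> 'e list \<Rightarrow> 't) \<Rightarrow> bool" where
  "presents S T \<longleftrightarrow> (\<forall>n p xs n' p' xs'. p \<in> Ops Op n \<longrightarrow> xs \<in> tuples S n \<longrightarrow> p' \<in> Ops Op n' \<longrightarrow>
      xs' \<in> tuples S n' \<longrightarrow>
     (T n p xs = T n' p' xs' \<longleftrightarrow> n = n' \<and> rel n p xs p' xs'))"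

lemma presentsD:
  "presents S T \<Longrightarrow> p \<in> Ops Op n \<Longrightarrow> xs \<in> tuples S n \<Longrightarrow> p' \<in> Ops Op n' \<Longrightarrow> xs' \<in> tuples S n' \<Longrightarrow>
   T n p xs = T n' p' xs' \<longleftrightarrow> n = n' \<and> rel n p xs p' xs'"
  unfolding presents_def by blast

lemma rel_eqv: "eqv n p p' \<Longrightarrow> rel n p xs p' xs"
  unfolding rel_def by (rule bexI[of _ "\<one>\<^bsub>Grp L n\<^esub>"]) (use eqv_Ops eqv_sym in \<open>auto simp: act_one\<close>)

lemma rel_act: "p \<in> Ops Op n \<Longrightarrow> g \<in> G n \<Longrightarrow> rel n p (perm_tuple (Prm L n g) xs) (act n g p) xs"
  unfolding rel_def by (rule bexI[of _ g]) (auto intro: eqv_refl act_Ops)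

lemma rel_sym:
  assumes r: "rel n p xs p' xs'" and p: "p \<in> Ops Op n" and xs': "length xs' = n"
  shows "rel n p' xs' p xs"
proof -
  from r obtain g where g: "g \<in> G n" "eqv n p' (act n g p)" "xs = perm_tuple (Prm L n g) xs'"
    unfolding rel_def by blast
  have "eqv n p (act n (inv\<^bsub>Grp L n\<^esub> g) p')"
    using eqv_act[OF eqv_sym[OF g(2)] inv_G[OF g(1)]] act_inv[OF p g(1)] by simp
  moreover have "xs' = perm_tuple (Prm L n (inv\<^bsub>Grp L n\<^esub> g)) xs"
    unfolding g(3) Prm_inv[OF g(1)] using perm_tuple_inv(2) Prm_permutes[OF g(1)] xs' by metis
  ultimately show ?thesis unfolding rel_def using inv_G[OF g(1)] by blast
qed

lemma rel_trans:
  assumes r: "rel n p xs p' xs'" and r': "rel n p' xs' p'' xs''" and p: "p \<in> Ops Op n"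
      and xs: "length xs'' = n"
  shows "rel n p xs p'' xs''"
proof -
  from r obtain g where g: "g \<in> G n" "eqv n p' (act n g p)" "xs = perm_tuple (Prm L n g) xs'"
    unfolding rel_def by blast
  from r' obtain h where h: "h \<in> G n" "eqv n p'' (act n h p')" "xs' = perm_tuple (Prm L n h) xs''"
    unfolding rel_def by blast
  have "eqv n p'' (act n (g \<otimes>\<^bsub>Grp L n\<^esub> h) p)"
    using eqv_trans[OF h(2) eqv_act[OF g(2) h(1)]] act_mult[OF p g(1) h(1)] by simp
  moreover have "xs = perm_tuple (Prm L n (g \<otimes>\<^bsub>Grp L n\<^esub> h)) xs''"
    unfolding g(3) h(3) Prm_mult[OF g(1) h(1)]
    by (rule perm_tuple_comp[symmetric])
        (use Prm_permutes[OF g(1)] Prm_permutes[OF h(1)] xs in simp_all)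
  ultimately show ?thesis unfolding rel_def using mult_G[OF g(1) h(1)] by blast
qed

lemma rel_map:
  assumes "rel n p xs p' xs'" "length xs' = n"
  shows "rel n p (map f xs) p' (map f xs')"
  using assms Prm_permutes unfolding rel_def by (auto simp: map_perm_tuple)

lemma perm_tuple_tuples: "g \<in> G n \<Longrightarrow> xs \<in> tuples S n \<Longrightarrow> perm_tuple (Prm L n g) xs \<in> tuples S n"
  using set_perm_tuple_subset[of "Prm L n g" xs] Prm_permutes[of g n] by (auto simp: tuples_def)

lemma tens_map_eq:
  assumes T: "presents S T" and T': "presents S' T'" and f: "f \<in> S \<rightarrow> S'"
    and p: "p \<in> Ops Op n" and xs: "xs \<in> tuples S n"
  shows "tens_map Op S T T' f (T n p xs) = T' n p (map f xs)"
  unfolding tens_map_def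
proof (rule the_equality)
  fix W assume "\<exists>n' p' xs'. p' \<in> Ops Op n' \<and> xs' \<in> tuples S n' \<and> T n p xs = T n' p' xs' \<and> W =
      T' n' p' (map f xs')"
  then obtain n' p' xs' where h: "p' \<in> Ops Op n'" "xs' \<in> tuples S n'" "T n p xs = T n' p' xs'" "W =
      T' n' p' (map f xs')"
    by blast
  hence "n = n'" "rel n p xs p' xs'" using presentsD[OF T p xs] by auto
  moreover have "rel n p (map f xs) p' (map f xs')"
    by (rule rel_map) (use calculation h length_tuples in auto)
  ultimately show "W = T' n p (map f xs)"
    using presentsD[OF T' p map_tuples[OF xs f] h(1) map_tuples[OF h(2) f]] h(4) by simp
qed (use p xs in blast)

lemma tens_map_tens:
  assumes T: "presents S T" and T': "presents S' T'" and f: "f \<in> S \<rightarrow> S'"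
  shows "tens_map Op S T T' f \<in> tens Op S T \<rightarrow> tens Op S' T'"
  using tens_map_eq[OF assms] map_tuples[OF _ f] by (auto simp: tens_def) blast

lemma tens_unit_tens: "x \<in> S \<Longrightarrow> tens_unit Op T x \<in> tens Op S T"
  unfolding tens_unit_def by (intro tens_I Unit_Ops) (simp add: tuples_def)

lemma length_blocks: "length ks = length qs \<Longrightarrow> length qs = length xss \<Longrightarrow> length (blocks T ks qs xss) =
    length ks"
  by (simp add: blocks_def)

lemma nth_blocks: "i < length ks \<Longrightarrow> length ks = length qs \<Longrightarrow> length qs = length xss \<Longrightarrow>
    blocks T ks qs xss ! i = T (ks ! i) (qs ! i) (xss ! i)"
  by (simp add: blocks_def)

lemma perm_blocks:
  assumes "\<sigma> permutes {1..length ks}" "length ks = length qs" "length qs = length xss"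
  shows "perm_tuple \<sigma> (blocks T ks qs xss) =
      blocks T (perm_tuple \<sigma> ks) (perm_tuple \<sigma> qs) (perm_tuple \<sigma> xss)"
  using assms unfolding blocks_def by (simp add: zip_perm_tuple map_perm_tuple)

lemma blocks_tuples:
  assumes "ops_tuple Op ks qs" "tuple_lists S ks xss"
  shows "blocks T ks qs xss \<in> tuples (tens Op S T) (length ks)"
  using assms unfolding ops_tuple_def list_all2_conv_all_nth
  by (auto simp: tuples_def length_blocks in_set_conv_nth nth_blocks intro!: tens_I)

lemma blocks_rep:
  assumes "ts \<in> tuples (tens Op S T) n"
  obtains ks qs xss where "length ks = n" "ops_tuple Op ks qs" "tuple_lists S ks xss"
    "ts = blocks T ks qs xss"
proof -
  have "\<forall>i<n. \<exists>k q xs. q \<in> Ops Op k \<and> xs \<in> tuples S k \<and> ts ! i = T k q xs"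
    using assms nth_mem by (fastforce simp: tuples_def tens_def)
  then obtain k q xs where h: "\<And>i. i < n \<Longrightarrow> q i \<in> Ops Op (k i) \<and> xs i \<in> tuples S (k i) \<and> ts ! i =
      T (k i) (q i) (xs i)"
    by metis
  show thesis
    by (rule that[of "map k [0..<n]" "map q [0..<n]" "map xs [0..<n]"])
      (use h assms in \<open>auto simp: ops_tuple_def list_all2_conv_all_nth tuples_def length_blocks
          nth_blocks intro!: nth_equalityI\<close>)
qed

text \<open>
  The rearrangement of the blocks and the rearrangements inside the blocks combine, by the two
  equivariance axioms, into one element of \<open>\<Lambda>(k\<^sub>1 + \<dots> + k\<^sub>n)\<close>.
\<close>

lemma rel_Mu:
  assumes g: "g \<in> G (length ks')" and p: "p \<in> Ops Op (length ks')"
      and pp: "eqv (length ks') p' (act (length ks') g p)"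
    and qs': "ops_tuple Op ks' qs'" and xss': "tuple_lists S ks' xss'"
    and ks: "ks = perm_tuple (Prm L (length ks') g) ks'"
    and qs: "ops_tuple Op ks qs" and xss: "tuple_lists S ks xss"
    and r: "\<And>i. i < length ks \<Longrightarrow> rel (ks ! i) (qs ! i) (xss ! i)
        (perm_tuple (Prm L (length ks') g) qs' ! i) (perm_tuple (Prm L (length ks') g) xss' ! i)"
  shows "rel (sum_list ks) (Mu Op ks p qs) (concat xss) (Mu Op ks' p' qs') (concat xss')"
proof -
  let ?s = "Prm L (length ks') g"
  let ?n = "length ks'"
  have n: "length ks = ?n" by (simp add: ks)
  have s: "?s permutes {1..?n}" using Prm_permutes[OF g] .
  have ls: "length qs = ?n" "length xss = ?n" "length qs' = ?n" "length xss' = ?n"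
    using qs xss qs' xss' n by (auto simp: ops_tuple_def dest: list_all2_lengthD)
  from r obtain h where h: "\<And>i. i < ?n \<Longrightarrow> h i \<in> G (ks ! i)"
    "\<And>i. i < ?n \<Longrightarrow> eqv (ks ! i) (perm_tuple ?s qs' ! i) (act (ks ! i) (h i) (qs ! i))"
    "\<And>i. i < ?n \<Longrightarrow> xss ! i = perm_tuple (Prm L (ks ! i) (h i)) (perm_tuple ?s xss' ! i)"
    unfolding rel_def n by metis
  define hs where "hs = map h [0..<?n]"
  have hsG: "list_all2 (\<lambda>k h. h \<in> G k) ks hs" using h(1)
      by (simp add: hs_def list_all2_conv_all_nth n)
  have sum: "sum_list ks = sum_list ks'" using sum_list_perm_tuple[OF s] by (simp add: ks)
  let ?b = "L_beta L ks hs" and ?d = "L_delta L ks' g"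
  have b: "?b \<in> G (sum_list ks)" using L_beta_G[OF hsG] .
  have d: "?d \<in> G (sum_list ks)" using L_delta_G[OF g] sum by simp
  have M: "Mu Op ks p qs \<in> Ops Op (sum_list ks)" using Mu_Ops qs p n by simp
  have qs'': "ops_tuple Op ks (perm_tuple ?s qs')"
    using list_all2_perm_tuple[OF s] qs' unfolding ks ops_tuple_def by blast
  have "eqv (sum_list ks) (Mu Op ks' p' qs') (Mu Op ks' (act ?n g p) qs')"
    unfolding sum by (rule eqv_Mu) (use pp qs' in \<open>auto simp: ops_tuple_def list_all2_conv_all_nth
        intro: eqv_refl\<close>)
  also have "Mu Op ks' (act ?n g p) qs' = act (sum_list ks) ?d (Mu Op ks p (perm_tuple ?s qs'))"
    using Mu_delta[OF p g qs', folded ks] by (simp add: sum)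
  finally have e1: "eqv (sum_list ks) (Mu Op ks' p' qs')
      (act (sum_list ks) ?d (Mu Op ks p (perm_tuple ?s qs')))" .
  have "eqv (sum_list ks) (Mu Op ks p (perm_tuple ?s qs'))
      (Mu Op ks p (map2 (\<lambda>k (q, g). act k g q) ks (zip qs hs)))"
  proof (rule eqv_Mu)
    show "eqv (length ks) p p" using p n by (simp add: eqv_refl)
    show "ops_tuple Op ks (map2 (\<lambda>k (q, g). act k g q) ks (zip qs hs))"
      using qs h(1) ls n by (auto simp: ops_tuple_def list_all2_conv_all_nth hs_def intro: act_Ops)
  qed (use qs'' h(2) ls n in \<open>auto simp: hs_def\<close>)
  also have "Mu Op ks p (map2 (\<lambda>k (q, g). act k g q) ks (zip qs hs)) =
      act (sum_list ks) ?b (Mu Op ks p qs)"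
    by (rule Mu_beta) (use p n qs hsG in auto)
  finally have "eqv (sum_list ks) (act (sum_list ks) ?d (Mu Op ks p (perm_tuple ?s qs')))
     (act (sum_list ks) ?d (act (sum_list ks) ?b (Mu Op ks p qs)))"
    using d by (rule eqv_act)
  with e1 have "eqv (sum_list ks) (Mu Op ks' p' qs')
      (act (sum_list ks) (?b \<otimes>\<^bsub>Grp L (sum_list ks)\<^esub> ?d) (Mu Op ks p qs))"
    using act_mult[OF M b d] eqv_trans by simp
  \<comment> \<open>Operations are acted on from the right and tuples from the left. So on tuples
    the same product first moves whole blocks by \<open>L_delta\<close> and then permutes inside
    them by \<open>L_beta\<close>.\<close>
  moreover have "concat xss = perm_tuple (Prm L (sum_list ks) (?b \<otimes>\<^bsub>Grp L (sum_list ks)\<^esub> ?d))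
      (concat xss')"
  proof -
    have lc: "length (concat xss') = sum_list ks" using list_all2_lengths[OF xss']
        by (simp add: length_concat sum)
    have xss'': "tuple_lists S ks (perm_tuple ?s xss')"
      using list_all2_perm_tuple[OF s xss'] by (simp add: ks)
    have pd: "Prm L (sum_list ks) ?d = sym_delta ks' ?s" using Prm_L_delta[OF g] by (simp add: sum)
    have pb: "Prm L (sum_list ks) ?b = sym_beta ks (map2 (Prm L) ks hs)" using Prm_L_beta[OF hsG] .
    have "perm_tuple (Prm L (sum_list ks) (?b \<otimes>\<^bsub>Grp L (sum_list ks)\<^esub> ?d)) (concat xss') =
      perm_tuple (Prm L (sum_list ks) ?b) (perm_tuple (Prm L (sum_list ks) ?d) (concat xss'))"
      unfolding Prm_mult[OF b d] by (rule perm_tuple_comp)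
          (use Prm_permutes[OF b] Prm_permutes[OF d] lc in simp_all)
    also have "perm_tuple (Prm L (sum_list ks) ?d) (concat xss') = concat (perm_tuple ?s xss')"
      unfolding pd
    proof (rule perm_tuple_sym_delta)
      show "ks' = map length xss'" using list_all2_lengths[OF xss'] .
      show "?s permutes {1..length xss'}" using s unfolding ls .
      show "sym_delta ks' ?s permutes {1..sum_list ks'}"
          using Prm_permutes[OF d, unfolded pd, unfolded sum] .
    qed
    also have "perm_tuple (Prm L (sum_list ks) ?b) (concat (perm_tuple ?s xss')) =
       concat (map2 perm_tuple (map2 (Prm L) ks hs) (perm_tuple ?s xss'))"
      unfolding pb
    proof (rule perm_tuple_sym_beta)
      show *: "ks = map length (perm_tuple ?s xss')" using list_all2_lengths[OF xss''] .
      show "sym_beta ks (map2 (Prm L) ks hs) permutes {1..sum_list ks}" using Prm_permutes[OF b] pb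
          by simp
      show "length (map2 (Prm L) ks hs) = length (perm_tuple ?s xss')" using ls n
          by (simp add: hs_def)
      fix i assume i: "i < length (perm_tuple ?s xss')"
      hence "length (perm_tuple ?s xss' ! i) = ks ! i"
        using list_all2_nthD2[OF xss'', of i] by (simp add: tuples_def)
      thus "map2 (Prm L) ks hs ! i permutes {1..length (perm_tuple ?s xss' ! i)}"
        using i ls n h(1) Prm_permutes by (simp add: hs_def)
    qed
    also have "map2 perm_tuple (map2 (Prm L) ks hs) (perm_tuple ?s xss') = xss"
    proof (rule nth_equalityI)
      fix i assume "i < length (map2 perm_tuple (map2 (Prm L) ks hs) (perm_tuple ?s xss'))"
      hence "i < ?n" using ls n by (simp add: hs_def)
      thus "map2 perm_tuple (map2 (Prm L) ks hs) (perm_tuple ?s xss') ! i = xss ! i"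
        using ls n by (simp add: hs_def h(3))
    qed (use ls n in \<open>simp add: hs_def\<close>)
    finally show ?thesis by (rule HOL.sym)
  qed
  ultimately show ?thesis unfolding rel_def using mult_G[OF b d] by (intro bexI conjI)
qed

text \<open>Two descriptions of the same class differ by one outer group element and by a relation
  in each block; \<open>rel_Mu\<close> shows that their composites are related, so the definite
  description in \<open>tens_mult\<close> has one value.\<close>

lemma tens_mult_eq:
  assumes T: "presents S T" and TT: "presents (tens Op S T) TT"
    and p: "p \<in> Ops Op (length ks)" and qs: "ops_tuple Op ks qs" and xss: "tuple_lists S ks xss"
  shows "tens_mult Op S T TT (TT (length ks) p (blocks T ks qs xss)) =
      T (sum_list ks) (Mu Op ks p qs) (concat xss)"
  unfolding tens_mult_def
proof (rule the_equality)
  fix W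
  assume "\<exists>ks' p' qs' xss'. p' \<in> Ops Op (length ks') \<and> ops_tuple Op ks' qs' \<and>
     tuple_lists S ks' xss' \<and>
     TT (length ks) p (blocks T ks qs xss) = TT (length ks') p' (blocks T ks' qs' xss') \<and>
     W = T (sum_list ks') (Mu Op ks' p' qs') (concat xss')"
  then obtain ks' p' qs' xss' where p': "p' \<in> Ops Op (length ks')" and qs': "ops_tuple Op ks' qs'"
    and xss': "tuple_lists S ks' xss'"
    and e: "TT (length ks) p (blocks T ks qs xss) = TT (length ks') p' (blocks T ks' qs' xss')"
    and W: "W = T (sum_list ks') (Mu Op ks' p' qs') (concat xss')" by blast
  from e have n: "length ks = length ks'"
      and "rel (length ks) p (blocks T ks qs xss) p' (blocks T ks' qs' xss')"
    using presentsD[OF TT p blocks_tuples[OF qs xss] p' blocks_tuples[OF qs' xss']] by auto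
  then obtain g where g: "g \<in> G (length ks')" and pp: "eqv (length ks') p' (act (length ks') g p)"
    and b: "blocks T ks qs xss = perm_tuple (Prm L (length ks') g) (blocks T ks' qs' xss')"
    unfolding rel_def by auto
  let ?s = "Prm L (length ks') g"
  have s: "?s permutes {1..length ks'}" using Prm_permutes[OF g] .
  have ls: "length qs = length ks'" "length xss = length ks'" "length qs' = length ks'"
      "length xss' = length ks'"
    using qs xss qs' xss' n by (auto simp: ops_tuple_def dest: list_all2_lengthD)
  have b': "blocks T ks qs xss = blocks T (perm_tuple ?s ks') (perm_tuple ?s qs')
      (perm_tuple ?s xss')"
    using b perm_blocks[OF s, of qs' xss'] ls by simp
  have qs'': "ops_tuple Op (perm_tuple ?s ks') (perm_tuple ?s qs')"
    using list_all2_perm_tuple[OF s] qs' unfolding ops_tuple_def by blast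
  have xss'': "tuple_lists S (perm_tuple ?s ks') (perm_tuple ?s xss')"
    using list_all2_perm_tuple[OF s xss'] .
  \<comment> \<open>Equal inner classes have equal arities. Hence the equation between the two lists
    of blocks also shows that \<open>ks\<close> is the permuted \<open>ks'\<close>.\<close>
  have r: "ks ! i = perm_tuple ?s ks' ! i \<and>
      rel (ks ! i) (qs ! i) (xss ! i) (perm_tuple ?s qs' ! i) (perm_tuple ?s xss' ! i)"
    if i: "i < length ks" for i
  proof -
    have "T (ks ! i) (qs ! i) (xss ! i) =
        T (perm_tuple ?s ks' ! i) (perm_tuple ?s qs' ! i) (perm_tuple ?s xss' ! i)"
      using nth_blocks[of i ks qs xss T]
          nth_blocks[of i "perm_tuple ?s ks'" "perm_tuple ?s qs'" "perm_tuple ?s xss'" T] b' i n ls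
      by simp
    moreover have "qs ! i \<in> Ops Op (ks ! i)" "xss ! i \<in> tuples S (ks ! i)"
      using qs xss i by (auto simp: ops_tuple_def list_all2_conv_all_nth)
    moreover have "perm_tuple ?s qs' ! i \<in> Ops Op (perm_tuple ?s ks' ! i)"
        "perm_tuple ?s xss' ! i \<in> tuples S (perm_tuple ?s ks' ! i)"
      using list_all2_nthD[OF qs''[unfolded ops_tuple_def], of i] list_all2_nthD[OF xss'', of i] i n
          by auto
    ultimately show ?thesis using presentsD[OF T] by metis
  qed
  have ks: "ks = perm_tuple ?s ks'" by (rule nth_equalityI) (use r n in auto)
  have R: "rel (sum_list ks) (Mu Op ks p qs) (concat xss) (Mu Op ks' p' qs') (concat xss')"
  proof (rule rel_Mu[OF g _ pp qs' xss' ks qs xss])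
    show "p \<in> Ops Op (length ks')" using p n by simp
  qed (rule conjunct2[OF r])
  have sum: "sum_list ks = sum_list ks'" using sum_list_perm_tuple[OF s] ks by simp
  show "W = T (sum_list ks) (Mu Op ks p qs) (concat xss)"
    unfolding W
    using presentsD[OF T Mu_Ops[OF p qs] concat_tuples[OF xss] Mu_Ops[OF p' qs'] concat_tuples[OF
        xss']] R sum by simp
qed (use p qs xss in blast)

lemma tens_mult_tens:
  assumes T: "presents S T" and TT: "presents (tens Op S T) TT"
  shows "tens_mult Op S T TT \<in> tens Op (tens Op S T) TT \<rightarrow> tens Op S T"
proof
  fix Z assume "Z \<in> tens Op (tens Op S T) TT"
  then obtain n p ts where h: "p \<in> Ops Op n" "ts \<in> tuples (tens Op S T) n" "Z = TT n p ts"
      unfolding tens_def by blast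
  obtain ks qs xss where k: "length ks = n" "ops_tuple Op ks qs" "tuple_lists S ks xss"
    "ts = blocks T ks qs xss" by (rule blocks_rep[OF h(2)])
  thus "tens_mult Op S T TT Z \<in> tens Op S T"
    using tens_mult_eq[OF T TT, of p ks qs xss] h by (auto intro!: tens_I Mu_Ops concat_tuples)
qed

end

text \<open>For the multiplication, the outer operation and the inner ones are changed separately;
  each change costs one kernel element, and their product is again in the kernel.\<close>

lemma (in equivariant_operad) operad_congruence_kernel_orbit: "operad_congruence L Op act
    kernel_orbit"
proof
  fix n p q r assume "kernel_orbit n p q"
  then obtain h where p: "p \<in> Ops Op n" and h: "h \<in> G n" "Prm L n h = id" and q: "q = act n h p"
    unfolding kernel_orbit_def by blast
  show "p \<in> Ops Op n \<and> q \<in> Ops Op n" using p h q act_Ops by simp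
  show "kernel_orbit n q p"
    unfolding kernel_orbit_def using p h q act_Ops act_inv[OF p h(1)]
    by (intro conjI bexI[of _ "inv\<^bsub>Grp L n\<^esub> h"]) (simp_all add: Prm_inv)
  show "kernel_orbit n p r" if "kernel_orbit n q r"
  proof -
    from that obtain k where k: "k \<in> G n" "Prm L n k = id" "r = act n k q"
        unfolding kernel_orbit_def by blast
    show ?thesis unfolding kernel_orbit_def
      using p h q k act_mult[OF p h(1) k(1)]
          by (intro conjI bexI[of _ "h \<otimes>\<^bsub>Grp L n\<^esub> k"]) (simp_all add: Prm_mult)
  qed
  fix g assume g: "g \<in> G n"
  show "kernel_orbit n (act n g p) (act n g q)"
    unfolding kernel_orbit_def using act_conj[OF p g h(1)] Prm_conj[OF g h] g h q act_Ops[OF p g]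
    by (intro conjI bexI[of _ "inv\<^bsub>Grp L n\<^esub> g \<otimes>\<^bsub>Grp L n\<^esub> (h \<otimes>\<^bsub>Grp L n\<^esub> g)"]) simp_all
next
  fix n p assume p: "p \<in> Ops Op n"
  show "kernel_orbit n p p"
    unfolding kernel_orbit_def using p act_one[OF p]
        by (intro conjI bexI[of _ "\<one>\<^bsub>Grp L n\<^esub>"]) simp_all
  fix g assume g: "g \<in> G n" "Prm L n g = id"
  show "kernel_orbit n (act n g p) p"
    unfolding kernel_orbit_def using p g act_Ops act_inv[OF p g(1)]
    by (intro conjI bexI[of _ "inv\<^bsub>Grp L n\<^esub> g"]) (simp_all add: Prm_inv)
next
  fix ks p p' qs qs'
  assume p': "kernel_orbit (length ks) p p'" and qs: "ops_tuple Op ks qs"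
      and qs': "ops_tuple Op ks qs'"
    and o: "\<And>i. i < length ks \<Longrightarrow> kernel_orbit (ks ! i) (qs ! i) (qs' ! i)"
  from p' obtain h where p: "p \<in> Ops Op (length ks)" and h: "h \<in> G (length ks)"
      "Prm L (length ks) h = id"
    and ph: "p' = act (length ks) h p" unfolding kernel_orbit_def by blast
  obtain k where k: "k \<in> G (sum_list ks)" "Prm L (sum_list ks) k = id" "Mu Op ks p' qs' =
      act (sum_list ks) k (Mu Op ks p qs')"
    unfolding ph by (rule Mu_ker_left[OF p qs' h])
  from o obtain f where "\<And>i. i < length ks \<Longrightarrow> f i \<in> G (ks ! i) \<and> Prm L (ks ! i) (f i) = id \<and>
      qs' ! i = act (ks ! i) (f i) (qs ! i)"
    unfolding kernel_orbit_def by metis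
  moreover have "length qs' = length ks" using qs' by (simp add: ops_tuple_def list_all2_lengthD)
  ultimately obtain l where l: "l \<in> G (sum_list ks)" "Prm L (sum_list ks) l = id" "Mu Op ks p qs' =
      act (sum_list ks) l (Mu Op ks p qs)"
    using Mu_ker_right[OF p qs] by blast
  show "kernel_orbit (sum_list ks) (Mu Op ks p qs) (Mu Op ks p' qs')"
    unfolding kernel_orbit_def using k l Mu_Ops[OF p qs] act_mult[OF Mu_Ops[OF p qs] l(1) k(1)]
    by (intro conjI bexI[of _ "l \<otimes>\<^bsub>Grp L (sum_list ks)\<^esub> k"]) (simp_all add: Prm_mult)
qed

section \<open>Pullback squares of sets over a free congruence\<close>

locale free_congruence = operad_congruence L Op act eqv
  for L :: "'g action_operad" and Op :: "'x operad" and act and eqv +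
  assumes eqv_free: "p \<in> Ops Op n \<Longrightarrow> g \<in> G n \<Longrightarrow> eqv n (act n g p) p \<Longrightarrow> Prm L n g = id"
begin

text \<open>The product of \<open>g\<close> with the inverse of \<open>h\<close> fixes the class of
  \<open>p\<close>, so freeness puts it into the kernel. This is the uniqueness, modulo the kernel,
  of the element relating two representatives.\<close>

lemma Prm_eqI:
  assumes p: "p \<in> Ops Op n" and g: "g \<in> G n" and h: "h \<in> G n" and e: "eqv n (act n g p) (act n h p)"
  shows "Prm L n g = Prm L n h"
proof -
  let ?k = "g \<otimes>\<^bsub>Grp L n\<^esub> inv\<^bsub>Grp L n\<^esub> h"
  have "eqv n (act n ?k p) p"
    using eqv_act[OF e inv_G[OF h]] act_inv[OF p h] act_mult[OF p g inv_G[OF h]] by simp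
  hence "Prm L n g \<circ> inv' (Prm L n h) = id"
    using eqv_free[OF p mult_G[OF g inv_G[OF h]]] Prm_mult[OF g inv_G[OF h]] Prm_inv[OF h] by simp
  hence "Prm L n g \<circ> inv' (Prm L n h) \<circ> Prm L n h = Prm L n h" by simp
  thus ?thesis using permutes_inv_o(2)[OF Prm_permutes[OF h]] by (simp add: comp_assoc)
qed

text \<open>For existence, absorb the group element that relates the two images into the second
  tuple and lift entry by entry. For uniqueness, each projection supplies its own group element;
  both carry the class of \<open>u\<close> to that of \<open>v\<close>, so by \<open>Prm_eqI\<close>
  they permute alike, and the tuples agree entrywise.\<close>

lemma set_pullback_tens_map:
  assumes W: "presents W TW" and A: "presents A TA" and B: "presents B TB" and C: "presents C TC"
    and pb: "set_pullback W A B p q f g" and f: "f \<in> A \<rightarrow> C" and g: "g \<in> B \<rightarrow> C"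
  shows "set_pullback (tens Op W TW) (tens Op A TA) (tens Op B TB)
     (tens_map Op W TW TA p) (tens_map Op W TW TB q) (tens_map Op A TA TC f)
         (tens_map Op B TB TC g)"
proof -
  have p: "p \<in> W \<rightarrow> A" and q: "q \<in> W \<rightarrow> B" and fp: "\<And>w. w \<in> W \<Longrightarrow> f (p w) = g (q w)"
    using pb by (auto simp: set_pullback_def)
  note me = tens_map_eq[OF W A p] tens_map_eq[OF W B q] tens_map_eq[OF A C f] tens_map_eq[OF B C g]
  note mt = map_tuples[OF _ p] map_tuples[OF _ q] map_tuples[OF _ f] map_tuples[OF _ g]
  show ?thesis
    unfolding set_pullback_def
  proof (intro conjI ballI impI)
    fix Z assume "Z \<in> tens Op W TW"
    then obtain n u ws where h: "u \<in> Ops Op n" "ws \<in> tuples W n" "Z = TW n u ws" unfolding tens_def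
        by blast
    show "tens_map Op W TW TA p Z \<in> tens Op A TA" "tens_map Op W TW TB q Z \<in> tens Op B TB"
      using h mt by (auto simp: me intro!: tens_I)
    have "map f (map p ws) = map g (map q ws)" using h(2) fp by (auto simp: tuples_def)
    thus "tens_map Op A TA TC f (tens_map Op W TW TA p Z) =
        tens_map Op B TB TC g (tens_map Op W TW TB q Z)"
      using h mt by (simp add: me del: map_map)
  next
    fix a b assume "a \<in> tens Op A TA" "b \<in> tens Op B TB"
      and e: "tens_map Op A TA TC f a = tens_map Op B TB TC g b"
    then obtain n u as n' v bs where h: "u \<in> Ops Op n" "as \<in> tuples A n" "a = TA n u as"
      "v \<in> Ops Op n'" "bs \<in> tuples B n'" "b = TB n' v bs" unfolding tens_def by blast
    from e have "TC n u (map f as) = TC n' v (map g bs)" using h by (simp add: me)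
    hence n: "n' = n" and "rel n u (map f as) v (map g bs)"
      using presentsD[OF C h(1) mt(3)[OF h(2)] h(4) mt(4)[OF h(5)]] by auto
    then obtain k where k: "k \<in> G n" "eqv n v (act n k u)" "map f as =
        perm_tuple (Prm L n k) (map g bs)"
      unfolding rel_def by blast
    let ?bs = "perm_tuple (Prm L n k) bs"
    have bs: "?bs \<in> tuples B n" using perm_tuple_tuples[OF k(1)] h(5) n by simp
    have fg: "map f as = map g ?bs" using k(3) map_perm_tuple[of "Prm L n k" bs g]
        Prm_permutes[OF k(1)] h(5) n
      by (simp add: tuples_def)
    have "\<exists>w\<in>W. p w = as ! i \<and> q w = ?bs ! i" if "i < n" for i
    proof (rule set_pullback_ex[OF pb])
      show "as ! i \<in> A" "?bs ! i \<in> B" using h(2) bs that by (auto simp: tuples_def)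
      show "f (as ! i) = g (?bs ! i)" using arg_cong[OF fg, of "\<lambda>l. l ! i"] h(2) bs that
          by (simp add: tuples_def)
    qed
    then obtain w where w: "\<And>i. i < n \<Longrightarrow> w i \<in> W \<and> p (w i) = as ! i \<and> q (w i) = ?bs ! i" by metis
    let ?ws = "map w [0..<n]"
    have ws: "?ws \<in> tuples W n" using w by (auto simp: tuples_def)
    have "map p ?ws = as" "map q ?ws = ?bs"
      using w length_tuples[OF h(2)] length_tuples[OF bs] by (auto intro!: nth_equalityI)
    hence "tens_map Op W TW TA p (TW n u ?ws) = a" "tens_map Op W TW TB q (TW n u ?ws) = TB n u ?bs"
      using me(1,2)[OF h(1) ws] h by simp_all
    moreover have "TB n u ?bs = b"
      using presentsD[OF B h(1) bs h(4) h(5)] k n h by (auto simp: rel_def)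
    ultimately show "\<exists>w\<in>tens Op W TW. tens_map Op W TW TA p w = a \<and> tens_map Op W TW TB q w = b"
      using tens_I[where T = TW, OF h(1) ws] by blast
  next
    fix Z Z' assume "Z \<in> tens Op W TW" "Z' \<in> tens Op W TW"
      and e: "tens_map Op W TW TA p Z = tens_map Op W TW TA p Z'" "tens_map Op W TW TB q Z =
          tens_map Op W TW TB q Z'"
    then obtain n u ws n' v ws' where h: "u \<in> Ops Op n" "ws \<in> tuples W n" "Z = TW n u ws"
      "v \<in> Ops Op n'" "ws' \<in> tuples W n'" "Z' = TW n' v ws'" unfolding tens_def by blast
    from e(1) have "TA n u (map p ws) = TA n' v (map p ws')" using h by (simp add: me)
    hence n: "n' = n" and "rel n u (map p ws) v (map p ws')"
      using presentsD[OF A h(1) mt(1)[OF h(2)] h(4) mt(1)[OF h(5)]] by auto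
    then obtain k where k: "k \<in> G n" "eqv n v (act n k u)" "map p ws =
        perm_tuple (Prm L n k) (map p ws')"
      unfolding rel_def by blast
    from e(2) have "TB n u (map q ws) = TB n' v (map q ws')" using h by (simp add: me)
    then obtain l where l: "l \<in> G n" "eqv n v (act n l u)" "map q ws =
        perm_tuple (Prm L n l) (map q ws')"
      using presentsD[OF B h(1) mt(2)[OF h(2)] h(4) mt(2)[OF h(5)]] unfolding rel_def by blast
    have kl: "Prm L n l = Prm L n k" using Prm_eqI[OF h(1) l(1) k(1)]
        eqv_trans[OF eqv_sym[OF l(2)] k(2)] .
    let ?ws = "perm_tuple (Prm L n k) ws'"
    have ws: "?ws \<in> tuples W n" using perm_tuple_tuples[OF k(1)] h(5) n by simp
    have len: "Prm L n k permutes {1..length ws'}" using Prm_permutes[OF k(1)] h(5) n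
        by (simp add: tuples_def)
    have pq: "map p ws = map p ?ws" "map q ws = map q ?ws"
      using k(3) l(3) by (simp_all add: kl map_perm_tuple[OF len])
    have "ws = ?ws"
    proof (rule nth_equalityI)
      fix i assume i: "i < length ws"
      show "ws ! i = ?ws ! i"
        by (rule set_pullback_unique[OF pb])
          (use i h(2) ws arg_cong[OF pq(1), of "\<lambda>l. l ! i"] arg_cong[OF pq(2), of "\<lambda>l. l ! i"] in
              \<open>auto simp: tuples_def\<close>)
    qed (use h(2) ws in \<open>simp add: tuples_def\<close>)
    thus "Z = Z'" using presentsD[OF W h(1,2) h(4,5)] k n h(3,6) by (auto simp: rel_def)
  qed
qed

text \<open>Every permutation in arity 1 is trivial, so a class over \<open>Unit\<close> determines
  its single entry. If \<open>F\<close> sends a class to a unit class, the group element involved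
  already relates the operation to \<open>Unit\<close> before \<open>F\<close> is applied.\<close>

lemma set_pullback_tens_unit:
  assumes X: "presents X TX" and Y: "presents Y TY" and F: "F \<in> X \<rightarrow> Y"
  shows "set_pullback X (tens Op X TX) Y (tens_unit Op TX) F (tens_map Op X TX TY F)
      (tens_unit Op TY)"
proof -
  note me = tens_map_eq[OF X Y F]
  have s1: "[x] \<in> tuples S 1" if "x \<in> S" for x :: 'z and S using that by (simp add: tuples_def)
  have P1: "Prm L 1 k = id" if "k \<in> G 1" for k
    using Prm_permutes[OF that] by (simp add: permutes_sing)
  show ?thesis
    unfolding set_pullback_def
  proof (intro conjI ballI impI)
    fix x assume x: "x \<in> X"
    show "tens_unit Op TX x \<in> tens Op X TX" using tens_unit_tens[OF x] .
    show "F x \<in> Y" using F x by blast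
    show "tens_map Op X TX TY F (tens_unit Op TX x) = tens_unit Op TY (F x)"
      using me[OF Unit_Ops s1[OF x]] by (simp add: tens_unit_def)
  next
    fix Z y assume Z: "Z \<in> tens Op X TX" and y: "y \<in> Y" and e: "tens_map Op X TX TY F Z =
        tens_unit Op TY y"
    then obtain n u xs where h: "u \<in> Ops Op n" "xs \<in> tuples X n" "Z = TX n u xs" unfolding tens_def
        by blast
    from e have "TY n u (map F xs) = TY 1 (Unit Op) [y]" using h by (simp add: me tens_unit_def)
    hence n: "n = 1" and "rel n u (map F xs) (Unit Op) [y]"
      using presentsD[OF Y h(1) map_tuples[OF h(2) F] Unit_Ops s1[OF y]] by auto
    then obtain k where k: "k \<in> G 1" "eqv 1 (Unit Op) (act 1 k u)" "map F xs =
        perm_tuple (Prm L 1 k) [y]"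
      unfolding rel_def by blast
    hence "map F xs = [y]" by (simp only: P1 perm_tuple_id)
    then obtain x where x: "xs = [x]" "F x = y" by auto
    have xX: "x \<in> X" using h(2) x by (simp add: tuples_def)
    have "perm_tuple (Prm L 1 k) [x] = [x]" using k(1) by (simp only: P1 perm_tuple_id)
    hence "rel 1 u [x] (Unit Op) [x]" using k unfolding rel_def by force
    hence "tens_unit Op TX x = Z"
      using presentsD[OF X h(1,2) Unit_Ops s1[OF xX]] n x h(3) by (simp add: tens_unit_def)
    thus "\<exists>x\<in>X. tens_unit Op TX x = Z \<and> F x = y" using xX x by blast
  next
    fix x x' assume x: "x \<in> X" "x' \<in> X" and "tens_unit Op TX x = tens_unit Op TX x'"
    hence "rel 1 (Unit Op) [x] (Unit Op) [x']"
      using presentsD[OF X Unit_Ops s1[OF x(1)] Unit_Ops s1[OF x(2)]] by (simp add: tens_unit_def)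
    then obtain k where "k \<in> G 1" "[x] = perm_tuple (Prm L 1 k) [x']" unfolding rel_def by blast
    hence "[x] = [x']" by (simp only: P1 perm_tuple_id)
    thus "x = x'" by simp
  qed
qed

lemma map_blocks:
  assumes X: "presents X TX" and Y: "presents Y TY" and F: "F \<in> X \<rightarrow> Y"
    and qs: "ops_tuple Op ks qs" and xss: "tuple_lists X ks xss"
  shows "map (tens_map Op X TX TY F) (blocks TX ks qs xss) = blocks TY ks qs (map (map F) xss)"
  using qs xss tens_map_eq[OF X Y F]
  by (intro nth_equalityI) (auto simp: length_blocks nth_blocks ops_tuple_def
      list_all2_conv_all_nth)

lemma map_tuples_list:
  assumes F: "F \<in> X \<rightarrow> Y" and xss: "tuple_lists X ks xss"
  shows "tuple_lists Y ks (map (map F) xss)"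
  using xss map_tuples[OF _ F] by (auto simp: list_all2_conv_all_nth)

lemma split_concat:
  assumes "map F xs = concat yss"
  obtains xss where "xs = concat xss" "map (map F) xss = yss"
  using assms
proof (induction yss arbitrary: xs thesis)
  case (Cons ys yss)
  from Cons.prems(2) obtain us vs where "xs = us @ vs" "map F us = ys" "map F vs = concat yss"
    by (auto simp: map_eq_append_conv)
  moreover obtain vss where "vs = concat vss" "map (map F) vss = yss" using Cons.IH calculation(3)
      by metis
  ultimately show ?case using Cons.prems(1)[of "us # vss"] by simp
qed simp

text \<open>For existence, rearrange the tuple over the given composite so that it lies over
  \<open>concat yss\<close>, and cut it into blocks there. For uniqueness, rewrite both elements
  with the same outer and inner operations; they can then differ only in their tuples, which is
  excluded by freeness at the composite operation.\<close>

lemma set_pullback_tens_mult: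
  assumes X: "presents X TX" and Y: "presents Y TY" and F: "F \<in> X \<rightarrow> Y"
    and TTX: "presents (tens Op X TX) TTX" and TTY: "presents (tens Op Y TY) TTY"
  shows "set_pullback (tens Op (tens Op X TX) TTX) (tens Op X TX) (tens Op (tens Op Y TY) TTY)
     (tens_mult Op X TX TTX) (tens_map Op (tens Op X TX) TTX TTY (tens_map Op X TX TY F))
     (tens_map Op X TX TY F) (tens_mult Op Y TY TTY)"
proof -
  let ?F = "tens_map Op X TX TY F"
  have FF: "?F \<in> tens Op X TX \<rightarrow> tens Op Y TY" by (rule tens_map_tens[OF X Y F])
  note me = tens_map_eq[OF X Y F] and mme = tens_map_eq[OF TTX TTY FF]
  note mx = tens_mult_eq[OF X TTX] and my = tens_mult_eq[OF Y TTY]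
  show ?thesis
    unfolding set_pullback_def
  proof (intro conjI ballI impI)
    fix Z assume Z: "Z \<in> tens Op (tens Op X TX) TTX"
    show "tens_mult Op X TX TTX Z \<in> tens Op X TX" using tens_mult_tens[OF X TTX] Z by blast
    show "tens_map Op (tens Op X TX) TTX TTY ?F Z \<in> tens Op (tens Op Y TY) TTY"
      using tens_map_tens[OF TTX TTY FF] Z by blast
    from Z obtain n p ts where h: "p \<in> Ops Op n" "ts \<in> tuples (tens Op X TX) n" "Z = TTX n p ts"
        unfolding tens_def by blast
    obtain ks qs xss where k: "length ks = n" "ops_tuple Op ks qs" "tuple_lists X ks xss"
      "ts = blocks TX ks qs xss" by (rule blocks_rep[OF h(2)])
    have p: "p \<in> Ops Op (length ks)" using h k by simp
    have "?F (tens_mult Op X TX TTX Z) =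
        TY (sum_list ks) (Mu Op ks p qs) (concat (map (map F) xss))"
      using mx[OF p k(2,3)] me[OF Mu_Ops[OF p k(2)] concat_tuples[OF k(3)]] h k
          by (simp add: map_concat)
    moreover have "tens_map Op (tens Op X TX) TTX TTY ?F Z =
        TTY n p (blocks TY ks qs (map (map F) xss))"
      using mme[OF h(1,2)] map_blocks[OF X Y F k(2,3)] h k by simp
    ultimately show "?F (tens_mult Op X TX TTX Z) =
        tens_mult Op Y TY TTY (tens_map Op (tens Op X TX) TTX TTY ?F Z)"
      using my[OF p k(2) map_tuples_list[OF F k(3)]] k(1) by simp
  next
    fix Z V assume "Z \<in> tens Op X TX" "V \<in> tens Op (tens Op Y TY) TTY" and e: "?F Z =
        tens_mult Op Y TY TTY V"
    then obtain n r xs m p ts where h: "r \<in> Ops Op n" "xs \<in> tuples X n" "Z = TX n r xs"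
      "p \<in> Ops Op m" "ts \<in> tuples (tens Op Y TY) m" "V = TTY m p ts" unfolding tens_def by blast
    obtain ks qs yss where k: "length ks = m" "ops_tuple Op ks qs" "tuple_lists Y ks yss"
      "ts = blocks TY ks qs yss" by (rule blocks_rep[OF h(5)])
    have p: "p \<in> Ops Op (length ks)" using h k by simp
    let ?m = "Mu Op ks p qs"
    from e have "TY n r (map F xs) = TY (sum_list ks) ?m (concat yss)"
      using h k me my[OF p k(2,3)] by simp
    hence n: "n = sum_list ks" and "rel n r (map F xs) ?m (concat yss)"
      using presentsD[OF Y h(1) map_tuples[OF h(2) F] Mu_Ops[OF p k(2)] concat_tuples[OF k(3)]]
          by auto
    then obtain g where g: "g \<in> G n" "eqv n ?m (act n g r)" "map F xs =
        perm_tuple (Prm L n g) (concat yss)"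
      unfolding rel_def by blast
    let ?s = "Prm L n g"
    have s: "?s permutes {1..length xs}" using Prm_permutes[OF g(1)] h(2) by (simp add: tuples_def)
    have lc: "length (concat yss) = length xs" using arg_cong[OF g(3), of length] by simp
    \<comment> \<open>Undoing the permutation of \<open>g\<close> puts the entries directly over
      \<open>concat yss\<close>; the operation \<open>r\<close> changes to \<open>?m\<close> at the
      same time.\<close>
    define zs where "zs = perm_tuple (inv' ?s) xs"
    have zs: "zs \<in> tuples X n"
      unfolding zs_def using perm_tuple_tuples[OF inv_G[OF g(1)] h(2)] Prm_inv[OF g(1)] by simp
    have xs: "xs = perm_tuple ?s zs" unfolding zs_def using perm_tuple_inv(1)[OF s] by simp
    have "map F zs = concat yss"
      unfolding zs_def using map_perm_tuple[OF permutes_inv[OF s], of F]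
          perm_tuple_inv(2)[of ?s "concat yss"] s lc g(3) by simp
    then obtain xss where xss: "zs = concat xss" "map (map F) xss = yss" by (rule split_concat)
    have xk: "tuple_lists X ks xss"
    proof -
      have l: "length xss = length ks" using list_all2_lengthD[OF k(3)] xss(2) by auto
      have "xss ! i \<in> tuples X (ks ! i)" if "i < length ks" for i
      proof -
        have "yss ! i \<in> tuples Y (ks ! i)" using list_all2_nthD[OF k(3) that] .
        hence "length (xss ! i) = ks ! i" using xss(2) l that by (auto simp: tuples_def)
        moreover have "set (xss ! i) \<subseteq> X"
          using nth_mem[of i xss] zs xss(1) that l by (fastforce simp: tuples_def)
        ultimately show ?thesis by (simp add: tuples_def)
      qed
      thus ?thesis using l by (simp add: list_all2_conv_all_nth)
    qed
    let ?w = "TTX m p (blocks TX ks qs xss)"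
    have b: "blocks TX ks qs xss \<in> tuples (tens Op X TX) m" using blocks_tuples[OF k(2) xk] k(1)
        by simp
    have "tens_map Op (tens Op X TX) TTX TTY ?F ?w = V"
      using mme[OF h(4) b] map_blocks[OF X Y F k(2) xk] xss(2) k h by simp
    moreover have "tens_mult Op X TX TTX ?w = Z"
    proof -
      have "tens_mult Op X TX TTX ?w = TX n ?m zs" using mx[OF p k(2) xk] k(1) n xss by simp
      moreover have "TX n r xs = TX n ?m zs"
        using presentsD[OF X h(1,2), of ?m n zs] Mu_Ops[OF p k(2)] zs n g xs unfolding rel_def
            by blast
      ultimately show ?thesis using h by simp
    qed
    moreover have "?w \<in> tens Op (tens Op X TX) TTX" using tens_I[where T = TTX, OF h(4) b] .
    ultimately show "\<exists>w\<in>tens Op (tens Op X TX) TTX. tens_mult Op X TX TTX w = Z \<and>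
        tens_map Op (tens Op X TX) TTX TTY ?F w = V" by blast
  next
    fix Z Z' assume Z: "Z \<in> tens Op (tens Op X TX) TTX" "Z' \<in> tens Op (tens Op X TX) TTX"
      and e1: "tens_mult Op X TX TTX Z = tens_mult Op X TX TTX Z'"
      and e2: "tens_map Op (tens Op X TX) TTX TTY ?F Z = tens_map Op (tens Op X TX) TTX TTY ?F Z'"
    then obtain n p ts n' p' ts' where h: "p \<in> Ops Op n" "ts \<in> tuples (tens Op X TX) n" "Z =
        TTX n p ts"
      "p' \<in> Ops Op n'" "ts' \<in> tuples (tens Op X TX) n'" "Z' = TTX n' p' ts'" unfolding tens_def
          by blast
    from e2 have "TTY n p (map ?F ts) = TTY n' p' (map ?F ts')" using h by (simp add: mme)
    hence n: "n' = n" and "rel n p (map ?F ts) p' (map ?F ts')"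
      using presentsD[OF TTY h(1) map_tuples[OF h(2) FF] h(4) map_tuples[OF h(5) FF]] by auto
    then obtain g where g: "g \<in> G n" "eqv n p' (act n g p)" "map ?F ts =
        perm_tuple (Prm L n g) (map ?F ts')"
      unfolding rel_def by blast
    define us where "us = perm_tuple (Prm L n g) ts'"
    have us: "us \<in> tuples (tens Op X TX) n" unfolding us_def using perm_tuple_tuples[OF g(1)] h(5) n
        by simp
    have Fus: "map ?F ts = map ?F us"
      unfolding us_def using map_perm_tuple[of "Prm L n g" ts' ?F] Prm_permutes[OF g(1)] h(5) n g(3)
          by (simp add: tuples_def)
    have Z'us: "Z' = TTX n p us"
      using presentsD[OF TTX h(1) us h(4,5)] g(1,2) us_def n h(6) by (auto simp: rel_def)
    obtain ks qs xss where k: "length ks = n" "ops_tuple Op ks qs" "tuple_lists X ks xss"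
      "ts = blocks TX ks qs xss" by (rule blocks_rep[OF h(2)])
    have ls: "length qs = n" "length xss = n" using k
        by (auto simp: ops_tuple_def dest: list_all2_lengthD)
    \<comment> \<open>Each entry of \<open>us\<close> has the same image as the corresponding entry
      of \<open>ts\<close>. The element relating the two operations is moved into the tuple, so both
      entries can use \<open>qs ! i\<close>.\<close>
    have "\<exists>zs\<in>tuples X (ks ! i). us ! i = TX (ks ! i) (qs ! i) zs \<and> map F zs = map F (xss ! i)"
        if i: "i < n" for i
    proof -
      have q: "qs ! i \<in> Ops Op (ks ! i)" "xss ! i \<in> tuples X (ks ! i)"
        using k i by (auto simp: ops_tuple_def list_all2_conv_all_nth)
      have ti: "ts ! i = TX (ks ! i) (qs ! i) (xss ! i)" using k ls i by (simp add: nth_blocks)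
      have "us ! i \<in> tens Op X TX" using us i by (auto simp: tuples_def)
      then obtain k' q' vs where v: "q' \<in> Ops Op k'" "vs \<in> tuples X k'" "us ! i = TX k' q' vs"
          unfolding tens_def by blast
      have "?F (ts ! i) = ?F (us ! i)"
        using arg_cong[OF Fus, of "\<lambda>l. l ! i"] h(2) us i by (simp add: tuples_def)
      hence "TY (ks ! i) (qs ! i) (map F (xss ! i)) = TY k' q' (map F vs)" using q v ti
          by (simp add: me)
      hence k': "k' = ks ! i" and "rel (ks ! i) (qs ! i) (map F (xss ! i)) q' (map F vs)"
        using presentsD[OF Y q(1) map_tuples[OF q(2) F] v(1) map_tuples[OF v(2) F]] by auto
      then obtain l where l: "l \<in> G k'" "eqv k' q' (act k' l (qs ! i))" "map F (xss ! i) =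
          perm_tuple (Prm L k' l) (map F vs)"
        unfolding rel_def by blast
      let ?zs = "perm_tuple (Prm L k' l) vs"
      have zs: "?zs \<in> tuples X k'" using perm_tuple_tuples[OF l(1) v(2)] .
      have "TX k' (qs ! i) ?zs = TX k' q' vs"
        using presentsD[OF X _ zs v(1,2), of "qs ! i"] q(1) k' l(1,2) by (auto simp: rel_def)
      moreover have "map F ?zs = map F (xss ! i)"
        using l(3) map_perm_tuple[of "Prm L k' l" vs F] Prm_permutes[OF l(1)] v(2)
            by (simp add: tuples_def)
      ultimately show ?thesis using zs v(3) k' by (intro bexI[of _ ?zs]) auto
    qed
    then obtain z where z: "\<And>i. i < n \<Longrightarrow> z i \<in> tuples X (ks ! i) \<and> us ! i =
        TX (ks ! i) (qs ! i) (z i) \<and> map F (z i) = map F (xss ! i)"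
      by metis
    define zss where "zss = map z [0..<n]"
    have zss: "tuple_lists X ks zss" using z k(1) by (simp add: zss_def list_all2_conv_all_nth)
    have uz: "us = blocks TX ks qs zss"
      by (rule nth_equalityI) (use z k(1) ls us in \<open>auto simp: zss_def length_blocks nth_blocks
          tuples_def\<close>)
    have p: "p \<in> Ops Op (length ks)" using h k by simp
    let ?m = "Mu Op ks p qs"
    have "TX (sum_list ks) ?m (concat xss) = TX (sum_list ks) ?m (concat zss)"
      using e1 h(3) Z'us mx[OF p k(2,3)] mx[OF p k(2) zss] k(1,4) uz by simp
    then obtain c where c: "c \<in> G (sum_list ks)" "eqv (sum_list ks) ?m (act (sum_list ks) c ?m)"
      "concat xss = perm_tuple (Prm L (sum_list ks) c) (concat zss)"
      using presentsD[OF X Mu_Ops[OF p k(2)] concat_tuples[OF k(3)] Mu_Ops[OF p k(2)]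
          concat_tuples[OF zss]]
      unfolding rel_def by blast
    \<comment> \<open>\<open>c\<close> carries \<open>?m\<close> to itself up to \<open>eqv\<close>,
      so freeness leaves no permutation. Since \<open>z i\<close> and \<open>xss ! i\<close> have
      the same image, their lengths agree, and equal concatenations then give equal blocks.\<close>
    have "Prm L (sum_list ks) c = id" using eqv_free[OF Mu_Ops[OF p k(2)] c(1) eqv_sym[OF c(2)]] .
    hence "concat xss = concat zss" using c(3) by simp
    moreover have "length (xss ! i) = length (z i)" if "i < n" for i
      using z[OF that] by (metis length_map)
    hence "\<forall>(x, y)\<in>set (zip xss zss). length x = length y"
      using ls by (auto simp: zss_def set_zip)
    ultimately have "xss = zss" using concat_injective[of xss zss] ls by (simp add: zss_def)
    thus "Z = Z'" using h(3) Z'us k(4) uz by simp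
  qed
qed

end

section \<open>Tensor products with operads in categories\<close>

lemma map2_replicate: "length xs = n \<Longrightarrow> map2 f (replicate n x) xs = map (f x) xs"
  by (auto intro: nth_equalityI)

lemma Obj_power: "Obj (power_cat X n) = tuples (Obj X) n" and Arr_power: "Arr (power_cat X n) =
    tuples (Arr X) n"
  by (auto simp: power_cat_def tuple_cat_def tuples_def list_all2_conv_all_nth in_set_conv_nth)
    (metis nth_mem subsetD)+

lemma Dom_power: "length xs = n \<Longrightarrow> Dom (power_cat X n) xs = map (Dom X) xs"
  and Cod_power: "length xs = n \<Longrightarrow> Cod (power_cat X n) xs = map (Cod X) xs"
  and Idt_power: "length ps = n \<Longrightarrow> Idt (power_cat X n) ps = map (Idt X) ps"
  by (simp_all add: power_cat_def tuple_cat_def map2_replicate)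

lemma Cmp_power: "length ys = n \<Longrightarrow> length xs = n \<Longrightarrow> Cmp (power_cat X n) ys xs = map2 (Cmp X) ys xs"
  by (simp add: power_cat_def tuple_cat_def map2_replicate)

lemma map2_Cmp_tuples:
  assumes X: "is_cat X" and xs: "xs \<in> tuples (Arr X) n" and ys: "ys \<in> tuples (Arr X) n"
    and e: "map (Dom X) ys = map (Cod X) xs"
  shows "map2 (Cmp X) ys xs \<in> tuples (Arr X) n" "map (Dom X) (map2 (Cmp X) ys xs) = map (Dom X) xs"
    "map (Cod X) (map2 (Cmp X) ys xs) = map (Cod X) ys"
proof -
  have l: "length xs = n" "length ys = n" using xs ys by (auto simp: tuples_def)
  have i: "xs ! i \<in> Arr X \<and> ys ! i \<in> Arr X \<and> Dom X (ys ! i) = Cod X (xs ! i)" if "i < n" for i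
    using xs ys that arg_cong[OF e, of "\<lambda>l. l ! i"] by (auto simp: tuples_def)
  show "map2 (Cmp X) ys xs \<in> tuples (Arr X) n"
    using l i cat_simps(6)[OF X] by (auto simp: tuples_def set_zip)
  show "map (Dom X) (map2 (Cmp X) ys xs) = map (Dom X) xs" "map (Cod X) (map2 (Cmp X) ys xs) =
      map (Cod X) ys"
    using l i cat_simps(7,8)[OF X] by (auto intro!: nth_equalityI)
qed

lemma tuples_Dom: "is_cat X \<Longrightarrow> xs \<in> tuples (Arr X) n \<Longrightarrow> map (Dom X) xs \<in> tuples (Obj X) n"
  and tuples_Cod: "is_cat X \<Longrightarrow> xs \<in> tuples (Arr X) n \<Longrightarrow> map (Cod X) xs \<in> tuples (Obj X) n"
  and tuples_Idt: "is_cat X \<Longrightarrow> ps \<in> tuples (Obj X) n \<Longrightarrow> map (Idt X) ps \<in> tuples (Arr X) n"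
  by (auto simp: tuples_def Dom_Obj Cod_Obj Idt_Arr)

lemma is_cat_power:
  assumes X: "is_cat X" shows "is_cat (power_cat X n)"
proof (rule is_catI, goal_cases)
  case (1 xs)
  hence xs: "xs \<in> tuples (Arr X) n" by (simp add: Arr_power)
  show ?case using tuples_Dom[OF X xs] tuples_Cod[OF X xs] length_tuples[OF xs]
      by (simp add: Obj_power Dom_power Cod_power)
next
  case (2 ps)
  hence ps: "ps \<in> tuples (Obj X) n" by (simp add: Obj_power)
  hence "map (Dom X \<circ> Idt X) ps = ps" "map (Cod X \<circ> Idt X) ps = ps"
    using cat_simps(4,5)[OF X] by (auto simp: tuples_def intro!: map_idI)
  thus ?case using tuples_Idt[OF X ps] length_tuples[OF ps]
      by (simp add: Arr_power Dom_power Cod_power Idt_power)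
next
  case (3 xs ys)
  hence t: "xs \<in> tuples (Arr X) n" "ys \<in> tuples (Arr X) n" by (simp_all add: Arr_power)
  have l: "length xs = n" "length ys = n" using t by (auto simp: tuples_def)
  hence "map (Dom X) ys = map (Cod X) xs" using 3(3) by (simp add: Dom_power Cod_power)
  thus ?case using map2_Cmp_tuples[OF X t] l by (simp add: Arr_power Dom_power Cod_power Cmp_power)
next
  case (4 xs)
  hence "length xs = n" "\<And>i. i < n \<Longrightarrow> xs ! i \<in> Arr X" by (auto simp: Arr_power tuples_def)
  thus ?case using cat_simps(9,10)[OF X]
    by (auto simp: Dom_power Cod_power Idt_power Cmp_power intro!: nth_equalityI)
next
  case (5 xs ys zs)
  hence l: "length xs = n" "length ys = n" "length zs = n"
    and i: "\<And>i. i < n \<Longrightarrow> xs ! i \<in> Arr X \<and> ys ! i \<in> Arr X \<and> zs ! i \<in> Arr X"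
        by (auto simp: Arr_power tuples_def)
  from 5(4,5) l have "map (Dom X) ys = map (Cod X) xs" "map (Dom X) zs = map (Cod X) ys"
    by (simp_all add: Dom_power Cod_power)
  hence "\<And>i. i < n \<Longrightarrow> Dom X (ys ! i) = Cod X (xs ! i) \<and> Dom X (zs ! i) = Cod X (ys ! i)"
    using l by (metis nth_map)
  thus ?case using l i cat_simps(11)[OF X] by (auto simp: Cmp_power intro!: nth_equalityI)
qed

lemma is_cat_prod:
  assumes "is_cat C" "is_cat D" shows "is_cat (prod_cat C D)"
  using cat_simps[OF assms(1)] cat_simps[OF assms(2)]
  by (intro is_catI) (auto simp: prod_cat_def)

locale lam_op = action_op L for L :: "'g action_operad" +
  fixes P :: "('g, 'o, 'a) lam_operad"
  assumes lam_operad: "is_lam_operad L P"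
begin

lemma cat_P: "is_cat (PCat P n)"
  using lam_operad by (simp add: is_lam_operad_def)

lemma functor_PMu: "is_functor (prod_cat (PCat P (length ks)) (tuple_cat (map (PCat P) ks)))
    (PCat P (sum_list ks)) (PMu P ks)"
  using lam_operad by (simp add: is_lam_operad_def)

lemma functor_PAct: "g \<in> G n \<Longrightarrow> is_functor (PCat P n) (PCat P n) (PAct P n g)"
  using lam_operad by (simp add: is_lam_operad_def)

lemma Ops_obj [simp]: "Ops (obj_operad P) n = Obj (PCat P n)" and Ops_arr
    [simp]: "Ops (arr_operad P) n = Arr (PCat P n)"
  by (simp_all add: obj_operad_def arr_operad_def)

sublocale ob: equivariant_operad L "obj_operad P" "\<lambda>n g. FObj (PAct P n g)"
  by unfold_locales (use lam_operad in \<open>simp add: is_lam_operad_def\<close>)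

sublocale ar: equivariant_operad L "arr_operad P" "\<lambda>n g. FArr (PAct P n g)"
  by unfold_locales (use lam_operad in \<open>simp add: is_lam_operad_def\<close>)

sublocale obc: operad_congruence L "obj_operad P" "\<lambda>n g. FObj (PAct P n g)" ob.kernel_orbit
  by (rule ob.operad_congruence_kernel_orbit)

abbreviation aO where "aO n g \<equiv> FObj (PAct P n g)"
abbreviation aA where "aA n g \<equiv> FArr (PAct P n g)"
abbreviation MO where "MO \<equiv> Mu (obj_operad P)"
abbreviation MA where "MA \<equiv> Mu (arr_operad P)"

lemma Arr_tuple: "us \<in> Arr (tuple_cat (map (PCat P) ks)) \<longleftrightarrow> ops_tuple (arr_operad P) ks us"
  and Obj_tuple: "ps \<in> Obj (tuple_cat (map (PCat P) ks)) \<longleftrightarrow> ops_tuple (obj_operad P) ks ps"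
  by (simp_all add: tuple_cat_def ops_tuple_def list_all2_map1)

lemma map2_map1: "map2 f (map g ks) us = map2 (\<lambda>k. f (g k)) ks us"
  by (rule nth_equalityI) simp_all

lemma Dom_MA:
  assumes "u \<in> Arr (PCat P (length ks))" "ops_tuple (arr_operad P) ks us"
  shows "Dom (PCat P (sum_list ks)) (MA ks u us) =
      MO ks (Dom (PCat P (length ks)) u) (map2 (\<lambda>k. Dom (PCat P k)) ks us)"
  using FArr_Dom[OF functor_PMu, of "(u, us)" ks] assms Arr_tuple[of us ks]
  by (simp add: prod_cat_def tuple_cat_def arr_operad_def obj_operad_def map2_map1)

lemma Cod_MA:
  assumes "u \<in> Arr (PCat P (length ks))" "ops_tuple (arr_operad P) ks us"
  shows "Cod (PCat P (sum_list ks)) (MA ks u us) =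
      MO ks (Cod (PCat P (length ks)) u) (map2 (\<lambda>k. Cod (PCat P k)) ks us)"
  using FArr_Cod[OF functor_PMu, of "(u, us)" ks] assms Arr_tuple[of us ks]
  by (simp add: prod_cat_def tuple_cat_def arr_operad_def obj_operad_def map2_map1)

lemma Idt_MA:
  assumes "p \<in> Obj (PCat P (length ks))" "ops_tuple (obj_operad P) ks ps"
  shows "MA ks (Idt (PCat P (length ks)) p) (map2 (\<lambda>k. Idt (PCat P k)) ks ps) =
      Idt (PCat P (sum_list ks)) (MO ks p ps)"
  using FArr_Idt[OF functor_PMu, of "(p, ps)" ks] assms Obj_tuple[of ps ks]
  by (simp add: prod_cat_def tuple_cat_def arr_operad_def obj_operad_def map2_map1)

text \<open>The interchange law, which is functoriality of \<open>PMu\<close> on composites. The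
  composite tuple is given entrywise so that both an unchanged list and a list updated in one slot
  can be supplied.\<close>

lemma Cmp_MA:
  assumes u: "u \<in> Arr (PCat P (length ks))" and us: "ops_tuple (arr_operad P) ks us"
    and v: "v \<in> Arr (PCat P (length ks))" and vs: "ops_tuple (arr_operad P) ks vs"
    and e: "Dom (PCat P (length ks)) v = Cod (PCat P (length ks)) u"
    and es: "\<And>i. i < length ks \<Longrightarrow> Dom (PCat P (ks ! i)) (vs ! i) = Cod (PCat P (ks ! i)) (us ! i)"
    and ws: "length ws = length ks" "\<And>i. i < length ks \<Longrightarrow> ws ! i =
        Cmp (PCat P (ks ! i)) (vs ! i) (us ! i)"
  shows "MA ks (Cmp (PCat P (length ks)) v u) ws =
      Cmp (PCat P (sum_list ks)) (MA ks v vs) (MA ks u us)"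
proof -
  have l: "length us = length ks" "length vs = length ks" using us vs
      by (auto simp: ops_tuple_def dest: list_all2_lengthD)
  have d: "map2 (\<lambda>k. Dom (PCat P k)) ks vs = map2 (\<lambda>k. Cod (PCat P k)) ks us"
    using l es by (auto intro: nth_equalityI)
  have w: "ws = map2 (\<lambda>C (g, f). Cmp C g f) (map (PCat P) ks) (zip vs us)"
    using l ws by (auto intro: nth_equalityI)
  show ?thesis
    using FArr_Cmp[OF functor_PMu, of "(u, us)" ks "(v, vs)"] u v us vs e d Arr_tuple[of us ks]
        Arr_tuple[of vs ks]
    by (simp add: prod_cat_def tuple_cat_def arr_operad_def map2_map1 w)
qed

lemma ops_tuple_nth: "ops_tuple O' ks qs \<Longrightarrow> i < length ks \<Longrightarrow> qs ! i \<in> Ops O' (ks ! i)"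
  and ops_tuple_length: "ops_tuple O' ks qs \<Longrightarrow> length qs = length ks"
  by (auto simp: ops_tuple_def list_all2_conv_all_nth)

lemma ops_tupleI: "length qs = length ks \<Longrightarrow> (\<And>i. i < length ks \<Longrightarrow> qs ! i \<in> Ops O' (ks ! i)) \<Longrightarrow>
    ops_tuple O' ks qs"
  by (auto simp: ops_tuple_def list_all2_conv_all_nth)

text \<open>
  As a congruence, this may identify more than the orbits of \<open>ker \<pi>\<^sub>n\<close>: it relates \<open>v \<circ> u\<close> to
  \<open>(v \<cdot> h) \<circ> u\<close> if \<open>h\<close> fixes the domain of \<open>v\<close>.
\<close>

inductive arr_cong :: "nat \<Rightarrow> 'a \<Rightarrow> 'a \<Rightarrow> bool" where
  act: "u \<in> Arr (PCat P n) \<Longrightarrow> h \<in> G n \<Longrightarrow> Prm L n h = id \<Longrightarrow> arr_cong n (aA n h u) u"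
| refl: "u \<in> Arr (PCat P n) \<Longrightarrow> arr_cong n u u"
| sym: "arr_cong n u v \<Longrightarrow> arr_cong n v u"
| trans: "arr_cong n u v \<Longrightarrow> arr_cong n v w \<Longrightarrow> arr_cong n u w"
| Cmp: "arr_cong n u u' \<Longrightarrow> arr_cong n v v' \<Longrightarrow> Dom (PCat P n) v = Cod (PCat P n) u \<Longrightarrow>
    Dom (PCat P n) v' = Cod (PCat P n) u' \<Longrightarrow> arr_cong n (Cmp (PCat P n) v u) (Cmp (PCat P n) v' u')"

text \<open>The control of endpoints is what carries freeness from objects to arrows: an arrow fixed
  up to \<open>arr_cong\<close> has a domain fixed up to the kernel.\<close>

lemma arr_cong_Arr:
  "arr_cong n u v \<Longrightarrow> u \<in> Arr (PCat P n) \<and> v \<in> Arr (PCat P n) \<and>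
    ob.kernel_orbit n (Dom (PCat P n) u) (Dom (PCat P n) v) \<and> ob.kernel_orbit n (Cod (PCat P n) u)
        (Cod (PCat P n) v)"
proof (induction rule: arr_cong.induct)
  case (act u n h)
  thus ?case using functor_simps[OF functor_PAct[OF act(2)]] cat_simps[OF cat_P]
      by (auto intro: obc.eqv_ker)
next
  case (refl u n)
  thus ?case using cat_simps[OF cat_P] by (auto intro: obc.eqv_refl)
next
  case (sym n u v)
  thus ?case by (auto intro: obc.eqv_sym)
next
  case (trans n u v w)
  thus ?case by (auto intro: obc.eqv_trans)
next
  case (Cmp n u u' v v')
  thus ?case using cat_simps[OF cat_P] by auto
qed

text \<open>Each group element acts by a functor, which settles composites; a kernel generator goes
  to its conjugate, again in the kernel.\<close>

lemma arr_cong_act: "arr_cong n u v \<Longrightarrow> g \<in> G n \<Longrightarrow> arr_cong n (aA n g u) (aA n g v)"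
proof (induction rule: arr_cong.induct)
  case (act u n h)
  have "arr_cong n (aA n (inv\<^bsub>Grp L n\<^esub> g \<otimes>\<^bsub>Grp L n\<^esub> (h \<otimes>\<^bsub>Grp L n\<^esub> g)) (aA n g u)) (aA n g u)"
    using act by (intro arr_cong.act ar.Prm_conj FArr_Arr[OF functor_PAct]) simp_all
  thus ?case using ar.act_conj[of u n g h] act by simp
next
  case (refl u n)
  thus ?case using FArr_Arr[OF functor_PAct] by (auto intro: arr_cong.refl)
next
  case (Cmp n u u' v v')
  note f = functor_simps[OF functor_PAct[OF Cmp(7)]]
  show ?case using Cmp f arr_cong_Arr[OF Cmp.hyps(1)] arr_cong_Arr[OF Cmp.hyps(2)]
    by (auto intro!: arr_cong.Cmp)
qed (auto intro: arr_cong.sym arr_cong.trans)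

lemma Idt_tuple:
  "ops_tuple (obj_operad P) ks ps \<Longrightarrow> ops_tuple (arr_operad P) ks (map2 (\<lambda>k. Idt (PCat P k)) ks ps)"
  using Idt_Arr[OF cat_P] by (auto simp: ops_tuple_def list_all2_conv_all_nth)

lemma Dom_tuple:
  "ops_tuple (arr_operad P) ks us \<Longrightarrow> ops_tuple (obj_operad P) ks (map2 (\<lambda>k. Dom (PCat P k)) ks us)"
  using Dom_Obj[OF cat_P] by (auto simp: ops_tuple_def list_all2_conv_all_nth)

text \<open>For a composite outer arrow, interchange puts \<open>us\<close> into the later factor
  and identities on the domains of \<open>us\<close> into the earlier one. The induction leaves
  \<open>us\<close> arbitrary because the earlier factor has those identities as its inputs.\<close>

lemma arr_cong_MA_left:
  assumes "arr_cong n u v" "n = length ks" "ops_tuple (arr_operad P) ks us"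
  shows "arr_cong (sum_list ks) (MA ks u us) (MA ks v us)"
  using assms
proof (induction arbitrary: us rule: arr_cong.induct)
  case (act u n h)
  obtain k where "k \<in> G (sum_list ks)" "Prm L (sum_list ks) k = id" "MA ks (aA (length ks) h u) us =
      aA (sum_list ks) k (MA ks u us)"
    by (rule ar.Mu_ker_left[of u ks us h]) (use act in auto)
  thus ?case using arr_cong.act[of "MA ks u us"] ar.Mu_Ops[of u ks us] act by simp
next
  case (refl u n)
  thus ?case using ar.Mu_Ops[of u ks us] by (auto intro: arr_cong.refl)
next
  case (Cmp n u u' v v')
  let ?ds = "map2 (\<lambda>k. Dom (PCat P k)) ks us"
  let ?is = "map2 (\<lambda>k. Idt (PCat P k)) ks ?ds"
  note i = Idt_tuple[OF Dom_tuple[OF Cmp(8)]]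
  note l = ops_tuple_length[OF Cmp(8)]
  have *: "MA ks (Cmp (PCat P n) y x) us = Cmp (PCat P (sum_list ks)) (MA ks y us) (MA ks x ?is)
      \<and> Dom (PCat P (sum_list ks)) (MA ks y us) = Cod (PCat P (sum_list ks)) (MA ks x ?is)"
    if "x \<in> Arr (PCat P n)" "y \<in> Arr (PCat P n)" "Dom (PCat P n) y = Cod (PCat P n) x" for x y
  proof
    show "MA ks (Cmp (PCat P n) y x) us = Cmp (PCat P (sum_list ks)) (MA ks y us) (MA ks x ?is)"
      unfolding Cmp(7)
      by (rule Cmp_MA) (use that Cmp(7,8) i l ops_tuple_nth[OF Cmp(8)] cat_simps[OF cat_P] in
          simp_all)
    have "map2 (\<lambda>k. Cod (PCat P k)) ks ?is = ?ds"
      by (rule nth_equalityI) (use l ops_tuple_nth[OF Cmp(8)] cat_simps[OF cat_P] in simp_all)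
    thus "Dom (PCat P (sum_list ks)) (MA ks y us) = Cod (PCat P (sum_list ks)) (MA ks x ?is)"
      using that Cmp(7,8) i by (simp add: Dom_MA Cod_MA)
  qed
  show ?case
    using *[of u v] *[of u' v'] Cmp.IH(1)[OF Cmp(7) i] Cmp.IH(2)[OF Cmp(7,8)] Cmp.hyps(3,4)
      arr_cong_Arr[OF Cmp.hyps(1)] arr_cong_Arr[OF Cmp.hyps(2)] by (auto intro: arr_cong.Cmp)
qed (auto intro: arr_cong.sym arr_cong.trans)

lemma ops_tuple_update: "ops_tuple O' ks us \<Longrightarrow> x \<in> Ops O' (ks ! i) \<Longrightarrow> ops_tuple O' ks (us[i := x])"
  by (cases "i < length us") (auto simp: ops_tuple_def list_all2_conv_all_nth nth_list_update)

text \<open>One slot is treated at a time because the derivations of \<open>arr_cong\<close> in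
  different slots may have different shapes. For a composite in slot \<open>i\<close>, interchange
  puts the later arrow under \<open>w\<close> and the earlier one under identities.\<close>

lemma arr_cong_MA_slot:
  assumes "arr_cong m u v" "m = ks ! i" "i < length ks" "w \<in> Arr (PCat P (length ks))"
      "ops_tuple (arr_operad P) ks us"
  shows "arr_cong (sum_list ks) (MA ks w (us[i := u])) (MA ks w (us[i := v]))"
  using assms
proof (induction arbitrary: w us rule: arr_cong.induct)
  case (act u m h)
  have t: "ops_tuple (arr_operad P) ks (us[i := u])" using ops_tuple_update[OF act(7)] act by simp
  \<comment> \<open>The family of kernel elements is \<open>h\<close> in slot \<open>i\<close> and
    the unit elsewhere.\<close>
  obtain k where "k \<in> G (sum_list ks)" "Prm L (sum_list ks) k = id"
    "MA ks w (us[i := aA m h u]) = aA (sum_list ks) k (MA ks w (us[i := u]))"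
    by (rule ar.Mu_ker_right[of w ks "us[i := u]" "us[i := aA m h u]" "\<lambda>j. if j =
        i then h else \<one>\<^bsub>Grp L (ks ! j)\<^esub>"])
      (use act t ops_tuple_length[OF act(7)] ops_tuple_nth[OF act(7)] ar.act_one in \<open>auto
          simp: nth_list_update\<close>)
  thus ?case using arr_cong.act[of "MA ks w (us[i := u])"] ar.Mu_Ops[of w ks "us[i := u]"] act t
      by simp
next
  case (refl u m)
  thus ?case using ar.Mu_Ops[of w ks "us[i := u]"] ops_tuple_update[OF refl(5)]
      by (auto intro: arr_cong.refl)
next
  case (Cmp m u u' v v')
  let ?ds = "map2 (\<lambda>k. Dom (PCat P k)) ks us"
  let ?is = "map2 (\<lambda>k. Idt (PCat P k)) ks ?ds"
  let ?I = "Idt (PCat P (length ks)) (Dom (PCat P (length ks)) w)"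
  note it = Idt_tuple[OF Dom_tuple[OF Cmp(10)]]
  note l = ops_tuple_length[OF Cmp(10)]
  have I: "?I \<in> Arr (PCat P (length ks))" "Cod (PCat P (length ks)) ?I = Dom (PCat P (length ks)) w"
    "Cmp (PCat P (length ks)) w ?I = w"
    using Cmp(9) cat_simps[OF cat_P] by auto
  have *: "MA ks w (us[i := Cmp (PCat P m) y x]) =
      Cmp (PCat P (sum_list ks)) (MA ks w (us[i := y])) (MA ks ?I (?is[i := x]))
      \<and> Dom (PCat P (sum_list ks)) (MA ks w (us[i := y])) = Cod (PCat P (sum_list ks))
          (MA ks ?I (?is[i := x]))"
    if x: "x \<in> Arr (PCat P m)" and y: "y \<in> Arr (PCat P m)" and e: "Dom (PCat P m) y =
        Cod (PCat P m) x" for x y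
  proof
    have t: "ops_tuple (arr_operad P) ks (us[i := y])" "ops_tuple (arr_operad P) ks (?is[i := x])"
      using ops_tuple_update[OF Cmp(10)] ops_tuple_update[OF it] x y Cmp(7) by simp_all
    have "MA ks (Cmp (PCat P (length ks)) w ?I) (us[i := Cmp (PCat P m) y x]) =
       Cmp (PCat P (sum_list ks)) (MA ks w (us[i := y])) (MA ks ?I (?is[i := x]))"
      by (rule Cmp_MA) (use x y e I t l Cmp(7,8,9) ops_tuple_nth[OF Cmp(10)] cat_simps[OF cat_P] in
          \<open>auto simp: nth_list_update\<close>)
    thus "MA ks w (us[i := Cmp (PCat P m) y x]) =
        Cmp (PCat P (sum_list ks)) (MA ks w (us[i := y])) (MA ks ?I (?is[i := x]))"
      using I(3) by simp
    have "map2 (\<lambda>k. Cod (PCat P k)) ks (?is[i := x]) = map2 (\<lambda>k. Dom (PCat P k)) ks (us[i := y])"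
      by (rule nth_equalityI)
        (use x y e l Cmp(7,8) ops_tuple_nth[OF Cmp(10)] cat_simps[OF cat_P] in \<open>auto
            simp: nth_list_update\<close>)
    thus "Dom (PCat P (sum_list ks)) (MA ks w (us[i := y])) =
        Cod (PCat P (sum_list ks)) (MA ks ?I (?is[i := x]))"
      using I Cmp(9) t by (simp add: Dom_MA Cod_MA)
  qed
  show ?case
    using *[of u v] *[of u' v'] Cmp.IH(1)[OF Cmp(7,8) I(1) it] Cmp.IH(2)[OF Cmp(7,8,9,10)]
        Cmp.hyps(3,4)
      arr_cong_Arr[OF Cmp.hyps(1)] arr_cong_Arr[OF Cmp.hyps(2)] by (auto intro: arr_cong.Cmp)
next
  case (trans m u v u')
  show ?case by (rule arr_cong.trans[OF trans.IH(1)[OF trans.prems] trans.IH(2)[OF trans.prems]])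
qed (auto intro: arr_cong.sym)

text \<open>After changing the outer arrow, pass through the hybrid lists
  \<open>take m us' @ drop m us\<close>; consecutive ones differ in a single slot.\<close>

lemma arr_cong_MA:
  assumes u: "arr_cong (length ks) u u'" and us: "ops_tuple (arr_operad P) ks us"
      and us': "ops_tuple (arr_operad P) ks us'"
    and c: "\<And>i. i < length ks \<Longrightarrow> arr_cong (ks ! i) (us ! i) (us' ! i)"
  shows "arr_cong (sum_list ks) (MA ks u us) (MA ks u' us')"
proof -
  note l = ops_tuple_length[OF us] ops_tuple_length[OF us']
  have u'A: "u' \<in> Arr (PCat P (length ks))" using arr_cong_Arr[OF u] by simp
  have "m \<le> length ks \<Longrightarrow> arr_cong (sum_list ks) (MA ks u' us) (MA ks u' (take m us' @ drop m us))"
      for m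
  proof (induction m)
    case 0
    show ?case using ar.Mu_Ops[of u' ks us] us u'A by (auto intro: arr_cong.refl)
  next
    case (Suc m)
    let ?ms = "take m us' @ drop m us"
    have m: "m < length ks" using Suc by simp
    have t: "ops_tuple (arr_operad P) ks ?ms"
      by (rule ops_tupleI) (use l m ops_tuple_nth[OF us] ops_tuple_nth[OF us'] in \<open>auto
          simp: nth_append\<close>)
    have "?ms[m := us ! m] = ?ms" "?ms[m := us' ! m] = take (Suc m) us' @ drop (Suc m) us"
      using m l by (auto intro!: nth_equalityI simp: nth_append nth_list_update)
    thus ?case using Suc m arr_cong_MA_slot[OF c[OF m] _ m u'A t] by (auto intro: arr_cong.trans)
  qed
  from this[of "length ks"] have "arr_cong (sum_list ks) (MA ks u' us) (MA ks u' us')" using l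
      by simp
  thus ?thesis using arr_cong_MA_left[OF u _ us] arr_cong.trans by blast
qed

sublocale arc: operad_congruence L "arr_operad P" "\<lambda>n g. FArr (PAct P n g)" arr_cong
proof
  fix n p q r
  show "arr_cong n p q \<Longrightarrow> p \<in> Ops (arr_operad P) n \<and> q \<in> Ops (arr_operad P) n" using arr_cong_Arr
      by simp
  show "p \<in> Ops (arr_operad P) n \<Longrightarrow> arr_cong n p p" by (auto intro: arr_cong.refl)
  show "arr_cong n p q \<Longrightarrow> arr_cong n q p" by (rule arr_cong.sym)
  show "arr_cong n p q \<Longrightarrow> arr_cong n q r \<Longrightarrow> arr_cong n p r" by (rule arr_cong.trans)
  fix g
  show "arr_cong n p q \<Longrightarrow> g \<in> G n \<Longrightarrow> arr_cong n (aA n g p) (aA n g q)" by (rule arr_cong_act)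
  show "p \<in> Ops (arr_operad P) n \<Longrightarrow> g \<in> G n \<Longrightarrow> Prm L n g = id \<Longrightarrow> arr_cong n (aA n g p) p"
    by (auto intro: arr_cong.act)
qed (rule arr_cong_MA)

end

section \<open>The coequalizer relation on objects\<close>

context lam_op
begin

abbreviation src where "src \<equiv> tensor_src L P"
abbreviation tgt where "tgt \<equiv> tensor_tgt P"

lemma Obj_tgt: "Obj (tgt X n) = Obj (PCat P n) \<times> tuples (Obj X) n"
  and Arr_tgt: "Arr (tgt X n) = Arr (PCat P n) \<times> tuples (Arr X) n"
  by (simp_all add: tensor_tgt_def prod_cat_def Obj_power Arr_power)

lemma Obj_src: "Obj (src X n) = Obj (PCat P n) \<times> G n \<times> tuples (Obj X) n"
  and Arr_src: "Arr (src X n) = Arr (PCat P n) \<times> G n \<times> tuples (Arr X) n"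
  by (simp_all add: tensor_src_def prod_cat_def discrete_def Obj_power Arr_power)

lemma Dom_tgt: "length xs = n \<Longrightarrow> Dom (tgt X n) (u, xs) = (Dom (PCat P n) u, map (Dom X) xs)"
  and Cod_tgt: "length xs = n \<Longrightarrow> Cod (tgt X n) (u, xs) = (Cod (PCat P n) u, map (Cod X) xs)"
  by (simp_all add: tensor_tgt_def prod_cat_def Dom_power Cod_power)

lemma Idt_tgt: "length xs = n \<Longrightarrow> Idt (tgt X n) (p, xs) = (Idt (PCat P n) p, map (Idt X) xs)"
  by (simp add: tensor_tgt_def prod_cat_def Idt_power)

lemma Cmp_tgt: "length ys = n \<Longrightarrow> length xs = n \<Longrightarrow>
    Cmp (tgt X n) (v, ys) (u, xs) = (Cmp (PCat P n) v u, map2 (Cmp X) ys xs)"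
  by (simp add: tensor_tgt_def prod_cat_def Cmp_power)

lemma perm_Prm: "g \<in> G n \<Longrightarrow> length xs = n \<Longrightarrow> map f (perm_tuple (Prm L n g) xs) =
    perm_tuple (Prm L n g) (map f xs)"
  using map_perm_tuple[of "Prm L n g" xs f] Prm_permutes[of g n] by simp

lemma perm_Prm_map2: "g \<in> G n \<Longrightarrow> length xs = n \<Longrightarrow> length ys = n \<Longrightarrow>
    map2 f (perm_tuple (Prm L n g) xs) (perm_tuple (Prm L n g) ys) = perm_tuple (Prm L n g)
        (map2 f xs ys)"
  using Prm_permutes[of g n] by (simp add: zip_perm_tuple map_perm_tuple)

lemma functor_pair_tensor:
  assumes X: "is_cat X"
  shows "functor_pair (src X n) (tgt X n) (act_left P n) (act_right L n)"
proof
  have pw: "is_cat (power_cat X n)" by (rule is_cat_power[OF X])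
  show "is_cat (src X n)" and "is_cat (tgt X n)"
    unfolding tensor_src_def tensor_tgt_def by (intro is_cat_prod cat_P is_cat_discrete pw)+
  have srcD: "Dom (src X n) (u, g, xs) = (Dom (PCat P n) u, g, map (Dom X) xs)"
    "Cod (src X n) (u, g, xs) = (Cod (PCat P n) u, g, map (Cod X) xs)" if "length xs = n" for u g xs
    using that by (simp_all add: tensor_src_def prod_cat_def discrete_def Dom_power Cod_power)
  have srcI: "Idt (src X n) (p, g, xs) = (Idt (PCat P n) p, g, map (Idt X) xs)" if "length xs = n"
      for p g xs
    using that by (simp add: tensor_src_def prod_cat_def discrete_def Idt_power)
  have srcC: "Cmp (src X n) (v, h, ys) (u, g, xs) = (Cmp (PCat P n) v u, g, map2 (Cmp X) ys xs)"
    if "length xs = n" "length ys = n" for v h ys u g xs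
    using that by (simp add: tensor_src_def prod_cat_def discrete_def Cmp_power)
  show "is_functor (src X n) (tgt X n) (act_left P n)"
    using functor_simps[OF functor_PAct]
    by (intro is_functorI)
      (auto simp: Obj_src Arr_src Obj_tgt Arr_tgt act_left_def srcD srcI srcC length_tuples Dom_tgt
          Cod_tgt Idt_tgt Cmp_tgt
        simp del: length_map)
  show "is_functor (src X n) (tgt X n) (act_right L n)"
    by (intro is_functorI)
      (auto simp: Obj_src Arr_src Obj_tgt Arr_tgt act_right_def srcD srcI srcC length_tuples Dom_tgt
          Cod_tgt Idt_tgt Cmp_tgt
         perm_Prm perm_Prm_map2 obc.perm_tuple_tuples)
qed

abbreviation tobj where
  "tobj X n \<equiv> coeq_obj (src X n) (tgt X n) (act_left P n) (act_right L n)"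
abbreviation tarr where
  "tarr X n \<equiv> coeq_arr (src X n) (tgt X n) (act_left P n) (act_right L n)"

lemma tobj_act: "p \<in> Obj (PCat P n) \<Longrightarrow> xs \<in> tuples (Obj X) n \<Longrightarrow> g \<in> G n \<Longrightarrow>
    tobj X n (p, perm_tuple (Prm L n g) xs) (aO n g p, xs)"
  using coeq_obj.sym[OF coeq_obj.base[of "(p, g, xs)" "src X n" "tgt X n" "act_left P n"
      "act_right L n"]]
  by (simp add: Obj_src act_left_def act_right_def)

lemma tarr_act: "u \<in> Arr (PCat P n) \<Longrightarrow> xs \<in> tuples (Arr X) n \<Longrightarrow> g \<in> G n \<Longrightarrow>
    tarr X n [(u, perm_tuple (Prm L n g) xs)] [(aA n g u, xs)]"
  using coeq_arr.sym[OF coeq_arr.base[of "(u, g, xs)" "src X n" "tgt X n" "act_left P n"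
      "act_right L n"]]
  by (simp add: Arr_src act_left_def act_right_def)

text \<open>On objects one generator always suffices: symmetry and transitivity are absorbed by
  inverses and products of group elements.\<close>

lemma tobj_imp:
  assumes X: "is_cat X" and r: "tobj X n x y"
  shows "fst x \<in> Obj (PCat P n) \<and> snd y \<in> tuples (Obj X) n \<and>
    (\<exists>g\<in>G n. fst y = aO n g (fst x) \<and> snd x = perm_tuple (Prm L n g) (snd y))"
proof -
  interpret functor_pair "src X n" "tgt X n" "act_left P n" "act_right L n"
    by (rule functor_pair_tensor[OF X])
  have mem: "\<And>x y. tobj X n x y \<Longrightarrow> x \<in> Obj (PCat P n) \<times> tuples (Obj X) n \<and>
      y \<in> Obj (PCat P n) \<times> tuples (Obj X) n"
    using obj_rel_Obj by (simp add: Obj_tgt)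
  from r show ?thesis
  proof (induction rule: coeq_obj.induct)
    case (base c)
    then obtain p g xs where c: "c = (p, g, xs)" "p \<in> Obj (PCat P n)" "g \<in> G n"
        "xs \<in> tuples (Obj X) n" by (auto simp: Obj_src)
    have "xs = perm_tuple (Prm L n (inv\<^bsub>Grp L n\<^esub> g)) (perm_tuple (Prm L n g) xs)"
      using perm_tuple_inv(2)[of "Prm L n g" xs] Prm_permutes c by (simp add: Prm_inv length_tuples)
    thus ?case using c ob.act_inv[of p n g] ob.act_Ops[of p n g] obc.perm_tuple_tuples[of g n xs]
      by (auto simp: act_left_def act_right_def intro!: bexI[of _ "inv\<^bsub>Grp L n\<^esub> g"])
  next
    case (refl x)
    thus ?case using ob.act_one[of "fst x" n]
      by (auto simp: Obj_tgt perm_tuple_id[unfolded id_def] intro!: bexI[of _ "\<one>\<^bsub>Grp L n\<^esub>"])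
  next
    case (sym x y)
    then obtain g where g: "g \<in> G n" "fst y = aO n g (fst x)" "snd x =
        perm_tuple (Prm L n g) (snd y)" by blast
    have "snd y = perm_tuple (Prm L n (inv\<^bsub>Grp L n\<^esub> g)) (snd x)"
      unfolding g(3) using perm_tuple_inv(2)[of "Prm L n g" "snd y"] Prm_permutes[OF g(1)]
          mem[OF sym(1)]
      by (auto simp: Prm_inv[OF g(1)] length_tuples)
    thus ?case using g mem[OF sym(1)] ob.act_inv[of "fst x" n g]
      by (auto intro!: bexI[of _ "inv\<^bsub>Grp L n\<^esub> g"])
  next
    case (trans x y z)
    then obtain g h where g: "g \<in> G n" "fst y = aO n g (fst x)" "snd x =
        perm_tuple (Prm L n g) (snd y)"
      and h: "h \<in> G n" "fst z = aO n h (fst y)" "snd y = perm_tuple (Prm L n h) (snd z)" by blast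
    have "snd x = perm_tuple (Prm L n (g \<otimes>\<^bsub>Grp L n\<^esub> h)) (snd z)"
      unfolding g(3) h(3) Prm_mult[OF g(1) h(1)]
      by (rule perm_tuple_comp[symmetric])
        (use Prm_permutes[OF g(1)] Prm_permutes[OF h(1)] mem[OF trans(2)] in \<open>auto
            simp: length_tuples\<close>)
    moreover have "fst z = aO n (g \<otimes>\<^bsub>Grp L n\<^esub> h) (fst x)"
      using g h mem[OF trans(1)] ob.act_mult[of "fst x" n g h] by auto
    ultimately show ?case using mem[OF trans(1)] mem[OF trans(2)] mult_G[OF g(1) h(1)] by auto
  qed
qed

text \<open>Object classes are plain orbits, whereas \<open>rel\<close> also allows a kernel
  element. That element can be multiplied into \<open>g\<close>, as it does not change the
  permutation. Being available in \<open>lam_op\<close>, this description serves both directions of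
  the equivalence.\<close>

lemma presents_T_obj:
  assumes X: "is_cat X" shows "obc.presents (Obj X) (T_obj L P X)"
  unfolding obc.presents_def
proof (intro allI impI)
  fix n p xs n' p' xs'
  assume h: "p \<in> Ops (obj_operad P) n" "xs \<in> tuples (Obj X) n" "p' \<in> Ops (obj_operad P) n'"
      "xs' \<in> tuples (Obj X) n'"
  interpret functor_pair "src X n" "tgt X n" "act_left P n" "act_right L n"
    by (rule functor_pair_tensor[OF X])
  have "tobj X n (p, xs) (p', xs') \<longleftrightarrow> obc.rel n p xs p' xs'" if n: "n' = n"
  proof
    assume "tobj X n (p, xs) (p', xs')"
    from tobj_imp[OF X this] obtain g where "g \<in> G n" "p' = aO n g p" "xs =
        perm_tuple (Prm L n g) xs'" by auto
    thus "obc.rel n p xs p' xs'" using obc.rel_act[of p n g xs'] h(1) by simp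
  next
    assume "obc.rel n p xs p' xs'"
    then obtain g where g: "g \<in> G n" "ob.kernel_orbit n p' (aO n g p)" "xs =
        perm_tuple (Prm L n g) xs'"
      unfolding obc.rel_def by blast
    from obc.eqv_sym[OF g(2)] obtain k where k: "k \<in> G n" "Prm L n k = id" "p' = aO n k (aO n g p)"
      unfolding ob.kernel_orbit_def by blast
    have "p' = aO n (g \<otimes>\<^bsub>Grp L n\<^esub> k) p" using k ob.act_mult[OF h(1) g(1) k(1)] by simp
    moreover have "Prm L n (g \<otimes>\<^bsub>Grp L n\<^esub> k) = Prm L n g" using Prm_mult[OF g(1) k(1)] k(2) by simp
    ultimately show "tobj X n (p, xs) (p', xs')"
      using tobj_act[of p n xs' X "g \<otimes>\<^bsub>Grp L n\<^esub> k"] h n g(3) mult_G[OF g(1) k(1)] by simp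
  qed
  thus "T_obj L P X n p xs = T_obj L P X n' p' xs' \<longleftrightarrow> n = n' \<and> obc.rel n p xs p' xs'"
    using ocls_eq[of "(p, xs)" "(p', xs')"] h by (auto simp: T_obj_def Obj_tgt)
qed

end

section \<open>The coequalizer relation on arrows for a free action\<close>

locale free_lam_op = lam_op +
  assumes free: "p \<in> Obj (PCat P n) \<Longrightarrow> g \<in> G n \<Longrightarrow> FObj (PAct P n g) p = p \<Longrightarrow> Prm L n g = id"
begin

sublocale obf: free_congruence L "obj_operad P" "\<lambda>n g. FObj (PAct P n g)" ob.kernel_orbit
proof
  fix n p g assume p: "p \<in> Ops (obj_operad P) n" and g: "g \<in> G n"
      and "ob.kernel_orbit n (aO n g p) p"
  then obtain h where h: "h \<in> G n" "Prm L n h = id" "p = aO n h (aO n g p)"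
      unfolding ob.kernel_orbit_def by blast
  have "Prm L n (g \<otimes>\<^bsub>Grp L n\<^esub> h) = id"
    using free[of p n "g \<otimes>\<^bsub>Grp L n\<^esub> h"] p ob.act_mult[OF p g h(1)] h mult_G[OF g h(1)] by simp
  thus "Prm L n g = id" using Prm_mult[OF g h(1)] h(2) by simp
qed

sublocale arf: free_congruence L "arr_operad P" "\<lambda>n g. FArr (PAct P n g)" arr_cong
proof
  fix n u g assume u: "u \<in> Ops (arr_operad P) n" and g: "g \<in> G n" and "arr_cong n (aA n g u) u"
  from arr_cong_Arr[OF this(3)] show "Prm L n g = id"
    using u FArr_Dom[OF functor_PAct[OF g]] Dom_Obj[OF cat_P] g
        by (intro obf.eqv_free[of "Dom (PCat P n) u" n g]) auto
qed

text \<open>The candidate for \<open>R\<close> in \<open>transport_congruence\<close>.\<close>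

definition tens_rel where
  "tens_rel X n f f' \<longleftrightarrow> f \<in> Arr (tgt X n) \<and> f' \<in> Arr (tgt X n) \<and>
     arc.rel n (fst f) (snd f) (fst f') (snd f')"

text \<open>
  Freeness enters the proof that the relation is compatible with composition: the group elements
  relating \<open>u\<close> to \<open>u'\<close> and \<open>v\<close> to \<open>v'\<close> agree modulo the kernel, because they move the common
  object \<open>Cod u = Dom v\<close> to the same place.
\<close>

lemma tens_rel_Cmp:
  assumes X: "is_cat X" and f: "tens_rel X n f f'" and g: "tens_rel X n g g'"
    and e: "Dom (tgt X n) g = Cod (tgt X n) f" and e': "Dom (tgt X n) g' = Cod (tgt X n) f'"
  shows "tens_rel X n (Cmp (tgt X n) g f) (Cmp (tgt X n) g' f')"
proof -
  interpret functor_pair "src X n" "tgt X n" "act_left P n" "act_right L n"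
    by (rule functor_pair_tensor[OF X])
  obtain u xs u' xs' v ys v' ys' where s: "f = (u, xs)" "f' = (u', xs')" "g = (v, ys)" "g' =
      (v', ys')"
    by (metis prod.exhaust)
  let ?C = "PCat P n"
  have m: "u \<in> Arr ?C" "u' \<in> Arr ?C" "v \<in> Arr ?C" "v' \<in> Arr ?C" "xs \<in> tuples (Arr X) n"
      "xs' \<in> tuples (Arr X) n"
    "ys \<in> tuples (Arr X) n" "ys' \<in> tuples (Arr X) n" using f g
        by (auto simp: tens_rel_def s Arr_tgt)
  have l: "length xs = n" "length xs' = n" "length ys = n" "length ys' = n" using m
      by (auto simp: tuples_def)
  have d: "Dom ?C v = Cod ?C u" "Dom ?C v' = Cod ?C u'" using e e' l
      by (auto simp: s Dom_tgt Cod_tgt)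
  from f obtain a where a: "a \<in> G n" "arr_cong n u' (aA n a u)" "xs = perm_tuple (Prm L n a) xs'"
    by (auto simp: tens_rel_def s arc.rel_def)
  from g obtain b where b: "b \<in> G n" "arr_cong n v' (aA n b v)" "ys = perm_tuple (Prm L n b) ys'"
    by (auto simp: tens_rel_def s arc.rel_def)
  note fa = functor_simps[OF functor_PAct[OF a(1)]] and fb = functor_simps[OF functor_PAct[OF b(1)]]
  have "ob.kernel_orbit n (Dom ?C v') (aO n b (Dom ?C v))"
      using arr_cong_Arr[OF b(2)] fb(3)[OF m(3)] by simp
  moreover have "ob.kernel_orbit n (Dom ?C v') (aO n a (Dom ?C v))"
      using arr_cong_Arr[OF a(2)] fa(4)[OF m(1)] d by simp
  ultimately have k: "ob.kernel_orbit n (aO n a (Dom ?C v)) (aO n b (Dom ?C v))"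
    using obc.eqv_sym obc.eqv_trans by blast
  have ab: "Prm L n a = Prm L n b"
    by (rule obf.Prm_eqI[OF _ a(1) b(1) k]) (use m Dom_Obj[OF cat_P] in simp)
  \<comment> \<open>\<open>?c\<close> lies in the kernel and turns \<open>v\<close> moved by
    \<open>a\<close> into \<open>v\<close> moved by \<open>b\<close>. So \<open>a\<close> alone
    serves both factors, and functoriality of its action treats the composite.\<close>
  let ?c = "inv\<^bsub>Grp L n\<^esub> a \<otimes>\<^bsub>Grp L n\<^esub> b"
  have "Prm L n ?c = id"
    using Prm_mult[OF inv_G[OF a(1)] b(1)] Prm_inv[OF a(1)]
        permutes_inv_o(2)[OF Prm_permutes[OF a(1)]] ab by simp
  moreover have "aA n ?c (aA n a v) = aA n b v"
    using ar.act_mult[of "aA n a v" n "inv\<^bsub>Grp L n\<^esub> a" b] ar.act_inv[of v n a] ar.act_Ops[of v n a]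
        m a b by simp
  ultimately have "arr_cong n (aA n b v) (aA n a v)"
    using arr_cong.act[of "aA n a v" n ?c] fa(2)[OF m(3)] a b by simp
  hence v': "arr_cong n v' (aA n a v)" using b(2) arr_cong.trans by blast
  have "arr_cong n (Cmp ?C v' u') (Cmp ?C (aA n a v) (aA n a u))"
    by (rule arr_cong.Cmp[OF a(2) v']) (use d fa m in auto)
  hence "arr_cong n (Cmp ?C v' u') (aA n a (Cmp ?C v u))" using fa(6)[OF m(1,3) d(1)] by simp
  moreover have "map2 (Cmp X) ys xs = perm_tuple (Prm L n a) (map2 (Cmp X) ys' xs')"
    using a b l by (simp add: ab perm_Prm_map2)
  moreover have "Cmp (tgt X n) g f \<in> Arr (tgt X n)" "Cmp (tgt X n) g' f' \<in> Arr (tgt X n)"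
    using f g e e' Cmp_Arr[OF cat_D] by (auto simp: tens_rel_def)
  ultimately show ?thesis using a(1) l by (auto simp: tens_rel_def s Cmp_tgt arc.rel_def)
qed

text \<open>For a composite in \<open>P(n)\<close>, write the pair with entries \<open>xs\<close> as
  the later arrow paired with \<open>xs\<close> after the earlier arrow paired with identities. The
  two factors can then be replaced independently inside a path.\<close>

lemma tarr_cong:
  assumes X: "is_cat X"
  shows "arr_cong n u v \<Longrightarrow> xs \<in> tuples (Arr X) n \<Longrightarrow> tarr X n [(u, xs)] [(v, xs)]"
proof (induction arbitrary: xs rule: arr_cong.induct)
  case (act u n h)
  thus ?case using coeq_arr.sym[OF tarr_act[of u n xs X h]] by simp
next
  case (refl u n)
  interpret functor_pair "src X n" "tgt X n" "act_left P n" "act_right L n"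
    by (rule functor_pair_tensor[OF X])
  show ?case by (rule coeq_arr.refl) (use refl in \<open>simp add: Arr_tgt\<close>)
next
  case (sym n u v)
  thus ?case by (blast intro: coeq_arr.sym)
next
  case (trans n u v w)
  thus ?case by (blast intro: coeq_arr.trans)
next
  case (Cmp n u u' v v')
  interpret functor_pair "src X n" "tgt X n" "act_left P n" "act_right L n"
    by (rule functor_pair_tensor[OF X])
  let ?is = "map (Idt X) (map (Dom X) xs)"
  have xs: "length xs = n" "\<And>x. x \<in> set xs \<Longrightarrow> x \<in> Arr X" using Cmp.prems by (auto simp: tuples_def)
  have ist: "?is \<in> tuples (Arr X) n" using tuples_Idt[OF X tuples_Dom[OF X Cmp.prems]] .
  have ii: "map2 (Cmp X) xs ?is = xs" "map (Cod X) ?is = map (Dom X) xs"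
    using xs cat_simps[OF X] by (auto intro!: nth_equalityI)
  have *: "tarr X n [(x, ?is), (y, xs)] [(Cmp (PCat P n) y x, xs)] \<and> Dom (tgt X n) (y, xs) =
      Cod (tgt X n) (x, ?is)"
    if "x \<in> Arr (PCat P n)" "y \<in> Arr (PCat P n)" "Dom (PCat P n) y = Cod (PCat P n) x" for x y
  proof -
    have D: "Dom (tgt X n) (y, xs) = Cod (tgt X n) (x, ?is)"
      using that xs ii(2) by (simp add: Dom_tgt Cod_tgt)
    thus ?thesis using coeq_arr.comp[OF _ _ D] that ist Cmp.prems xs(1) ii(1)
        by (simp add: Arr_tgt Cmp_tgt)
  qed
  have A: "u \<in> Arr (PCat P n)" "v \<in> Arr (PCat P n)" "u' \<in> Arr (PCat P n)" "v' \<in> Arr (PCat P n)"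
    using arr_cong_Arr[OF Cmp.hyps(1)] arr_cong_Arr[OF Cmp.hyps(2)] by auto
  note c = *[OF A(1,2) Cmp.hyps(3)] and c' = *[OF A(3,4) Cmp.hyps(4)]
  have "Cod (tgt X n) (u, ?is) \<in> Obj (tgt X n)"
    using A ist by (intro Cod_Obj[OF cat_D]) (simp add: Arr_tgt)
  hence "tobj X n (Cod (tgt X n) (u, ?is)) (Dom (tgt X n) (v, xs))"
    unfolding conjunct2[OF c] by (rule coeq_obj.refl)
  hence "tarr X n ([(u, ?is)] @ [(v, xs)]) ([(u', ?is)] @ [(v', xs)])"
    by (intro arr_rel_append[OF Cmp.IH(1)[OF ist] Cmp.IH(2)[OF Cmp.prems]]) simp
  hence "tarr X n [(u, ?is), (v, xs)] [(u', ?is), (v', xs)]" by simp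
  from coeq_arr.trans[OF coeq_arr.sym[OF conjunct1[OF c]] coeq_arr.trans[OF this conjunct1[OF c']]]
  show ?case .
qed

lemma transport_tensor:
  assumes X: "is_cat X"
  shows "transport_congruence (src X n) (tgt X n) (act_left P n) (act_right L n) (tens_rel X n)"
proof -
  interpret functor_pair "src X n" "tgt X n" "act_left P n" "act_right L n"
    by (rule functor_pair_tensor[OF X])
  show ?thesis
  proof
    fix f g assume fg: "tens_rel X n f g"
    then obtain u xs v ys where s: "f = (u, xs)" "g = (v, ys)" and m: "u \<in> Arr (PCat P n)"
        "v \<in> Arr (PCat P n)"
      "xs \<in> tuples (Arr X) n" "ys \<in> tuples (Arr X) n" and r: "arc.rel n u xs v ys"
      by (cases f; cases g) (auto simp: tens_rel_def Arr_tgt)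
    from r obtain a where a: "a \<in> G n" "arr_cong n v (aA n a u)" "xs = perm_tuple (Prm L n a) ys"
      unfolding arc.rel_def by blast
    show "tarr X n [f] [g]"
    proof -
      have "tarr X n [(u, xs)] [(aA n a u, ys)]" unfolding a(3) by (rule tarr_act[OF m(1,4) a(1)])
      moreover have "tarr X n [(aA n a u, ys)] [(v, ys)]"
          by (rule coeq_arr.sym[OF tarr_cong[OF X a(2) m(4)]])
      ultimately show ?thesis unfolding s by (rule coeq_arr.trans)
    qed
    from arr_rel_path[OF this]
    show "f \<in> Arr (tgt X n) \<and> g \<in> Arr (tgt X n) \<and>
       tobj X n (Cod (tgt X n) f) (Cod (tgt X n) g)" by simp
    show "tens_rel X n g f"
      using fg arc.rel_sym[OF r] m by (simp add: tens_rel_def s length_tuples)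
    fix h assume gh: "tens_rel X n g h"
    then obtain w zs where h: "h = (w, zs)" "zs \<in> tuples (Arr X) n" "arc.rel n v ys w zs"
      by (cases h) (auto simp: tens_rel_def Arr_tgt s)
    show "tens_rel X n f h"
      using fg gh arc.rel_trans[OF r h(3)] m(1) h(2) by (simp add: tens_rel_def s h length_tuples)
  next
    fix f assume "f \<in> Arr (tgt X n)"
    thus "tens_rel X n f f" by (auto simp: tens_rel_def Arr_tgt intro: arc.rel_eqv[OF
        arr_cong.refl])
    fix x assume f: "f \<in> Arr (tgt X n)" and x: "tobj X n x (Dom (tgt X n) f)"
    then obtain u xs p ps where s: "f = (u, xs)" "x = (p, ps)" and m: "u \<in> Arr (PCat P n)"
        "xs \<in> tuples (Arr X) n"
      by (cases f; cases x) (auto simp: Arr_tgt)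
    from tobj_imp[OF X x] m obtain g where g: "g \<in> G n" "Dom (PCat P n) u = aO n g p" "ps =
        perm_tuple (Prm L n g) (map (Dom X) xs)"
      and p: "p \<in> Obj (PCat P n)" by (auto simp: s Dom_tgt length_tuples)
    \<comment> \<open>Here \<open>p\<close> moved by \<open>g\<close> is the domain of
      \<open>u\<close>. Acting by the inverse on \<open>u\<close> and permuting \<open>xs\<close> by
      \<open>g\<close> gives an equivalent pair whose domain is exactly \<open>x\<close>.\<close>
    let ?i = "inv\<^bsub>Grp L n\<^esub> g"
    let ?f = "(aA n ?i u, perm_tuple (Prm L n g) xs)"
    note fi = functor_simps[OF functor_PAct[OF inv_G[OF g(1)]]]
    have fA: "?f \<in> Arr (tgt X n)" using m fi(2) obc.perm_tuple_tuples[OF g(1) m(2)]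
        by (simp add: Arr_tgt)
    have "Dom (tgt X n) ?f = x"
      using m fi(3)[OF m(1)] g ob.act_inv[of p n g] p perm_Prm[OF g(1), of xs "Dom X"]
      by (simp add: s Dom_tgt length_tuples)
    moreover have "xs = perm_tuple (Prm L n ?i) (perm_tuple (Prm L n g) xs)"
      using perm_tuple_inv(2)[of "Prm L n g" xs] Prm_permutes[OF g(1)] m(2)
          by (simp add: Prm_inv[OF g(1)] length_tuples)
    hence "arc.rel n u xs (aA n ?i u) (perm_tuple (Prm L n g) xs)"
      using arc.rel_act[of u n ?i "perm_tuple (Prm L n g) xs"] m(1) inv_G[OF g(1)] by simp
    hence "tens_rel X n f ?f" using f fA by (simp add: tens_rel_def s)
    ultimately show "\<exists>f'. tens_rel X n f f' \<and> Dom (tgt X n) f' = x" by blast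
  next
    fix c assume "c \<in> Arr (src X n)"
    then obtain u g xs where c: "c = (u, g, xs)" "u \<in> Arr (PCat P n)" "g \<in> G n"
        "xs \<in> tuples (Arr X) n"
      by (auto simp: Arr_src)
    have r: "arc.rel n u (perm_tuple (Prm L n g) xs) (aA n g u) xs" using arc.rel_act c by simp
    have "arc.rel n (aA n g u) xs u (perm_tuple (Prm L n g) xs)"
      using arc.rel_sym[OF r] c by (simp add: length_tuples)
    thus "tens_rel X n (FArr (act_left P n) c) (FArr (act_right L n) c)"
      using c ar.act_Ops[of u n g] obc.perm_tuple_tuples[OF c(3,4)]
      by (simp add: act_left_def act_right_def tens_rel_def Arr_tgt)
  qed (rule tens_rel_Cmp[OF X])
qed

lemma presents_T_arr:
  assumes X: "is_cat X" shows "arc.presents (Arr X) (T_arr L P X)"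
  unfolding arc.presents_def
proof (intro allI impI)
  fix n p xs n' p' xs'
  assume h: "p \<in> Ops (arr_operad P) n" "xs \<in> tuples (Arr X) n" "p' \<in> Ops (arr_operad P) n'"
      "xs' \<in> tuples (Arr X) n'"
  interpret transport_congruence "src X n" "tgt X n" "act_left P n" "act_right L n" "tens_rel X n"
    by (rule transport_tensor[OF X])
  have "(p, xs) \<in> Arr (tgt X n)" using h by (simp add: Arr_tgt)
  thus "T_arr L P X n p xs = T_arr L P X n' p' xs' \<longleftrightarrow> n = n' \<and> arc.rel n p xs p' xs'"
    using acls_eq[of "[(p, xs)]" "[(p', xs')]"] single_rel_iff[of "(p, xs)" "(p', xs')"] h
    by (auto simp: T_arr_def tens_rel_def Arr_tgt)
qed

end

section \<open>The associated 2-monad\<close>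

lemma is_cat_coprod:
  assumes "\<And>i. is_cat (C i)" shows "is_cat (coprod_cat C)"
  using cat_simps[OF assms] by (intro is_catI) (auto simp: coprod_cat_def)

lemma concat_map2:
  assumes "list_all2 (\<lambda>ys xs. length ys = length xs) yss xss"
  shows "concat (map2 (map2 f) yss xss) = map2 f (concat yss) (concat xss)"
  using assms by (induction rule: list_all2_induct) simp_all

section \<open>The structure of \<open>T_cat\<close> on representatives\<close>

context lam_op
begin

lemma FObj_T_map: "FObj (T_map L P X Y F) =
    tens_map (obj_operad P) (Obj X) (T_obj L P X) (T_obj L P Y) (FObj F)"
  and FArr_T_map: "FArr (T_map L P X Y F) =
      tens_map (arr_operad P) (Arr X) (T_arr L P X) (T_arr L P Y) (FArr F)"
  by (simp_all add: T_map_def tens_map_def Obj_power Arr_power fun_eq_iff)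

lemma FObj_T_unit: "FObj (T_unit L P X) = tens_unit (obj_operad P) (T_obj L P X)"
  and FArr_T_unit: "FArr (T_unit L P X) = tens_unit (arr_operad P) (T_arr L P X)"
  by (simp_all add: T_unit_def tens_unit_def obj_operad_def arr_operad_def fun_eq_iff)

lemma FObj_T_mult:
    "FObj (T_mult L P X) = tens_mult (obj_operad P) (Obj X) (T_obj L P X) (T_obj L P (T_cat L P X))"
  and FArr_T_mult:
    "FArr (T_mult L P X) = tens_mult (arr_operad P) (Arr X) (T_arr L P X) (T_arr L P (T_cat L P X))"
  by (simp_all add: T_mult_def tens_mult_def blocks_def Obj_power Arr_power fun_eq_iff)

lemma is_cat_T: "is_cat X \<Longrightarrow> is_cat (T_cat L P X)"
  unfolding T_cat_def tensor_def
  by (intro is_cat_coprod functor_pair.is_cat_coequalizer functor_pair_tensor)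

lemma Obj_T: "Obj (T_cat L P X) = tens (obj_operad P) (Obj X) (T_obj L P X)"
  by (auto simp: T_cat_def coprod_cat_def tensor_def coequalizer_def tens_def T_obj_def Obj_tgt)

lemma Dom_T:
  assumes X: "is_cat X" and u: "u \<in> Arr (PCat P n)" and xs: "xs \<in> tuples (Arr X) n"
  shows "Dom (T_cat L P X) (T_arr L P X n u xs) = T_obj L P X n (Dom (PCat P n) u) (map (Dom X) xs)"
    and "Cod (T_cat L P X) (T_arr L P X n u xs) = T_obj L P X n (Cod (PCat P n) u) (map (Cod X) xs)"
proof -
  interpret functor_pair "src X n" "tgt X n" "act_left P n" "act_right L n"
    by (rule functor_pair_tensor[OF X])
  have "path [(u, xs)]" using u xs by (simp add: Arr_tgt)
  from Dom_acls[OF this] Cod_acls[OF this]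
  show "Dom (T_cat L P X) (T_arr L P X n u xs) = T_obj L P X n (Dom (PCat P n) u) (map (Dom X) xs)"
    "Cod (T_cat L P X) (T_arr L P X n u xs) = T_obj L P X n (Cod (PCat P n) u) (map (Cod X) xs)"
    using xs by (simp_all add: T_cat_def coprod_cat_def tensor_def T_obj_def T_arr_def Dom_tgt
        Cod_tgt length_tuples)
qed

lemma Idt_T:
  assumes X: "is_cat X" and p: "p \<in> Obj (PCat P n)" and xs: "xs \<in> tuples (Obj X) n"
  shows "Idt (T_cat L P X) (T_obj L P X n p xs) = T_arr L P X n (Idt (PCat P n) p) (map (Idt X) xs)"
proof -
  interpret functor_pair "src X n" "tgt X n" "act_left P n" "act_right L n"
    by (rule functor_pair_tensor[OF X])
  have "(p, xs) \<in> Obj (tgt X n)" using p xs by (simp add: Obj_tgt)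
  from Idt_ocls[OF this] show ?thesis
    using xs by (simp add: T_cat_def coprod_cat_def tensor_def T_obj_def T_arr_def Idt_tgt
        length_tuples)
qed

lemma Cmp_T:
  assumes X: "is_cat X" and u: "u \<in> Arr (PCat P n)" and xs: "xs \<in> tuples (Arr X) n"
    and v: "v \<in> Arr (PCat P n)" and ys: "ys \<in> tuples (Arr X) n"
    and e: "Dom (PCat P n) v = Cod (PCat P n) u" "map (Dom X) ys = map (Cod X) xs"
  shows "Cmp (T_cat L P X) (T_arr L P X n v ys) (T_arr L P X n u xs) =
    T_arr L P X n (Cmp (PCat P n) v u) (map2 (Cmp X) ys xs)"
proof -
  interpret functor_pair "src X n" "tgt X n" "act_left P n" "act_right L n"
    by (rule functor_pair_tensor[OF X])
  have p: "(u, xs) \<in> Arr (tgt X n)" "(v, ys) \<in> Arr (tgt X n)" using u v xs ys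
      by (simp_all add: Arr_tgt)
  have l: "length xs = n" "length ys = n" using xs ys by (auto simp: tuples_def)
  have d: "Dom (tgt X n) (v, ys) = Cod (tgt X n) (u, xs)" using e l by (simp add: Dom_tgt Cod_tgt)
  have "tobj X n (Cod (tgt X n) (u, xs)) (Dom (tgt X n) (v, ys))"
    unfolding d by (rule coeq_obj.refl[OF Cod_Obj[OF cat_D p(1)]])
  hence "Cmp (tensor L P X n) (acls [(v, ys)]) (acls [(u, xs)]) = acls [(u, xs), (v, ys)]"
    using Cmp_acls[of "[(u, xs)]" "[(v, ys)]"] p by (simp add: tensor_def)
  moreover have r: "tarr X n [(u, xs), (v, ys)] [Cmp (tgt X n) (v, ys) (u, xs)]"
    using coeq_arr.comp[OF p d] .
  moreover have "acls [(u, xs), (v, ys)] = acls [Cmp (tgt X n) (v, ys) (u, xs)]"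
    using acls_eq[of "[(u, xs), (v, ys)]"] arr_rel_path[OF r] r by simp
  ultimately show ?thesis using l by (simp add: T_cat_def coprod_cat_def T_arr_def Cmp_tgt)
qed

end

context free_lam_op
begin

text \<open>Every path collapses to one arrow by \<open>path_single_rep\<close>, so the definite
  descriptions in \<open>T_map\<close> and \<open>T_mult\<close> cover all arrows.\<close>

lemma Arr_T:
  assumes X: "is_cat X"
  shows "Arr (T_cat L P X) = tens (arr_operad P) (Arr X) (T_arr L P X)"
proof -
  have "Arr (tensor L P X n) = {S. \<exists>u xs. u \<in> Arr (PCat P n) \<and> xs \<in> tuples (Arr X) n \<and>
     S = coeq_acls (src X n) (tgt X n) (act_left P n) (act_right L n)
         [(u, xs)]}" (is "_ = ?R") for n
  proof -
    interpret transport_congruence "src X n" "tgt X n" "act_left P n" "act_right L n" "tens_rel X n"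
      by (rule transport_tensor[OF X])
    have "acls fs \<in> ?R" if p: "path fs" for fs
    proof -
      obtain u xs where f: "(u, xs) \<in> Arr (tgt X n)" "tarr X n fs [(u, xs)]"
        using path_single_rep[OF p] by auto
      hence "acls fs = acls [(u, xs)]" using acls_eq[OF p] by simp
      thus ?thesis using f(1) by (auto simp: Arr_tgt)
    qed
    moreover have "path [(u, xs)]" if "u \<in> Arr (PCat P n)" "xs \<in> tuples (Arr X) n" for u xs
      using that by (simp add: Arr_tgt)
    ultimately show ?thesis by (auto simp: tensor_def Arr_Q)
  qed
  thus ?thesis by (auto simp: T_cat_def coprod_cat_def tens_def T_arr_def)
qed

text \<open>Classes that compose in the quotient have representatives that compose on the nose: keep
  the first one and transport the second to its codomain. This reduces preservation of composites to
  a check on representatives.\<close>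

lemma composable_rep:
  assumes X: "is_cat X" and Z: "Z \<in> Arr (T_cat L P X)" "Z' \<in> Arr (T_cat L P X)"
    and e: "Dom (T_cat L P X) Z' = Cod (T_cat L P X) Z"
  obtains n u xs v ys where "u \<in> Arr (PCat P n)" "xs \<in> tuples (Arr X) n" "v \<in> Arr (PCat P n)"
      "ys \<in> tuples (Arr X) n"
    "Dom (PCat P n) v = Cod (PCat P n) u" "map (Dom X) ys = map (Cod X) xs"
    "Z = T_arr L P X n u xs" "Z' = T_arr L P X n v ys"
proof -
  from Z obtain n u xs n' v ys where h: "u \<in> Arr (PCat P n)" "xs \<in> tuples (Arr X) n" "Z =
      T_arr L P X n u xs"
    "v \<in> Arr (PCat P n')" "ys \<in> tuples (Arr X) n'" "Z' = T_arr L P X n' v ys"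
    by (auto simp: Arr_T[OF X] tens_def)
  have "T_obj L P X n' (Dom (PCat P n') v) (map (Dom X) ys) =
      T_obj L P X n (Cod (PCat P n) u) (map (Cod X) xs)"
    using e h Dom_T[OF X] by simp
  hence n: "n' = n" and oe: "coeq_ocls (src X n) (tgt X n) (act_left P n) (act_right L n)
      (Cod (PCat P n) u, map (Cod X) xs) = coeq_ocls (src X n) (tgt X n) (act_left P n)
          (act_right L n)
      (Dom (PCat P n) v, map (Dom X) ys)" by (auto simp: T_obj_def)
  interpret transport_congruence "src X n" "tgt X n" "act_left P n" "act_right L n" "tens_rel X n"
    by (rule transport_tensor[OF X])
  have m: "(v, ys) \<in> Arr (tgt X n)" "(Cod (PCat P n) u, map (Cod X) xs) \<in> Obj (tgt X n)"
    using h n Cod_Obj[OF cat_P] tuples_Cod[OF X h(2)] by (simp_all add: Arr_tgt Obj_tgt)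
  have "tobj X n (Cod (PCat P n) u, map (Cod X) xs) (Dom (tgt X n) (v, ys))"
    using oe ocls_eq[OF m(2)] h n by (simp add: Dom_tgt length_tuples)
  from R_transport[OF m(1) this] obtain w zs where w: "tens_rel X n (v, ys) (w, zs)"
    "Dom (tgt X n) (w, zs) = (Cod (PCat P n) u, map (Cod X) xs)" by (metis prod.exhaust)
  have wm: "w \<in> Arr (PCat P n)" "zs \<in> tuples (Arr X) n" using R_Arr[OF w(1)] by (auto simp: Arr_tgt)
  have "Z' = T_arr L P X n w zs"
    using h n acls_eq[of "[(v, ys)]" "[(w, zs)]"] R_arr_rel[OF w(1)] m(1) by (simp add: T_arr_def)
  thus thesis using that[of u n xs w zs] h wm w(2) by (simp add: Dom_tgt length_tuples)
qed

lemma is_functor_T_catI: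
  assumes X: "is_cat X"
    and O: "\<And>n p xs. p \<in> Obj (PCat P n) \<Longrightarrow> xs \<in> tuples (Obj X) n \<Longrightarrow>
        FObj F (T_obj L P X n p xs) \<in> Obj D"
    and A: "\<And>n u xs. u \<in> Arr (PCat P n) \<Longrightarrow> xs \<in> tuples (Arr X) n \<Longrightarrow>
        FArr F (T_arr L P X n u xs) \<in> Arr D \<and>
      Dom D (FArr F (T_arr L P X n u xs)) = FObj F
          (T_obj L P X n (Dom (PCat P n) u) (map (Dom X) xs)) \<and>
      Cod D (FArr F (T_arr L P X n u xs)) = FObj F
          (T_obj L P X n (Cod (PCat P n) u) (map (Cod X) xs))"
    and I: "\<And>n p xs. p \<in> Obj (PCat P n) \<Longrightarrow> xs \<in> tuples (Obj X) n \<Longrightarrow>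
      FArr F (T_arr L P X n (Idt (PCat P n) p) (map (Idt X) xs)) = Idt D
          (FObj F (T_obj L P X n p xs))"
    and C: "\<And>n u xs v ys. u \<in> Arr (PCat P n) \<Longrightarrow> xs \<in> tuples (Arr X) n \<Longrightarrow> v \<in> Arr (PCat P n) \<Longrightarrow>
        ys \<in> tuples (Arr X) n \<Longrightarrow>
      Dom (PCat P n) v = Cod (PCat P n) u \<Longrightarrow> map (Dom X) ys = map (Cod X) xs \<Longrightarrow>
      FArr F (T_arr L P X n (Cmp (PCat P n) v u) (map2 (Cmp X) ys xs)) =
      Cmp D (FArr F (T_arr L P X n v ys)) (FArr F (T_arr L P X n u xs))"
  shows "is_functor (T_cat L P X) D F"
proof (rule is_functorI)
  fix Z assume "Z \<in> Obj (T_cat L P X)"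
  then obtain n p xs where h: "p \<in> Obj (PCat P n)" "xs \<in> tuples (Obj X) n" "Z = T_obj L P X n p xs"
    by (auto simp: Obj_T tens_def)
  show "FObj F Z \<in> Obj D" using O h by simp
  show "FArr F (Idt (T_cat L P X) Z) = Idt D (FObj F Z)" using I h Idt_T[OF X] by simp
next
  fix Z assume "Z \<in> Arr (T_cat L P X)"
  then obtain n u xs where h: "u \<in> Arr (PCat P n)" "xs \<in> tuples (Arr X) n" "Z = T_arr L P X n u xs"
    by (auto simp: Arr_T[OF X] tens_def)
  show "FArr F Z \<in> Arr D \<and> Dom D (FArr F Z) = FObj F (Dom (T_cat L P X) Z) \<and> Cod D (FArr F Z) =
      FObj F (Cod (T_cat L P X) Z)"
    using A h Dom_T[OF X] by simp
next
  fix Z Z' assume "Z \<in> Arr (T_cat L P X)" "Z' \<in> Arr (T_cat L P X)" "Dom (T_cat L P X) Z' =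
      Cod (T_cat L P X) Z"
  from X this obtain n u xs v ys where h: "u \<in> Arr (PCat P n)" "xs \<in> tuples (Arr X) n"
      "v \<in> Arr (PCat P n)" "ys \<in> tuples (Arr X) n"
    "Dom (PCat P n) v = Cod (PCat P n) u" "map (Dom X) ys = map (Cod X) xs"
    "Z = T_arr L P X n u xs" "Z' = T_arr L P X n v ys" by (rule composable_rep)
  show "FArr F (Cmp (T_cat L P X) Z' Z) = Cmp D (FArr F Z') (FArr F Z)"
    unfolding h(7,8) Cmp_T[OF X h(1-6)] by (rule C[OF h(1-6)])
qed

lemma is_functor_T_map:
  assumes X: "is_cat X" and Y: "is_cat Y" and F: "is_functor X Y F"
  shows "is_functor (T_cat L P X) (T_cat L P Y) (T_map L P X Y F)"
proof -
  note fs = functor_simps[OF F]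
  have FO: "FObj F \<in> Obj X \<rightarrow> Obj Y" and FA: "FArr F \<in> Arr X \<rightarrow> Arr Y" using fs by auto
  note eO = obc.tens_map_eq[OF presents_T_obj[OF X] presents_T_obj[OF Y] FO, folded FObj_T_map,
      simplified]
    and eA = arc.tens_map_eq[OF presents_T_arr[OF X] presents_T_arr[OF Y] FA, folded FArr_T_map,
        simplified]
  note mO = map_tuples[OF _ FO] and mA = map_tuples[OF _ FA]
  have DC: "map (Dom Y) (map (FArr F) xs) = map (FObj F) (map (Dom X) xs)"
    "map (Cod Y) (map (FArr F) xs) = map (FObj F) (map (Cod X) xs)" if "xs \<in> tuples (Arr X) n"
        for xs n
    using that fs by (auto simp: tuples_def)
  show ?thesis
  proof (rule is_functor_T_catI[OF X], goal_cases)
    case (1 n p xs)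
    thus ?case using mO by (simp add: eO Obj_T tens_def) blast
  next
    case (2 n u xs)
    have "T_arr L P Y n u (map (FArr F) xs) \<in> Arr (T_cat L P Y)"
      unfolding Arr_T[OF Y] using 2 mA by (intro tens_I) simp_all
    thus ?case
      using 2 Dom_T[OF Y 2(1) mA[OF 2(2)]] DC[OF 2(2)] Dom_Obj[OF cat_P] Cod_Obj[OF cat_P]
          tuples_Dom[OF X] tuples_Cod[OF X]
      by (simp add: eO eA del: map_map)
  next
    case (3 n p xs)
    moreover have "map (FArr F) (map (Idt X) xs) = map (Idt Y) (map (FObj F) xs)" using 3 fs
        by (auto simp: tuples_def)
    ultimately show ?case
      using Idt_T[OF Y 3(1) mO[OF 3(2)]] Idt_Arr[OF cat_P] tuples_Idt[OF X]
          by (simp add: eO eA del: map_map)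
  next
    case (4 n u xs v ys)
    have l: "length xs = n" "length ys = n" using 4 by (auto simp: tuples_def)
    have "map (FArr F) (map2 (Cmp X) ys xs) = map2 (Cmp Y) (map (FArr F) ys) (map (FArr F) xs)"
    proof (rule nth_equalityI)
      fix i assume "i < length (map (FArr F) (map2 (Cmp X) ys xs))"
      hence i: "i < n" using l by simp
      have "xs ! i \<in> Arr X" "ys ! i \<in> Arr X" using 4 l i by (auto simp: tuples_def)
      moreover have "Dom X (ys ! i) = Cod X (xs ! i)" using 4(6) l i by (metis nth_map)
      ultimately show "map (FArr F) (map2 (Cmp X) ys xs) ! i =
          map2 (Cmp Y) (map (FArr F) ys) (map (FArr F) xs) ! i"
        using l i fs(6) by simp
    qed (use l in simp)
    moreover have "map (Dom Y) (map (FArr F) ys) = map (Cod Y) (map (FArr F) xs)"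
      unfolding DC(1)[OF 4(4)] DC(2)[OF 4(2)] 4(6) ..
    ultimately show ?case
      using 4 Cmp_T[OF Y 4(1) mA[OF 4(2)] 4(3) mA[OF 4(4)] 4(5)] map2_Cmp_tuples(1)[OF X 4(2,4,6)]
          Cmp_Arr[OF cat_P 4(1,3,5)]
      by (simp add: eA del: map_map)
  qed
qed

lemma is_functor_T_unit:
  assumes X: "is_cat X" shows "is_functor X (T_cat L P X) (T_unit L P X)"
proof -
  let ?e = "PUnit P" and ?C = "PCat P 1"
  have e: "?e \<in> Obj ?C" using ob.Unit_Ops by (simp add: obj_operad_def)
  have t: "[x] \<in> tuples S 1" if "x \<in> S" for x :: 'z and S using that by (simp add: tuples_def)
  note cp = cat_simps[OF cat_P[of 1]]
  have i: "Idt ?C ?e \<in> Arr ?C" using cp(3)[OF e] .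
  show ?thesis
  proof (rule is_functorI, goal_cases)
    case (1 x)
    thus ?case using tens_I[of ?e "obj_operad P" 1 "[x]" "Obj X" "T_obj L P X"] e t[OF 1]
        by (simp add: Obj_T T_unit_def)
  next
    case (2 u)
    thus ?case
      using tens_I[of "Idt ?C ?e" "arr_operad P" 1 "[u]" "Arr X" "T_arr L P X"] i t[of u "Arr X"]
          Dom_T[OF X i t[OF 2]] cp(4,5)[OF e]
      by (simp add: Arr_T[OF X] T_unit_def)
  next
    case (3 x)
    thus ?case using Idt_T[OF X e t[OF 3]] by (simp add: T_unit_def)
  next
    case (4 u v)
    thus ?case using Cmp_T[OF X i t[OF 4(1)] i t[OF 4(2)]] cp(4,5)[OF e] cp(9)[OF i]
        by (simp add: T_unit_def)
  qed
qed

text \<open>On representatives, multiplication composes operations and concatenates tuples, so the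
  functor laws come from those of \<open>PMu\<close> in each arity.\<close>

lemma is_functor_T_mult:
  assumes X: "is_cat X" shows "is_functor (T_cat L P (T_cat L P X)) (T_cat L P X) (T_mult L P X)"
proof -
  let ?T = "T_cat L P X"
  have T: "is_cat ?T" using is_cat_T[OF X] .
  note eO = obc.tens_mult_eq[OF presents_T_obj[OF X] presents_T_obj[OF T, unfolded Obj_T], folded
      FObj_T_mult, simplified]
    and eA = arc.tens_mult_eq[OF presents_T_arr[OF X] presents_T_arr[OF T, unfolded Arr_T[OF X]],
        folded FArr_T_mult, simplified]
  have DC: "map (Dom ?T) (blocks (T_arr L P X) ks us xss) =
      blocks (T_obj L P X) ks (map2 (\<lambda>k. Dom (PCat P k)) ks us) (map (map (Dom X)) xss)"
    "map (Cod ?T) (blocks (T_arr L P X) ks us xss) =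
        blocks (T_obj L P X) ks (map2 (\<lambda>k. Cod (PCat P k)) ks us) (map (map (Cod X)) xss)"
    if "ops_tuple (arr_operad P) ks us" "tuple_lists (Arr X) ks xss" for ks us xss
    using that Dom_T[OF X] ops_tuple_length[OF that(1)] ops_tuple_nth[OF that(1)]
        list_all2_nthD[OF that(2)] list_all2_lengthD[OF that(2)]
    by (auto simp: blocks_def intro!: nth_equalityI)
  have CodT: "ops_tuple (obj_operad P) ks (map2 (\<lambda>k. Cod (PCat P k)) ks us)"
      if "ops_tuple (arr_operad P) ks us" for ks us
    using that Cod_Obj[OF cat_P] by (auto simp: ops_tuple_def list_all2_conv_all_nth)
  have mt: "tuple_lists (Obj X) ks (map (map (Dom X)) xss)"
    "tuple_lists (Obj X) ks (map (map (Cod X)) xss)"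
    if "tuple_lists (Arr X) ks xss" for ks xss
    using that tuples_Dom[OF X] tuples_Cod[OF X] by (auto simp: list_all2_conv_all_nth)
  show ?thesis
  proof (rule is_functor_T_catI[OF T], goal_cases)
    case (1 n p ts)
    obtain ks qs xss where k: "length ks = n" "ops_tuple (obj_operad P) ks qs"
        "tuple_lists (Obj X) ks xss"
      "ts = blocks (T_obj L P X) ks qs xss" by (rule obc.blocks_rep[OF 1(2)[unfolded Obj_T]])
    have "p \<in> Obj (PCat P (length ks))" using 1 k by simp
    thus ?case using eO[of p ks qs xss] k ob.Mu_Ops[of p ks qs] concat_tuples[OF k(3)]
      by (auto simp: Obj_T intro!: tens_I)
  next
    case (2 n u ts)
    obtain ks us xss where k: "length ks = n" "ops_tuple (arr_operad P) ks us"
        "tuple_lists (Arr X) ks xss"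
      "ts = blocks (T_arr L P X) ks us xss" by (rule arc.blocks_rep[OF 2(2)[unfolded Arr_T[OF X]]])
    have u: "u \<in> Arr (PCat P (length ks))" using 2 k by simp
    have M: "MA ks u us \<in> Arr (PCat P (sum_list ks))" using ar.Mu_Ops[of u ks us] u k by simp
    have c: "concat xss \<in> tuples (Arr X) (sum_list ks)" using concat_tuples[OF k(3)] .
    have e: "FArr (T_mult L P X) (T_arr L P ?T n u ts) =
        T_arr L P X (sum_list ks) (MA ks u us) (concat xss)"
      using eA[OF u k(2,3)] k by simp
    have d: "FObj (T_mult L P X) (T_obj L P ?T n (Dom (PCat P n) u) (map (Dom ?T) ts)) =
        T_obj L P X (sum_list ks) (MO ks (Dom (PCat P n) u) (map2 (\<lambda>k. Dom (PCat P k)) ks us))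
            (concat (map (map (Dom X)) xss))"
      using eO[OF Dom_Obj[OF cat_P u] Dom_tuple[OF k(2)] mt(1)[OF k(3)]] DC(1)[OF k(2,3)] k by simp
    have c': "FObj (T_mult L P X) (T_obj L P ?T n (Cod (PCat P n) u) (map (Cod ?T) ts)) =
        T_obj L P X (sum_list ks) (MO ks (Cod (PCat P n) u) (map2 (\<lambda>k. Cod (PCat P k)) ks us))
            (concat (map (map (Cod X)) xss))"
      using eO[OF Cod_Obj[OF cat_P u] CodT[OF k(2)] mt(2)[OF k(3)]] DC(2)[OF k(2,3)] k by simp
    show ?case
      unfolding e d c' using Dom_T[OF X M c] Dom_MA[OF u k(2)] Cod_MA[OF u k(2)] k(1) M c
      by (simp add: Arr_T[OF X] map_concat tens_I)
  next
    case (3 n p ts)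
    obtain ks qs xss where k: "length ks = n" "ops_tuple (obj_operad P) ks qs"
        "tuple_lists (Obj X) ks xss"
      "ts = blocks (T_obj L P X) ks qs xss" by (rule obc.blocks_rep[OF 3(2)[unfolded Obj_T]])
    have p: "p \<in> Obj (PCat P (length ks))" using 3 k by simp
    let ?is = "map2 (\<lambda>k. Idt (PCat P k)) ks qs"
    have xi: "tuple_lists (Arr X) ks (map (map (Idt X)) xss)"
      using k(3) tuples_Idt[OF X] by (auto simp: list_all2_conv_all_nth)
    have "map (Idt ?T) ts = blocks (T_arr L P X) ks ?is (map (map (Idt X)) xss)"
      using Idt_T[OF X] ops_tuple_length[OF k(2)] ops_tuple_nth[OF k(2)] list_all2_nthD[OF k(3)]
          list_all2_lengthD[OF k(3)]
      unfolding k(4) by (auto simp: blocks_def intro!: nth_equalityI)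
    hence "FArr (T_mult L P X) (T_arr L P ?T n (Idt (PCat P n) p) (map (Idt ?T) ts)) =
       T_arr L P X (sum_list ks) (MA ks (Idt (PCat P n) p) ?is) (concat (map (map (Idt X)) xss))"
      using eA[OF Idt_Arr[OF cat_P p] Idt_tuple[OF k(2)] xi] k(1) by simp
    moreover have "FObj (T_mult L P X) (T_obj L P ?T n p ts) =
        T_obj L P X (sum_list ks) (MO ks p qs) (concat xss)"
      using eO[OF p k(2,3)] k by simp
    ultimately show ?case
      using Idt_T[OF X _ concat_tuples[OF k(3)], of "MO ks p qs"] ob.Mu_Ops[of p ks qs] p k
          Idt_MA[OF p k(2)]
      by (simp add: map_concat)
  next
    case (4 n u ts v ss)
    have lt: "length ts = n" "length ss = n" using 4 by (auto simp: tuples_def)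
    \<comment> \<open>Representatives are made composable inside each entry. This also forces both
      tuples to use the same inner arities \<open>ks\<close>, as interchange requires.\<close>
    have "\<exists>k a xs b ys. a \<in> Arr (PCat P k) \<and> xs \<in> tuples (Arr X) k \<and> b \<in> Arr (PCat P k) \<and>
        ys \<in> tuples (Arr X) k \<and>
       Dom (PCat P k) b = Cod (PCat P k) a \<and> map (Dom X) ys = map (Cod X) xs \<and>
       ts ! i = T_arr L P X k a xs \<and> ss ! i = T_arr L P X k b ys" if i: "i < n" for i
    proof -
      have "ts ! i \<in> Arr ?T" "ss ! i \<in> Arr ?T" using 4 lt i by (auto simp: tuples_def)
      moreover have "Dom ?T (ss ! i) = Cod ?T (ts ! i)" using 4(6) lt i by (metis nth_map)
      ultimately show ?thesis by (rule composable_rep[OF X]) blast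
    qed
    then obtain k a xs b ys where h: "\<And>i. i < n \<Longrightarrow> a i \<in> Arr (PCat P (k i)) \<and>
        xs i \<in> tuples (Arr X) (k i) \<and>
       b i \<in> Arr (PCat P (k i)) \<and> ys i \<in> tuples (Arr X) (k i) \<and>
       Dom (PCat P (k i)) (b i) = Cod (PCat P (k i)) (a i) \<and> map (Dom X) (ys i) = map (Cod X) (xs i)
           \<and>
       ts ! i = T_arr L P X (k i) (a i) (xs i) \<and> ss ! i = T_arr L P X (k i) (b i) (ys i)" by metis
    define ks as xss bs yss where "ks = map k [0..<n]" and "as = map a [0..<n]" and "xss =
        map xs [0..<n]"
      and "bs = map b [0..<n]" and "yss = map ys [0..<n]"
    note defs = ks_def as_def xss_def bs_def yss_def
    define cs where "cs = map (\<lambda>i. Cmp (PCat P (k i)) (b i) (a i)) [0..<n]"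
    define zss where "zss = map2 (map2 (Cmp X)) yss xss"
    have n: "length ks = n" by (simp add: defs)
    have tup: "ops_tuple (arr_operad P) ks as" "ops_tuple (arr_operad P) ks bs"
        "ops_tuple (arr_operad P) ks cs"
      using h Cmp_Arr[OF cat_P] by (auto simp: defs cs_def ops_tuple_def list_all2_conv_all_nth)
    have lists: "tuple_lists (Arr X) ks xss" "tuple_lists (Arr X) ks yss"
      "tuple_lists (Arr X) ks zss"
      using h map2_Cmp_tuples(1)[OF X] by (auto simp: defs zss_def list_all2_conv_all_nth)
    have ts: "ts = blocks (T_arr L P X) ks as xss" and ss: "ss = blocks (T_arr L P X) ks bs yss"
      using h lt by (auto simp: defs blocks_def intro!: nth_equalityI)
    have cc: "map2 (Cmp ?T) ss ts = blocks (T_arr L P X) ks cs zss"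
      using h lt Cmp_T[OF X] by (auto simp: defs cs_def zss_def blocks_def intro!: nth_equalityI)
    have u: "u \<in> Arr (PCat P (length ks))" and v: "v \<in> Arr (PCat P (length ks))"
      and e: "Dom (PCat P (length ks)) v = Cod (PCat P (length ks)) u" using 4 n by auto
    have M: "MA ks u as \<in> Arr (PCat P (sum_list ks))" "MA ks v bs \<in> Arr (PCat P (sum_list ks))"
      using ar.Mu_Ops[of u ks as] ar.Mu_Ops[of v ks bs] u v tup by simp_all
    have dm: "map2 (\<lambda>k. Dom (PCat P k)) ks bs = map2 (\<lambda>k. Cod (PCat P k)) ks as"
      using h by (auto simp: defs intro!: nth_equalityI)
    have D: "Dom (PCat P (sum_list ks)) (MA ks v bs) = Cod (PCat P (sum_list ks)) (MA ks u as)"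
      using Dom_MA[OF v tup(2)] Cod_MA[OF u tup(1)] e dm by simp
    have "map (map (Dom X)) yss = map (map (Cod X)) xss" using h by (simp add: defs)
    hence D': "map (Dom X) (concat yss) = map (Cod X) (concat xss)" by (simp add: map_concat)
    have len: "list_all2 (\<lambda>ys xs. length ys = length xs) yss xss"
      using h by (auto simp: defs list_all2_conv_all_nth tuples_def)
    have "FArr (T_mult L P X) (T_arr L P ?T n (Cmp (PCat P n) v u) (map2 (Cmp ?T) ss ts)) =
      T_arr L P X (sum_list ks) (MA ks (Cmp (PCat P n) v u) cs) (concat zss)"
      unfolding cc using eA[OF Cmp_Arr[OF cat_P u v e] tup(3) lists(3)] n by simp
    also have "MA ks (Cmp (PCat P n) v u) cs = Cmp (PCat P (sum_list ks)) (MA ks v bs) (MA ks u as)"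
      unfolding n[symmetric] by (rule Cmp_MA[OF u tup(1) v tup(2) e])
          (use h in \<open>auto simp: defs cs_def\<close>)
    also have "concat zss = map2 (Cmp X) (concat yss) (concat xss)" unfolding zss_def
        by (rule concat_map2[OF len])
    also have "T_arr L P X (sum_list ks) (Cmp (PCat P (sum_list ks)) (MA ks v bs) (MA ks u as)) \<dots> =
       Cmp ?T (T_arr L P X (sum_list ks) (MA ks v bs) (concat yss))
           (T_arr L P X (sum_list ks) (MA ks u as) (concat xss))"
      using Cmp_T[OF X M(1) concat_tuples[OF lists(1)] M(2) concat_tuples[OF lists(2)] D D'] by simp
    finally show ?case
      using eA[OF u tup(1) lists(1)] eA[OF v tup(2) lists(2)] n ts ss by simp
  qed
qed

theorem two_cartesian_if_free: "two_cartesian TYPE('u) L P"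
  unfolding two_cartesian_def
proof (intro conjI allI impI)
  fix W A B C :: "('u, 'u) cat" and p q f g
  assume pb: "two_pullback TYPE('u) W A B C p q f g"
  note d = two_pullbackD[OF pb]
  have fg: "FObj f \<in> Obj A \<rightarrow> Obj C" "FObj g \<in> Obj B \<rightarrow> Obj C" "FArr f \<in> Arr A \<rightarrow> Arr C"
      "FArr g \<in> Arr B \<rightarrow> Arr C"
    using functor_simps(1,2)[OF d(7)] functor_simps(1,2)[OF d(8)] by auto
  show "two_pullback TYPE('u) (T_cat L P W) (T_cat L P A) (T_cat L P B) (T_cat L P C)
          (T_map L P W A p) (T_map L P W B q) (T_map L P A C f) (T_map L P B C g)"
  proof (rule two_pullbackI)
    show "set_pullback (Obj (T_cat L P W)) (Obj (T_cat L P A)) (Obj (T_cat L P B))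
        (FObj (T_map L P W A p)) (FObj (T_map L P W B q)) (FObj (T_map L P A C f))
            (FObj (T_map L P B C g))"
      unfolding Obj_T FObj_T_map
      by (rule obf.set_pullback_tens_map[OF _ _ _ _ d(9) fg(1,2)]) (intro presents_T_obj d)+
    show "set_pullback (Arr (T_cat L P W)) (Arr (T_cat L P A)) (Arr (T_cat L P B))
        (FArr (T_map L P W A p)) (FArr (T_map L P W B q)) (FArr (T_map L P A C f))
            (FArr (T_map L P B C g))"
      unfolding Arr_T[OF d(1)] Arr_T[OF d(2)] Arr_T[OF d(3)] FArr_T_map
      by (rule arf.set_pullback_tens_map[OF _ _ _ _ d(10) fg(3,4)]) (intro presents_T_arr d)+
  qed (intro is_cat_T is_functor_T_map d)+
next
  fix X Y :: "('u, 'u) cat" and F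
  assume "is_cat X \<and> is_cat Y \<and> is_functor X Y F"
  hence X: "is_cat X" and Y: "is_cat Y" and F: "is_functor X Y F" by auto
  have FO: "FObj F \<in> Obj X \<rightarrow> Obj Y" and FA: "FArr F \<in> Arr X \<rightarrow> Arr Y" using functor_simps(1,2)[OF F]
      by auto
  have TX: "is_cat (T_cat L P X)" and TY: "is_cat (T_cat L P Y)" using is_cat_T X Y by auto
  have TF: "is_functor (T_cat L P X) (T_cat L P Y) (T_map L P X Y F)"
      using is_functor_T_map[OF X Y F] .
  show "two_pullback TYPE('u) X (T_cat L P X) Y (T_cat L P Y) (T_unit L P X) F (T_map L P X Y F)
      (T_unit L P Y)"
  proof (rule two_pullbackI)
    show "set_pullback (Obj X) (Obj (T_cat L P X)) (Obj Y) (FObj (T_unit L P X)) (FObj F)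
        (FObj (T_map L P X Y F)) (FObj (T_unit L P Y))"
      unfolding Obj_T FObj_T_map FObj_T_unit
      by (rule obf.set_pullback_tens_unit[OF presents_T_obj[OF X] presents_T_obj[OF Y] FO])
    show "set_pullback (Arr X) (Arr (T_cat L P X)) (Arr Y) (FArr (T_unit L P X)) (FArr F)
        (FArr (T_map L P X Y F)) (FArr (T_unit L P Y))"
      unfolding Arr_T[OF X] FArr_T_map FArr_T_unit
      by (rule arf.set_pullback_tens_unit[OF presents_T_arr[OF X] presents_T_arr[OF Y] FA])
  qed (intro X Y F TX TY TF is_functor_T_unit)+
  show "two_pullback TYPE('u) (T_cat L P (T_cat L P X)) (T_cat L P X) (T_cat L P (T_cat L P Y))
      (T_cat L P Y)
          (T_mult L P X) (T_map L P (T_cat L P X) (T_cat L P Y) (T_map L P X Y F)) (T_map L P X Y F)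
              (T_mult L P Y)"
  proof (rule two_pullbackI)
    show "set_pullback (Obj (T_cat L P (T_cat L P X))) (Obj (T_cat L P X))
        (Obj (T_cat L P (T_cat L P Y)))
      (FObj (T_mult L P X)) (FObj (T_map L P (T_cat L P X) (T_cat L P Y) (T_map L P X Y F)))
      (FObj (T_map L P X Y F)) (FObj (T_mult L P Y))"
      unfolding Obj_T FObj_T_map FObj_T_mult
      by (rule obf.set_pullback_tens_mult[OF presents_T_obj[OF X] presents_T_obj[OF Y] FO
            presents_T_obj[OF TX, unfolded Obj_T] presents_T_obj[OF TY, unfolded Obj_T]])
    show "set_pullback (Arr (T_cat L P (T_cat L P X))) (Arr (T_cat L P X))
        (Arr (T_cat L P (T_cat L P Y)))
      (FArr (T_mult L P X)) (FArr (T_map L P (T_cat L P X) (T_cat L P Y) (T_map L P X Y F)))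
      (FArr (T_map L P X Y F)) (FArr (T_mult L P Y))"
      unfolding Arr_T[OF X] Arr_T[OF TX] Arr_T[OF TY] Arr_T[OF Y] FArr_T_map FArr_T_mult
      by (rule arf.set_pullback_tens_mult[OF presents_T_arr[OF X] presents_T_arr[OF Y] FA
            presents_T_arr[OF TX, unfolded Arr_T[OF X]]
                presents_T_arr[OF TY, unfolded Arr_T[OF Y]]])
  qed (intro X Y F TX TY TF is_cat_T is_functor_T_mult is_functor_T_map)+
qed

end

section \<open>Necessity of the stabilizer condition\<close>

lemma is_functor_discrete_discrete:
  "h \<in> S \<rightarrow> S' \<Longrightarrow> is_functor (discrete S) (discrete S') \<lparr>FObj = h, FArr = h\<rparr>"
  by (auto simp: is_functor_discrete) (auto simp: discrete_def)

context lam_op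
begin

theorem stabilizer_in_kernel:
  assumes inf: "infinite (UNIV :: 'u set)" and tc: "two_cartesian TYPE('u) L P"
    and p: "p \<in> Obj (PCat P n)" and g: "g \<in> G n" and pg: "aO n g p = p"
  shows "Prm L n g = id"
proof (rule ccontr)
  let ?s = "Prm L n g"
  have s: "?s permutes {1..n}" using Prm_permutes[OF g] .
  assume "?s \<noteq> id"
  then obtain j where "?s j \<noteq> j" by (auto simp: fun_eq_iff)
  moreover from this have "j \<in> {1..n}" using permutes_not_in[OF s] by blast
  \<comment> \<open>List positions start at 0 and permutations at 1, so the moved point is written
    as \<open>Suc i\<close>.\<close>
  ultimately have "j - 1 < n \<and> ?s (Suc (j - 1)) \<noteq> Suc (j - 1)" by auto
  then obtain i where i: "i < n" "?s (Suc i) \<noteq> Suc i" by blast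
  obtain c :: "nat \<Rightarrow> 'u" where c: "inj c" using infinite_countable_subset[OF inf] by blast
  \<comment> \<open>Pairs of truth values are coded in binary by the first four values of
    \<open>c\<close>; \<open>d\<close> codes single truth values by the first two. Overlap of the
    two codes is harmless, as they belong to different categories.\<close>
  define e :: "bool \<times> bool \<Rightarrow> 'u" where "e = (\<lambda>(a, b). c (of_bool a + 2 * of_bool b))"
  have e: "inj e" by (rule injI) (auto simp: e_def of_bool_def dest!: injD[OF c] split: if_splits)
  define d :: "bool \<Rightarrow> 'u" where "d = (\<lambda>a. c (of_bool a))"
  have d: "inj d" by (rule injI) (auto simp: d_def of_bool_def dest!: injD[OF c] split: if_splits)
  define W where "W = discrete (range e)"
  define A where "A = discrete (range d)"
  define C where "C = discrete {c 0}"
  let ?h1 = "d \<circ> fst \<circ> inv' e" and ?h2 = "d \<circ> snd \<circ> inv' e"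
  define f1 where "f1 = \<lparr>FObj = ?h1, FArr = ?h1\<rparr>"
  define f2 where "f2 = \<lparr>FObj = ?h2, FArr = ?h2\<rparr>"
  define z :: "('u, 'u, 'u, 'u) ftr" where "z = \<lparr>FObj = (\<lambda>_. c 0), FArr = (\<lambda>_. c 0)\<rparr>"
  have cats: "is_cat W" "is_cat A" "is_cat C" by (simp_all add: W_def A_def C_def is_cat_discrete)
  have fr: "is_functor W A f1" "is_functor W A f2" "is_functor A C z"
    unfolding W_def A_def C_def f1_def f2_def z_def by (auto intro!: is_functor_discrete_discrete)
  have sp: "set_pullback (range e) (range d) (range d) ?h1 ?h2 (\<lambda>_. c 0) (\<lambda>_. c 0)"
    unfolding set_pullback_def
  proof (intro conjI ballI impI)
    fix a b assume "a \<in> range d" "b \<in> range d"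
    then obtain x y where "a = d x" "b = d y" by blast
    thus "\<exists>w\<in>range e. ?h1 w = a \<and> ?h2 w = b"
        by (intro bexI[of _ "e (x, y)"]) (simp_all add: inv_f_f[OF e])
  qed (auto simp: inv_f_f[OF e] inj_eq[OF d])
  have "two_pullback TYPE('u) W A A C f1 f2 z z"
  proof (rule two_pullbackI)
    show "set_pullback (Obj W) (Obj A) (Obj A) (FObj f1) (FObj f2) (FObj z) (FObj z)"
      "set_pullback (Arr W) (Arr A) (Arr A) (FArr f1) (FArr f2) (FArr z) (FArr z)"
      using sp by (simp_all add: W_def A_def f1_def f2_def z_def discrete_def)
  qed (use cats fr in auto)
  with tc have "two_pullback TYPE('u) (T_cat L P W) (T_cat L P A) (T_cat L P A) (T_cat L P C)
     (T_map L P W A f1) (T_map L P W A f2) (T_map L P A C z) (T_map L P A C z)"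
    unfolding two_cartesian_def by blast
  note pb = two_pullbackD(9)[OF this]
  have F: "FObj f1 \<in> Obj W \<rightarrow> Obj A" "FObj f2 \<in> Obj W \<rightarrow> Obj A"
      using functor_simps(1)[OF fr(1)] functor_simps(1)[OF fr(2)] by auto
  note m1 = obc.tens_map_eq[OF presents_T_obj[OF cats(1)] presents_T_obj[OF cats(2)] F(1), folded
      FObj_T_map, simplified]
    and m2 = obc.tens_map_eq[OF presents_T_obj[OF cats(1)] presents_T_obj[OF cats(2)] F(2), folded
        FObj_T_map, simplified]
  \<comment> \<open>The indicator of position \<open>i\<close>: a permutation fixes this tuple only
    if it fixes \<open>Suc i\<close>.\<close>
  define xs where "xs = map (\<lambda>j. j = i) [0..<n]"
  have lx: "length xs = n" by (simp add: xs_def)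
  \<comment> \<open>\<open>ws\<close> is the diagonal tuple, and in \<open>ws'\<close> the second
    coordinates are permuted by \<open>?s\<close>.\<close>
  define ws where "ws = map e (zip xs xs)"
  define ws' where "ws' = map e (zip xs (perm_tuple ?s xs))"
  have t: "ws \<in> tuples (Obj W) n" "ws' \<in> tuples (Obj W) n" using lx
      by (auto simp: ws_def ws'_def tuples_def W_def discrete_def)
  have td: "map d ys \<in> tuples (Obj A) n" if "length ys = n" for ys
    using that by (auto simp: tuples_def A_def discrete_def)
  have h: "map (FObj f1) ws = map d xs" "map (FObj f1) ws' = map d xs" "map (FObj f2) ws = map d xs"
    "map (FObj f2) ws' = perm_tuple ?s (map d xs)"
    using lx perm_Prm[OF g lx, of d] by (auto simp: ws_def ws'_def f1_def f2_def inv_f_f[OF e]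
        intro!: nth_equalityI simp flip: perm_Prm[OF g lx])
  \<comment> \<open>The stabilizer hypothesis enters here: it moves \<open>g\<close> from the tuple
    to \<open>p\<close>, where it disappears. Hence \<open>ws\<close> and \<open>ws'\<close> have
    the same second projection as well.\<close>
  have "T_obj L P A n p (perm_tuple ?s (map d xs)) = T_obj L P A n p (map d xs)"
    using obc.presentsD[OF presents_T_obj[OF cats(2)], of p n "perm_tuple ?s (map d xs)" p n
        "map d xs"]
      obc.rel_act[of p n g "map d xs"] obc.perm_tuple_tuples[OF g td[OF lx]] td[OF lx] p g pg
          by simp
  moreover have "T_obj L P W n p ws \<in> Obj (T_cat L P W)" "T_obj L P W n p ws' \<in> Obj (T_cat L P W)"
    unfolding Obj_T using p t by (auto intro: tens_I)
  ultimately have "T_obj L P W n p ws = T_obj L P W n p ws'"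
    using set_pullback_unique[OF pb, of "T_obj L P W n p ws" "T_obj L P W n p ws'"] p t
        m1[OF p t(1)] m1[OF p t(2)]
      m2[OF p t(1)] m2[OF p t(2)] h by simp
  hence "obc.rel n p ws p ws'"
    using obc.presentsD[OF presents_T_obj[OF cats(1)], of p n ws p n ws'] p t by simp
  then obtain k where k: "k \<in> G n" "ws = perm_tuple (Prm L n k) ws'" unfolding obc.rel_def by blast
  let ?k = "Prm L n k"
  have lw: "length ws' = n" using lx by (simp add: ws'_def)
  \<comment> \<open>The relating element \<open>k\<close> need not be \<open>g\<close>. Its action
    on first coordinates fixes \<open>xs\<close>, while on second coordinates it carries the
    permuted \<open>xs\<close> to \<open>xs\<close>; comparing the two and cancelling
    \<open>?k\<close> shows that \<open>?s\<close> fixes \<open>xs\<close>.\<close>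
  have "map (fst \<circ> inv' e) ws = perm_tuple ?k (map (fst \<circ> inv' e) ws')"
    "map (snd \<circ> inv' e) ws = perm_tuple ?k (map (snd \<circ> inv' e) ws')"
    unfolding k(2) using perm_Prm[OF k(1) lw] by blast+
  moreover have "map (fst \<circ> inv' e) ws = xs" "map (fst \<circ> inv' e) ws' = xs" "map (snd \<circ> inv' e) ws =
      xs"
    "map (snd \<circ> inv' e) ws' = perm_tuple ?s xs"
    using lx by (auto simp: ws_def ws'_def inv_f_f[OF e] intro!: nth_equalityI)
  ultimately have kk: "perm_tuple ?k xs = perm_tuple ?k (perm_tuple ?s xs)" by simp
  have ki: "perm_tuple (inv' ?k) (perm_tuple ?k ys) = ys" if "length ys = n" for ys :: "bool list"
    using perm_tuple_inv(2)[of ?k ys] Prm_permutes[OF k(1)] that by simp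
  have xx: "xs = perm_tuple ?s xs"
    using arg_cong[OF kk, of "perm_tuple (inv' ?k)"]
        unfolding ki[OF lx] ki[OF HOL.trans[OF length_perm_tuple lx]] .
  note q = nth_perm_tuple_image[of ?s xs i]
  have "perm_tuple ?s xs ! (?s (Suc i) - 1) = xs ! i" using q(3) s lx i by simp
  hence "xs ! (?s (Suc i) - 1) = xs ! i" unfolding xx[symmetric] .
  moreover have "xs ! i" using i by (simp add: xs_def)
  moreover have "?s (Suc i) - 1 < n" "?s (Suc i) - 1 \<noteq> i" using q(1,2) s lx i by auto
  hence "\<not> xs ! (?s (Suc i) - 1)" by (simp add: xs_def)
  ultimately show False by simp
qed

end

theorem theorem14p9:
  fixes L :: "'g action_operad"
    and P :: "('g, 'o, 'a) lam_operad"
  assumes "infinite (UNIV :: 'u set)"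
    and "is_action_operad L"
    and "is_lam_operad L P"
  shows "two_cartesian TYPE('u) L P \<longleftrightarrow>
    (\<forall>n. \<forall>p \<in> Obj (PCat P n). \<forall>g \<in> carrier (Grp L n).
       FObj (PAct P n g) p = p \<longrightarrow> g \<in> kernel (Grp L n) (sym_group n) (Prm L n))"
proof -
  interpret lam_op L P by unfold_locales (fact assms)+
  have kernel: "g \<in> kernel (Grp L n) (sym_group n) (Prm L n) \<longleftrightarrow> g \<in> G n \<and> Prm L n g = id" for n g
    by (simp add: kernel_def sym_group_one)
  show ?thesis
  proof
    assume "two_cartesian TYPE('u) L P"
    thus "\<forall>n. \<forall>p \<in> Obj (PCat P n). \<forall>g \<in> carrier (Grp L n).
       FObj (PAct P n g) p = p \<longrightarrow> g \<in> kernel (Grp L n) (sym_group n) (Prm L n)"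
      unfolding kernel using stabilizer_in_kernel[OF assms(1)] by blast
  next
    assume "\<forall>n. \<forall>p \<in> Obj (PCat P n). \<forall>g \<in> carrier (Grp L n).
       FObj (PAct P n g) p = p \<longrightarrow> g \<in> kernel (Grp L n) (sym_group n) (Prm L n)"
    then interpret free_lam_op L P by unfold_locales (auto simp: kernel)
    show "two_cartesian TYPE('u) L P" by (rule two_cartesian_if_free)
  qed
qed

end
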